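(* Let $k\ge 1$ be an integer, let $\Omega$ be a macro element, let $\bar f\in C^{k+2}(\Omega;\mathbb R)$, and let $\overline{\mathcal T}_{h,\Omega}$ with $h<h_0$ be a symmetric triangulation of $\Omega$. Let $\bar f_h=\bar I_h^k(\bar f)\in C^0(\Omega;\mathbb R)$ be the piecewise Lagrange interpolation of degree $k$. Let $\bar g\in W^{1,1}(\Omega)$, and let $\vec\beta\in\mathbb N_0^2$ satisfy $0\le|\vec\beta|\le k+2$ with $k+2-|\vec\beta|$ even. Then $$\left|\sum_{T\in\overline{\mathcal T}_{h,\Omega}}\int_T\bar g\,\big(\bar D^{\vec\beta}\bar f_h-\bar D^{\vec\beta}\bar f\big)\,d\bar\sigma\right|\le C\,h^{k+2-|\vec\beta|}\,\|\bar g\|_{W^{1,1}(\Omega)}\,\|\bar f\|_{C^{k+2}(\Omega)},$$ with a constant $C$ independent of $h$, $\bar f$ and $\bar g$.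
   Context: A macro element $\Omega$ is a fixed nondegenerate closed planar triangle (one of the finitely many triangles of a fixed macro grid of mesh size $h_0$). After choosing an orthonormal basis of its plane, $\Omega\subset\mathbb R^2$; $\bar D^{\vec\beta}$ denotes partial derivatives with multi-index $\vec\beta$ and $d\bar\sigma$ is Lebesgue measure. For $h<h_0$, $\overline{\mathcal T}_{h,\Omega}$ is a conforming triangulation of $\Omega$ into closed triangles; the family of triangulations is uniformly shape regular and quasi-uniform with mesh size $h$ (the maximal element diameter). Constants may depend on $\Omega$, on $k$, and on the shape-regularity and quasi-uniformity constants. Interpolation: $T_{\mathrm{ref}}$ is the reference triangle (with a vertex at $0$), $F_T:T_{\mathrm{ref}}\to T$ is an affine bijection, and $\hat I^k$ is Lagrange interpolation by polynomials of degree $k$ at the standard degree-$k$ Lagrange nodes of $T_{\mathrm{ref}}$. Then $\bar I_h^k(\bar f)|_T=\hat I^k(\bar f\circ F_T)\circ F_T^{-1}$ for every $T\in\overline{\mathcal T}_{h,\Omega}$. Derivatives of $\bar f_h$ are taken elementwise. Symmetric pair: two elements $T_1,T_2\in\overline{\mathcal T}_{h,\Omega}$ form a symmetric pair if $T_1\cap T_2=\{\bar x_0\}$ is a single point and there are affine reference maps $F_{T_i}:T_{\mathrm{ref}}\to T_i$ (onto) with $F_{T_1}(0)=F_{T_2}(0)=\bar x_0$ and $F_{T_1}(\xi)-\bar x_0=\bar x_0-F_{T_2}(\xi)$ for all $\xi\in T_{\mathrm{ref}}$. Symmetric triangulation: $\overline{\mathcal T}_{h,\Omega}$ is symmetric if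 it is a disjoint union $\mathcal A_{h,\Omega}\,\dot\cup\,\mathcal B_{h,\Omega}$, where $\mathcal A_{h,\Omega}$ can be partitioned into disjoint symmetric pairs, and the unpaired elements satisfy $\bigcup_{T\in\mathcal B_{h,\Omega}}T\subset\{\bar x\in\Omega:\operatorname{dist}(\bar x,\partial\Omega)\le h\}$ and hence $|\mathcal B_{h,\Omega}|\le C_{\partial\Omega}h^{-1}$, with $C_{\partial\Omega}$ depending only on $\Omega$ and the shape-regularity and quasi-uniformity constants. *)

theory Defs
  imports "HOL-Analysis.Analysis"
begin

subsection \<open>Partial derivatives and \<open>C\<^sup>m\<close> functions on the plane\<close>

definition mi_order :: "nat^2 \<Rightarrow> nat" where
  "mi_order \<beta> = (\<Sum>i\<in>UNIV. \<beta> $ i)"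

text \<open>Sums over the set below are sums over a finite set.\<close>

lemma finite_mi_order_le: "finite {\<beta>. mi_order \<beta> \<le> m}"
proof -
  have "inj_on (\<lambda>\<beta>::nat^2. (\<beta> $ 1, \<beta> $ 2)) A" for A
    by (auto simp: inj_on_def vec_eq_iff forall_2)
  moreover have "(\<lambda>\<beta>::nat^2. (\<beta> $ 1, \<beta> $ 2)) ` {\<beta>. mi_order \<beta> \<le> m} \<subseteq> {..m} \<times> {..m}"
    by (auto simp: mi_order_def sum_2)
  ultimately show ?thesis
    by (meson finite_SigmaI finite_atMost finite_imageD finite_subset)
qed

definition partial :: "2 \<Rightarrow> (real^2 \<Rightarrow> real) \<Rightarrow> real^2 \<Rightarrow> real" where
  "partial i f x = deriv (\<lambda>t. f (x + t *\<^sub>R axis i 1)) 0"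

definition mi_deriv :: "nat^2 \<Rightarrow> (real^2 \<Rightarrow> real) \<Rightarrow> real^2 \<Rightarrow> real" where
  "mi_deriv \<beta> f = (partial 1 ^^ (\<beta> $ 1)) ((partial 2 ^^ (\<beta> $ 2)) f)"

text \<open>\<open>C\<^sup>m\<close> on an open set.\<close>

fun Cdiff_on :: "nat \<Rightarrow> (real^2) set \<Rightarrow> (real^2 \<Rightarrow> real) \<Rightarrow> bool" where
  "Cdiff_on 0 U f \<longleftrightarrow> continuous_on U f"
| "Cdiff_on (Suc m) U f \<longleftrightarrow>
     (\<forall>x\<in>U. f differentiable (at x)) \<and> (\<forall>i. Cdiff_on m U (partial i f))"

text \<open>\<open>C\<^sup>m(\<Omega>)\<close> for a closed set \<open>\<Omega>\<close> with nonempty interior: all derivatives up to order \<open>m\<close> exist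
  in the interior and extend continuously to \<open>\<Omega>\<close>. The values of \<open>mi_deriv \<beta> f\<close> on the boundary of
  \<open>\<Omega>\<close> are meaningless (they involve values of \<open>f\<close> outside \<open>\<Omega>\<close>), so they are never used.\<close>

definition Cm_space :: "nat \<Rightarrow> (real^2) set \<Rightarrow> (real^2 \<Rightarrow> real) set" where
  "Cm_space m \<Omega> = {f. continuous_on \<Omega> f \<and> Cdiff_on m (interior \<Omega>) f \<and>
     (\<forall>\<beta>. mi_order \<beta> \<le> m \<longrightarrow>
        (\<exists>G. continuous_on \<Omega> G \<and> (\<forall>x\<in>interior \<Omega>. G x = mi_deriv \<beta> f x)))}"

definition Cm_norm :: "nat \<Rightarrow> (real^2) set \<Rightarrow> (real^2 \<Rightarrow> real) \<Rightarrow> real" where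
  "Cm_norm m \<Omega> f = (\<Sum>\<beta>\<in>{\<beta>. mi_order \<beta> \<le> m}. SUP x\<in>interior \<Omega>. \<bar>mi_deriv \<beta> f x\<bar>)"

subsection \<open>The Sobolev space \<open>W\<^sup>1\<^sup>,\<^sup>1\<close>\<close>

definition test_function :: "(real^2) set \<Rightarrow> (real^2 \<Rightarrow> real) \<Rightarrow> bool" where
  "test_function U \<phi> \<longleftrightarrow> (\<forall>m. Cdiff_on m UNIV \<phi>) \<and>
     compact (closure {x. \<phi> x \<noteq> 0}) \<and> closure {x. \<phi> x \<noteq> 0} \<subseteq> U"

definition has_weak_partial :: "(real^2) set \<Rightarrow> 2 \<Rightarrow> (real^2 \<Rightarrow> real) \<Rightarrow> (real^2 \<Rightarrow> real) \<Rightarrow> bool" where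
  "has_weak_partial U i g v \<longleftrightarrow> set_integrable lebesgue U v \<and>
     (\<forall>\<phi>. test_function U \<phi> \<longrightarrow>
        (LINT x:U|lebesgue. g x * partial i \<phi> x) = - (LINT x:U|lebesgue. v x * \<phi> x))"

text \<open>\<open>W\<^sup>1\<^sup>,\<^sup>1(\<Omega>)\<close> lives on the interior of \<open>\<Omega>\<close>. Weak derivatives are unique almost everywhere,
  so the choice in \<open>weak_partial\<close> does not affect the norm.\<close>

definition W11_space :: "(real^2) set \<Rightarrow> (real^2 \<Rightarrow> real) set" where
  "W11_space \<Omega> = {g. set_integrable lebesgue (interior \<Omega>) g \<and>
     (\<forall>i. \<exists>v. has_weak_partial (interior \<Omega>) i g v)}"

definition weak_partial :: "(real^2) set \<Rightarrow> 2 \<Rightarrow> (real^2 \<Rightarrow> real) \<Rightarrow> real^2 \<Rightarrow> real" where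
  "weak_partial U i g = (SOME v. has_weak_partial U i g v)"

definition W11_norm :: "(real^2) set \<Rightarrow> (real^2 \<Rightarrow> real) \<Rightarrow> real" where
  "W11_norm \<Omega> g = (LINT x:interior \<Omega>|lebesgue. \<bar>g x\<bar>) +
     (\<Sum>i\<in>UNIV. LINT x:interior \<Omega>|lebesgue. \<bar>weak_partial (interior \<Omega>) i g x\<bar>)"

subsection \<open>Triangulations\<close>

text \<open>The library's \<open>triangulation\<close> is finite and requires any two members to meet in a
  (possibly empty) common face, which is conformity.\<close>

definition conforming_triangulation_of :: "(real^2) set \<Rightarrow> (real^2) set set \<Rightarrow> bool" where
  "conforming_triangulation_of \<Omega> \<T> \<longleftrightarrow>
     triangulation \<T> \<and> (\<forall>T\<in>\<T>. 2 simplex T) \<and> \<Union>\<T> = \<Omega>"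

definition mesh_size :: "(real^2) set set \<Rightarrow> real" where
  "mesh_size \<T> = Max (diameter ` \<T>)"

definition inradius :: "(real^2) set \<Rightarrow> real" where
  "inradius T = Sup {r. 0 \<le> r \<and> (\<exists>c. cball c r \<subseteq> T)}"

definition shape_regular :: "real \<Rightarrow> (real^2) set set \<Rightarrow> bool" where
  "shape_regular \<sigma> \<T> \<longleftrightarrow> (\<forall>T\<in>\<T>. diameter T \<le> \<sigma> * inradius T)"

definition quasi_uniform :: "real \<Rightarrow> (real^2) set set \<Rightarrow> bool" where
  "quasi_uniform q \<T> \<longleftrightarrow> (\<forall>T\<in>\<T>. mesh_size \<T> \<le> q * diameter T)"

definition T_ref :: "(real^2) set" where
  "T_ref = convex hull {0, axis 1 1, axis 2 1}"

text \<open>Reference maps are affine maps of the whole plane; they are considered on \<open>T_ref\<close>.\<close>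

definition reference_map :: "(real^2) set \<Rightarrow> (real^2 \<Rightarrow> real^2) \<Rightarrow> bool" where
  "reference_map T F \<longleftrightarrow> linear (\<lambda>\<xi>. F \<xi> - F 0) \<and> bij_betw F T_ref T"

definition symmetric_pair :: "(real^2) set \<Rightarrow> (real^2) set \<Rightarrow> bool" where
  "symmetric_pair T1 T2 \<longleftrightarrow> (\<exists>x0 F1 F2. T1 \<inter> T2 = {x0} \<and>
     reference_map T1 F1 \<and> reference_map T2 F2 \<and> F1 0 = x0 \<and> F2 0 = x0 \<and>
     (\<forall>\<xi>\<in>T_ref. F1 \<xi> - x0 = x0 - F2 \<xi>))"

text \<open>The bound \<open>card B \<le> C / h\<close> on the number of unpaired elements follows from the inclusion
  in the boundary strip together with shape regularity and quasi-uniformity, so it is not part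
  of the definition.\<close>

definition symmetric_triangulation :: "(real^2) set \<Rightarrow> (real^2) set set \<Rightarrow> bool" where
  "symmetric_triangulation \<Omega> \<T> \<longleftrightarrow> (\<exists>A B. \<T> = A \<union> B \<and> A \<inter> B = {} \<and>
     (\<exists>P. partition_on A P \<and> (\<forall>p\<in>P. \<exists>T1 T2. p = {T1, T2} \<and> symmetric_pair T1 T2)) \<and>
     \<Union>B \<subseteq> {x \<in> \<Omega>. infdist x (frontier \<Omega>) \<le> mesh_size \<T>})"

subsection \<open>Lagrange interpolation\<close>

definition poly_deg_le :: "nat \<Rightarrow> (real^2 \<Rightarrow> real) \<Rightarrow> bool" where
  "poly_deg_le k p \<longleftrightarrow>
     (\<exists>c. p = (\<lambda>x. \<Sum>\<alpha>\<in>{\<alpha>. mi_order \<alpha> \<le> k}. c \<alpha> * (\<Prod>i\<in>UNIV. (x $ i) ^ (\<alpha> $ i))))"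

definition lagrange_nodes :: "nat \<Rightarrow> (real^2) set" where
  "lagrange_nodes k = (\<lambda>\<alpha>. \<chi> i. real (\<alpha> $ i) / real k) ` {\<alpha>. mi_order \<alpha> \<le> k}"

definition ref_interpolant :: "nat \<Rightarrow> (real^2 \<Rightarrow> real) \<Rightarrow> real^2 \<Rightarrow> real" where
  "ref_interpolant k u = (THE p. poly_deg_le k p \<and> (\<forall>\<xi>\<in>lagrange_nodes k. p \<xi> = u \<xi>))"

text \<open>For \<open>x\<close> in several elements the local interpolants agree, so the choice of the element is
  immaterial. In the interior of an element \<open>T\<close> the function coincides locally with the polynomial
  of \<open>T\<close>, hence \<open>mi_deriv \<beta>\<close> of it is the elementwise derivative off the null set of element
  boundaries.\<close>

definition lagrange_interpolant ::
  "nat \<Rightarrow> (real^2) set set \<Rightarrow> ((real^2) set \<Rightarrow> real^2 \<Rightarrow> real^2) \<Rightarrow> (real^2 \<Rightarrow> real) \<Rightarrow> real^2 \<Rightarrow> real"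
where
  "lagrange_interpolant k \<T> F f x =
     (let T = (SOME T. T \<in> \<T> \<and> x \<in> T)
      in ref_interpolant k (f \<circ> F T) (inv_into T_ref (F T) x))"

end

theory Submission
  imports Defs
begin

text \<open>
  On an element the interpolation error of \<open>f\<close> is, up to terms of the desired order, the error
  \<open>E\<close> for the homogeneous part of degree \<open>k + 1\<close> of the Taylor polynomial of \<open>f\<close> at a point \<open>c\<close>.
  On a symmetric pair with common vertex \<open>c\<close>, the derivative of \<open>E\<close> of order \<open>|\<beta>|\<close> is odd about \<open>c\<close>
  because \<open>k + 1 - |\<beta>|\<close> is odd. It therefore has mean zero, and a Poincare inequality for \<open>g\<close> gains
  the missing factor \<open>h\<close>. The unpaired elements lie in a boundary strip of width \<open>h\<close>, where a trace
  inequality for \<open>g\<close> gains the same factor.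

  Both inequalities for \<open>g\<close> are proved in dual form, without approximating \<open>g\<close> by smooth functions:
  for a smooth test function \<open>\<psi>\<close>, the definition of weak derivatives bounds the integral of
  \<open>g y * (\<psi> (y - a) - \<psi> y)\<close>, and this bound extends to bounded \<open>\<psi>\<close> that are continuous almost
  everywhere, such as piecewise polynomials. Averaging over all translations \<open>a\<close> of a convex set
  into itself yields the Poincare inequality; moving a slab at the boundary step by step into the
  interior yields the trace inequality.
\<close>

subsection \<open>Calculus of \<open>C\<^sup>m\<close> functions\<close>

text \<open>Classical interpolation theory gives the order \<open>k + 1 - mi_order \<beta>\<close>
  on each element, one power of h short of the claim. By parity, either
  \<open>mi_order \<beta> = k + 2\<close>, where the interpolant contributes nothing and the bound
  is immediate, or \<open>mi_order \<beta> \<le> k\<close>, where the missing power has to come from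
  g. An obstacle is that derivatives of f are available only in the interior of \<Omega>, so a
  Taylor centre must be an interior point. The common vertex of a pair always is one, because
  \<Omega> is convex and contains a triangle together with its reflection about that vertex. Oddness
  of the error also requires that interpolation commutes with this reflection; both sides are
  polynomials with the same nodal values. A single number \<kappa> measures the mesh: every element
  contains a ball of radius \<open>\<kappa> * h\<close>. It controls the derivatives of the basis
  polynomials, the area in the Poincare inequality, and the number of balls about pairs that cover
  one point. The last count allows the local estimates of all pairs to be summed without a loss that
  grows with the number of pairs.\<close>

lemma partial_eq:
  assumes "(f has_derivative f') (at x)"
  shows "partial i f x = f' (axis i 1)"
proof -
  have 1: "((\<lambda>t. x + t *\<^sub>R axis i (1::real)) has_derivative (\<lambda>t. t *\<^sub>R axis i 1)) (at 0)"
    by (auto intro!: derivative_eq_intros)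
  have "((\<lambda>t. f (x + t *\<^sub>R axis i 1)) has_derivative (\<lambda>t. f' (t *\<^sub>R axis i 1))) (at 0)"
    using has_derivative_compose[OF 1, of f f'] assms by simp
  moreover have "f' (t *\<^sub>R axis i 1) = t * f' (axis i 1)" for t
    using has_derivative_linear[OF assms] by (simp add: linear_cmul)
  ultimately have "((\<lambda>t. f (x + t *\<^sub>R axis i 1)) has_real_derivative f' (axis i 1)) (at 0)"
    by (simp add: has_field_derivative_def mult.commute[of _ "f' _"] mult_commute_abs)
  then show ?thesis unfolding partial_def by (rule DERIV_imp_deriv)
qed

lemma differentiable_partial:
  assumes "f differentiable (at x)"
  shows "(f has_derivative (\<lambda>d. \<Sum>i\<in>UNIV. d $ i * partial i f x)) (at x)"
proof -
  obtain f' where f': "(f has_derivative f') (at x)"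
    using assms by (auto simp: differentiable_def)
  have "f' d = (\<Sum>i\<in>UNIV. d $ i * partial i f x)" for d
  proof -
    have "f' d = f' (\<Sum>i\<in>UNIV. d $ i *\<^sub>R axis i 1)"
      using basis_expansion[of d] by (simp add: scalar_mult_eq_scaleR)
    also have "\<dots> = (\<Sum>i\<in>UNIV. d $ i * partial i f x)"
      using has_derivative_linear[OF f'] by (simp add: linear_sum linear_cmul partial_eq[OF f'])
    finally show ?thesis .
  qed
  then show ?thesis using f' by (metis (no_types, lifting) ext)
qed

lemma partial_cong:
  assumes "open U" "x \<in> U" "\<And>y. y \<in> U \<Longrightarrow> f y = g y"
  shows "partial i f x = partial i g x"
proof -
  have "((\<lambda>t. x + t *\<^sub>R axis i (1::real)) \<longlongrightarrow> x) (at 0)"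
    by (auto intro!: tendsto_eq_intros)
  then have "\<forall>\<^sub>F t in at 0. x + t *\<^sub>R axis i 1 \<in> U"
    using assms by (auto simp: tendsto_def)
  then have "\<forall>\<^sub>F t in nhds 0. x + t *\<^sub>R axis i 1 \<in> U"
    using assms(2) by (simp add: eventually_nhds_conv_at)
  then have "\<forall>\<^sub>F t in nhds 0. f (x + t *\<^sub>R axis i 1) = g (x + t *\<^sub>R axis i 1)"
    by eventually_elim (use assms in auto)
  then show ?thesis unfolding partial_def by (intro deriv_cong_ev) auto
qed

lemma Cdiff_on_cong:
  assumes "open U" "\<And>y. y \<in> U \<Longrightarrow> f y = g y" "Cdiff_on m U f"
  shows "Cdiff_on m U g"
  using assms(2,3)
proof (induction m arbitrary: f g)
  case 0
  then show ?case using continuous_on_cong[of U U f g] by auto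
next
  case (Suc m)
  have "g differentiable (at x)" if "x \<in> U" for x
  proof -
    have "f differentiable (at x)" using Suc that by simp
    then obtain f' where "(f has_derivative f') (at x)" by (auto simp: differentiable_def)
    then have "(g has_derivative f') (at x)"
      using has_derivative_transform_within_open[OF _ assms(1) that] Suc.prems(1) by blast
    then show ?thesis by (auto simp: differentiable_def)
  qed
  moreover have "Cdiff_on m U (partial i g)" for i
    using Suc.IH[of "partial i f" "partial i g"] Suc.prems partial_cong[OF assms(1) _ Suc.prems(1)]
    by simp
  ultimately show ?case by simp
qed

lemma Cdiff_on_Suc_imp: "Cdiff_on (Suc m) U f \<Longrightarrow> Cdiff_on m U f"
proof (induction m arbitrary: f)
  case 0
  then show ?case
    by (auto intro!: continuous_at_imp_continuous_on differentiable_imp_continuous_within)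
next
  case (Suc m)
  then show ?case by (metis Cdiff_on.simps(2))
qed

lemma Cdiff_on_le: "Cdiff_on n U f \<Longrightarrow> m \<le> n \<Longrightarrow> Cdiff_on m U f"
  by (induction n) (auto simp: le_Suc_eq dest: Cdiff_on_Suc_imp simp del: Cdiff_on.simps)

lemma Cdiff_on_subset: "Cdiff_on m U f \<Longrightarrow> V \<subseteq> U \<Longrightarrow> Cdiff_on m V f"
  by (induction m arbitrary: f) (auto intro: continuous_on_subset)

text \<open>The closure properties below mostly take this form: exhibit a total derivative and apply
  the induction hypothesis to its values on the axis vectors, which are the partial derivatives up
  to congruence on the open set.\<close>

lemma Cdiff_on_SucI:
  assumes "open U" "\<And>x. x \<in> U \<Longrightarrow> (f has_derivative f' x) (at x)"
    "\<And>i. Cdiff_on m U (\<lambda>x. f' x (axis i 1))"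
  shows "Cdiff_on (Suc m) U f"
proof -
  have "Cdiff_on m U (partial i f)" for i
    by (rule Cdiff_on_cong[OF assms(1) _ assms(3)[of i]]) (use partial_eq[OF assms(2)] in auto)
  moreover have "f differentiable (at x)" if "x \<in> U" for x
    using assms(2) that by (auto simp: differentiable_def)
  ultimately show ?thesis by simp
qed

lemma Cdiff_on_Suc_derivative:
  assumes "Cdiff_on (Suc m) U f" "x \<in> U"
  shows "(f has_derivative (\<lambda>d. \<Sum>i\<in>UNIV. d $ i * partial i f x)) (at x)"
  using assms by (auto intro: differentiable_partial)

lemma axis_sum: "(\<Sum>j\<in>UNIV. axis i (1::real) $ j * g j) = g (i::2)"
  by (simp add: axis_def if_distrib[where f="\<lambda>x. x * _"] cong: if_cong)

lemma Cdiff_on_const: "open U \<Longrightarrow> Cdiff_on m U (\<lambda>x. c)"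
proof (induction m arbitrary: c)
  case (Suc m)
  show ?case
    by (rule Cdiff_on_SucI[OF Suc.prems, where f'="\<lambda>x d. 0"]) (use Suc in auto)
qed auto

lemma Cdiff_on_component: "open U \<Longrightarrow> Cdiff_on m U (\<lambda>x. x $ i)"
proof (cases m)
  case (Suc n)
  assume "open U"
  then show ?thesis unfolding Suc
    by (intro Cdiff_on_SucI[where f'="\<lambda>x d. d $ i"])
      (auto intro!: bounded_linear_imp_has_derivative bounded_linear_vec_nth Cdiff_on_const)
qed (auto intro!: continuous_intros)

lemma Cdiff_on_add:
  assumes "open U"
  shows "Cdiff_on m U f \<Longrightarrow> Cdiff_on m U g \<Longrightarrow> Cdiff_on m U (\<lambda>x. f x + g x)"
proof (induction m arbitrary: f g)
  case (Suc m)
  show ?case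
    by (rule Cdiff_on_SucI[OF assms has_derivative_add[OF
          Cdiff_on_Suc_derivative[OF Suc.prems(1)] Cdiff_on_Suc_derivative[OF Suc.prems(2)]]])
      (use Suc in \<open>auto simp: axis_sum\<close>)
qed (auto intro: continuous_intros)

lemma Cdiff_on_sum:
  assumes "open U"
  shows "(\<And>j. j \<in> J \<Longrightarrow> Cdiff_on m U (f j)) \<Longrightarrow> Cdiff_on m U (\<lambda>x. \<Sum>j\<in>J. f j x)"
  by (induction J rule: infinite_finite_induct)
    (auto intro: Cdiff_on_const Cdiff_on_add assms)

lemma Cdiff_on_mult:
  assumes "open U"
  shows "Cdiff_on m U f \<Longrightarrow> Cdiff_on m U g \<Longrightarrow> Cdiff_on m U (\<lambda>x. f x * g x)"
proof (induction m arbitrary: f g)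
  case (Suc m)
  have "Cdiff_on m U f" "Cdiff_on m U g"
    using Suc.prems by (auto intro: Cdiff_on_Suc_imp simp del: Cdiff_on.simps)
  then show ?case
    by (intro Cdiff_on_SucI[OF assms has_derivative_mult[OF
          Cdiff_on_Suc_derivative[OF Suc.prems(1)] Cdiff_on_Suc_derivative[OF Suc.prems(2)]]])
      (use Suc in \<open>auto simp: axis_sum intro!: Cdiff_on_add assms\<close>)
qed (auto intro: continuous_intros)

lemma Cdiff_on_power:
  assumes "open U"
  shows "Cdiff_on m U f \<Longrightarrow> Cdiff_on m U (\<lambda>x. f x ^ n)"
  by (induction n) (auto intro: Cdiff_on_const Cdiff_on_mult assms)

lemma Cdiff_on_prod:
  assumes "open U"
  shows "(\<And>j. j \<in> J \<Longrightarrow> Cdiff_on m U (f j)) \<Longrightarrow> Cdiff_on m U (\<lambda>x. \<Prod>j\<in>J. f j x)"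
  by (induction J rule: infinite_finite_induct)
    (auto intro: Cdiff_on_const Cdiff_on_mult assms)

lemma Cdiff_on_inverse:
  assumes "open U" "\<And>x. x \<in> U \<Longrightarrow> f x \<noteq> 0"
  shows "Cdiff_on m U f \<Longrightarrow> Cdiff_on m U (\<lambda>x. inverse (f x))"
proof (induction m)
  case 0
  then show ?case using assms by (auto intro!: continuous_intros)
next
  case (Suc m)
  have f: "Cdiff_on m U f" "\<And>i. Cdiff_on m U (partial i f)"
    using Suc.prems by (auto intro: Cdiff_on_Suc_imp simp del: Cdiff_on.simps(1))
  have *: "Cdiff_on m U (\<lambda>x. (-1) * (inverse (f x) * partial i f x * inverse (f x)))" for i
    by (intro Cdiff_on_mult assms Cdiff_on_const f Suc.IH)
  show ?case
    by (rule Cdiff_on_SucI[OF assms(1) Deriv.has_derivative_inverse[OF assms(2)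
          Cdiff_on_Suc_derivative[OF Suc.prems]]]) (use * in \<open>auto simp: axis_sum\<close>)
qed

text \<open>Covers the translations, the reflection and the rescalings used below. Each partial
  derivative of the composition is a multiple of the same partial derivative of f, so the induction
  closes without mixing directions.\<close>

lemma Cdiff_on_scale_translate:
  "Cdiff_on m UNIV f \<Longrightarrow> Cdiff_on m UNIV (\<lambda>x. f (c *\<^sub>R x + b))"
proof (induction m arbitrary: f)
  case 0
  then show ?case by (auto intro!: continuous_on_compose2[of UNIV f] continuous_intros)
next
  case (Suc m)
  have 1: "((\<lambda>x. c *\<^sub>R x + b) has_derivative (\<lambda>d. c *\<^sub>R d)) (at x)" for x
    by (auto intro!: derivative_eq_intros)
  have "((\<lambda>x. f (c *\<^sub>R x + b)) has_derivative
      (\<lambda>d. \<Sum>i\<in>UNIV. (c *\<^sub>R d) $ i * partial i f (c *\<^sub>R x + b))) (at x)" for x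
    using has_derivative_compose[OF 1 Cdiff_on_Suc_derivative[OF Suc.prems]] by simp
  then show ?case
    by (rule Cdiff_on_SucI[rotated])
      (use Suc in \<open>auto simp: mult.assoc axis_sum sum_distrib_left[symmetric]
          intro!: Cdiff_on_mult Cdiff_on_const\<close>)
qed

subsection \<open>Smooth partitions of unity and test functions\<close>

text \<open>The exponent \<open>n\<close> makes the family closed under differentiation up to linear
  combinations, which gives smoothness by induction on the order.\<close>

definition flat :: "nat \<Rightarrow> real \<Rightarrow> real" where
  "flat n t = (if t \<le> 0 then 0 else exp (- 1 / t) / t ^ n)"

lemma flat_tendsto_0: "(flat n \<longlongrightarrow> 0) (at 0)"
proof -
  have "(flat n \<longlongrightarrow> 0) (at_right 0)"
  proof -
    have "((\<lambda>x. inverse x ^ n / exp (inverse x)) \<longlongrightarrow> (0::real)) (at_right 0)"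
      by (rule filterlim_compose[OF tendsto_power_div_exp_0 filterlim_inverse_at_top_right])
    then show ?thesis
    proof (rule Lim_transform_eventually)
      show "\<forall>\<^sub>F x in at_right (0::real). inverse x ^ n / exp (inverse x) = flat n x"
        by (auto simp: eventually_at_filter flat_def field_simps exp_minus)
    qed
  qed
  moreover have "(flat n \<longlongrightarrow> 0) (at_left 0)"
    by (rule tendsto_eventually) (auto simp: eventually_at_filter flat_def)
  ultimately show ?thesis by (simp add: filterlim_at_split)
qed

lemma flat_has_derivative:
  "(flat n has_real_derivative flat (n + 2) t - real n * flat (n + 1) t) (at t)"
proof -
  consider "t < 0" | "t = 0" | "t > 0" by linarith
  then show ?thesis
  proof cases
    case 1
    have "((\<lambda>t. 0) has_real_derivative 0) (at t)" by simp
    then have "(flat n has_real_derivative 0) (at t)"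
      by (rule has_field_derivative_transform_within_open[where S="{..<0}"])
        (use 1 in \<open>auto simp: flat_def\<close>)
    then show ?thesis using 1 by (simp add: flat_def)
  next
    case 2
    \<comment> \<open>At 0 the difference quotient of \<open>flat n\<close> is
      \<open>flat (n + 1)\<close>, which tends to 0.\<close>
    have "((\<lambda>h. (flat n (0 + h) - flat n 0) / h) \<longlongrightarrow> 0) (at 0)"
    proof (rule Lim_transform_eventually[OF flat_tendsto_0[of "n+1"]])
      show "\<forall>\<^sub>F x in at 0. flat (n + 1) x = (flat n (0 + x) - flat n 0) / x"
        by (auto simp: eventually_at_filter flat_def)
    qed
    then show ?thesis unfolding 2 DERIV_def by (simp add: flat_def)
  next
    case 3
    have "((\<lambda>t. exp (- 1 / t) / t ^ n) has_real_derivative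
        flat (n + 2) t - real n * flat (n + 1) t) (at t)"
      using 3
      by (auto intro!: derivative_eq_intros simp: flat_def divide_simps power2_eq_square)
        (cases n; simp add: field_simps)
    then show ?thesis
      by (rule has_field_derivative_transform_within_open[where S="{0<..}"])
        (use 3 in \<open>auto simp: flat_def\<close>)
  qed
qed

lemma Cdiff_on_flat: "Cdiff_on m UNIV (\<lambda>x. flat n (x $ i))"
proof (induction m arbitrary: n)
  case 0
  have "continuous_on UNIV (flat n)"
    using flat_has_derivative DERIV_isCont continuous_at_imp_continuous_on by blast
  then show ?case
    by (auto intro!: continuous_on_compose2[of UNIV "flat n"] continuous_intros)
next
  case (Suc m)
  have 1: "((\<lambda>x::real^2. x $ i) has_derivative (\<lambda>d. d $ i)) (at x)" for x
    by (auto intro!: bounded_linear_imp_has_derivative bounded_linear_vec_nth)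
  have "((\<lambda>x. flat n (x $ i)) has_derivative
      (\<lambda>d. d $ i * (flat (n + 2) (x $ i) - real n * flat (n + 1) (x $ i)))) (at x)" for x
    using DERIV_compose_FDERIV[OF flat_has_derivative 1] by simp
  moreover have "Cdiff_on m UNIV (\<lambda>x. axis j 1 $ i *
      (flat (n + 2) (x $ i) + (- real n) * flat (n + 1) (x $ i)))" for j
    by (intro Cdiff_on_mult Cdiff_on_add Cdiff_on_const Suc.IH open_UNIV)
  ultimately show ?case
    by (intro Cdiff_on_SucI[where f'="\<lambda>x d. d $ i * (flat (n + 2) (x $ i) - real n * flat (n + 1) (x $ i))"]) auto
qed

lemma flat_nonneg: "0 \<le> flat n t" and flat_pos: "0 < t \<Longrightarrow> 0 < flat n t"
  by (auto simp: flat_def)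

text \<open>The smooth transition from 0 on the nonpositive reals to 1 on the reals above 1. The
  denominator never vanishes, since t and 1 - t are not both nonpositive.\<close>

definition smooth_step :: "real \<Rightarrow> real" where
  "smooth_step t = flat 0 t * inverse (flat 0 t + flat 0 (1 - t))"

lemma flat_step_denom: "0 < flat 0 t + flat 0 (1 - t)"
  using flat_nonneg[of 0 t] flat_nonneg[of 0 "1 - t"] flat_pos[of t 0] flat_pos[of "1 - t" 0]
  by (cases "t > 0") auto

lemma smooth_step_bounds: "0 \<le> smooth_step t" "smooth_step t \<le> 1"
  using flat_step_denom[of t] flat_nonneg[of 0 t] flat_nonneg[of 0 "1 - t"]
  by (auto simp: smooth_step_def field_simps)

lemma smooth_step_eq: "t \<le> 0 \<Longrightarrow> smooth_step t = 0" "1 \<le> t \<Longrightarrow> smooth_step t = 1"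
  using flat_step_denom[of t] by (auto simp: smooth_step_def flat_def)

text \<open>A nonnegative smooth bump supported in [-1, 1]. As a difference of consecutive
  translates of \<open>smooth_step\<close>, its integer translates telescope to the constant
  1.\<close>

definition hat :: "real \<Rightarrow> real" where
  "hat t = smooth_step (t + 1) - smooth_step t"

lemma hat_nonneg: "0 \<le> hat t"
  using smooth_step_bounds[of t] smooth_step_bounds[of "t+1"] smooth_step_eq[of t] smooth_step_eq[of "t+1"]
  by (cases "t \<le> 0") (auto simp: hat_def)

lemma hat_eq_0: "1 \<le> \<bar>t\<bar> \<Longrightarrow> hat t = 0"
  using smooth_step_eq[of t] smooth_step_eq[of "t+1"]
  by (cases "t \<le> 0") (auto simp: hat_def)

text \<open>Only the two integers next to t contribute; their terms are 1 - s and s, with s the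
  value of \<open>smooth_step\<close> at the fractional part of t.\<close>

lemma hat_sum:
  assumes "finite J" "\<lfloor>t\<rfloor> \<in> J" "\<lfloor>t\<rfloor> + 1 \<in> J"
  shows "(\<Sum>j\<in>J. hat (t - of_int j)) = 1"
proof -
  have "hat (t - of_int j) = 0" if "j \<in> J - {\<lfloor>t\<rfloor>, \<lfloor>t\<rfloor> + 1}" for j
  proof (rule hat_eq_0)
    have "j \<le> \<lfloor>t\<rfloor> - 1 \<or> j \<ge> \<lfloor>t\<rfloor> + 2" using that by auto
    then have "real_of_int j \<le> real_of_int \<lfloor>t\<rfloor> - 1 \<or> real_of_int j \<ge> real_of_int \<lfloor>t\<rfloor> + 2"
      by linarith
    then show "1 \<le> \<bar>t - of_int j\<bar>" by linarith
  qed
  then have "(\<Sum>j\<in>J. hat (t - of_int j)) = (\<Sum>j\<in>{\<lfloor>t\<rfloor>, \<lfloor>t\<rfloor> + 1}. hat (t - of_int j))"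
    using assms by (intro sum.mono_neutral_right) auto
  also have "\<dots> = 1"
    using smooth_step_eq(1)[of "t - (1 + real_of_int \<lfloor>t\<rfloor>)"] floor_correct[of t] smooth_step_eq(2)[of "t - real_of_int \<lfloor>t\<rfloor> + 1"]
    by (simp add: hat_def algebra_simps)
  finally show ?thesis .
qed

lemma Cdiff_on_hat: "Cdiff_on m UNIV (\<lambda>x. hat (c * x $ i + b))"
proof -
  have s: "Cdiff_on m UNIV (\<lambda>x. smooth_step (x $ i))"
  proof -
    have "Cdiff_on m UNIV (\<lambda>x. flat 0 (((-1) *\<^sub>R x + axis i 1) $ i))"
      by (rule Cdiff_on_scale_translate) (rule Cdiff_on_flat)
    then have "Cdiff_on m UNIV (\<lambda>x. flat 0 (1 - x $ i))" by (simp add: axis_def)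
    then show ?thesis unfolding smooth_step_def
      using flat_step_denom
      by (intro Cdiff_on_mult Cdiff_on_inverse Cdiff_on_add Cdiff_on_flat open_UNIV)
        (auto simp: less_le)
  qed
  have s': "Cdiff_on m UNIV (\<lambda>x. smooth_step (c * x $ i + d))" for d
    using Cdiff_on_scale_translate[OF s, of c "axis i d"] by (simp add: axis_def)
  have "Cdiff_on m UNIV (\<lambda>x. smooth_step (c * x $ i + (b + 1)) + (-1) * smooth_step (c * x $ i + b))"
    by (intro Cdiff_on_mult Cdiff_on_add Cdiff_on_const s' open_UNIV)
  then show ?thesis by (simp add: hat_def add.assoc)
qed

lemma hat_sum_le: "finite J \<Longrightarrow> (\<Sum>j\<in>J. hat (t - of_int j)) \<le> 1"
  using hat_sum[of "J \<union> {\<lfloor>t\<rfloor>, \<lfloor>t\<rfloor> + 1}" t]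
    sum_mono2[of "J \<union> {\<lfloor>t\<rfloor>, \<lfloor>t\<rfloor> + 1}" J "\<lambda>j. hat (t - of_int j)"]
  by (auto simp: hat_nonneg)

text \<open>The approximants are quasi-interpolants \<open>\<Sum>j. \<psi> (j / n) * w (n * x - j)\<close> with a partition of
  unity \<open>w\<close>; nodes whose cell leaves \<open>V\<close> are dropped, so that the supports stay in \<open>V\<close>.\<close>

lemma test_function_approx:
  fixes \<psi> :: "real^2 \<Rightarrow> real"
  assumes V: "open V" "bounded V" and M: "0 \<le> M" "\<And>x. x \<in> V \<Longrightarrow> \<bar>\<psi> x\<bar> \<le> M"
  shows "\<exists>\<Psi>::nat \<Rightarrow> _. (\<forall>n. test_function V (\<Psi> n)) \<and> (\<forall>n x. \<bar>\<Psi> n x\<bar> \<le> M) \<and>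
    (\<forall>x\<in>V. isCont \<psi> x \<longrightarrow> (\<lambda>n. \<Psi> n x) \<longlonglongrightarrow> \<psi> x)"
proof -
  obtain r where r: "V \<subseteq> cball 0 r"
    using V(2) by (auto simp: bounded_iff subset_eq)
  \<comment> \<open>The index box is large enough to hold, for every x in V, both integers next to
    each coordinate of \<open>Suc n * x\<close>; so the weights sum to 1 on V although the index set
    is finite.\<close>
  define K where "K n = \<lceil>real (Suc n) * r\<rceil> + 2" for n
  define J where "J n = {- K n..K n} \<times> {- K n..K n}" for n
  have fJ: "finite (J n)" for n by (simp add: J_def)
  define jv where "jv j i = real_of_int (if i = (1::2) then fst j else snd j)" for j :: "int \<times> int" and i
  \<comment> \<open>The closed cell about the node \<open>p n j\<close>, outside of which the weight
    with index j vanishes.\<close>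
  define B where "B n j = cbox (\<chi> i. (jv j i - 1) / Suc n) (\<chi> i. (jv j i + 1) / Suc n)" for n j
  define p where "p n j = (\<chi> i. jv j i / Suc n)" for n j
  have pB: "p n j \<in> B n j" for n j
    by (auto simp: B_def p_def mem_box_cart divide_simps)
  define w where "w n j x = hat (Suc n * x $ 1 - of_int (fst j)) * hat (Suc n * x $ 2 - of_int (snd j))"
    for n j and x :: "real^2"
  define c where "c n j = (if B n j \<subseteq> V then \<psi> (p n j) else 0)" for n j
  define \<Psi> where "\<Psi> n x = (\<Sum>j\<in>J n. c n j * w n j x)" for n x
  have w_nonneg: "0 \<le> w n j x" for n j x by (simp add: w_def hat_nonneg)
  have w_prod: "(\<Sum>j\<in>J n. w n j x) = (\<Sum>j\<in>{- K n..K n}. hat (Suc n * x $ 1 - of_int j)) *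
      (\<Sum>j\<in>{- K n..K n}. hat (Suc n * x $ 2 - of_int j))" for n x
    by (simp add: w_def J_def sum_product sum.cartesian_product case_prod_unfold)
  have w_le: "(\<Sum>j\<in>J n. w n j x) \<le> 1" for n x
    unfolding w_prod by (intro mult_le_one hat_sum_le sum_nonneg) (auto simp: hat_nonneg)
  have w_eq: "(\<Sum>j\<in>J n. w n j x) = 1" if "x \<in> V" for n x
  proof -
    have "\<lfloor>Suc n * x $ i\<rfloor> \<in> {- K n..K n} \<and> \<lfloor>Suc n * x $ i\<rfloor> + 1 \<in> {- K n..K n}" for i
    proof -
      have "\<bar>x $ i\<bar> \<le> r" using r that component_le_norm_cart[of x i] by fastforce
      then have "\<bar>Suc n * x $ i\<bar> \<le> Suc n * r"
        unfolding abs_mult by (intro mult_mono) auto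
      then show ?thesis unfolding K_def by (simp only: atLeastAtMost_iff) linarith
    qed
    then show ?thesis unfolding w_prod by (simp add: hat_sum)
  qed
  have w_supp: "x \<in> B n j" if "w n j x \<noteq> 0" for n j x
  proof -
    have *: "\<bar>Suc n * x $ i - jv j i\<bar> < 1" for i
      using that hat_eq_0[of "Suc n * x $ 1 - of_int (fst j)"] hat_eq_0[of "Suc n * x $ 2 - of_int (snd j)"]
        exhaust_2[of i] unfolding w_def jv_def by (auto simp: not_le[symmetric])
    have "jv j i - 1 \<le> Suc n * x $ i \<and> Suc n * x $ i \<le> jv j i + 1" for i
      using *[of i] by linarith
    then show ?thesis by (simp add: B_def mem_box_cart divide_simps mult.commute)
  qed
  show ?thesis
  proof (intro exI[of _ \<Psi>] conjI allI ballI impI)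
    fix n
    have "Cdiff_on m UNIV (\<Psi> n)" for m
      unfolding \<Psi>_def[abs_def] w_def
      using Cdiff_on_hat[of m "real (Suc n)" _ "- real_of_int _"]
      by (intro Cdiff_on_sum Cdiff_on_mult Cdiff_on_const open_UNIV) auto
    moreover define S where "S = (\<Union>j\<in>{j\<in>J n. B n j \<subseteq> V}. B n j)"
    have S: "compact S" "S \<subseteq> V"
      unfolding S_def using fJ by (auto intro!: compact_UN simp: B_def)
    have sub: "{x. \<Psi> n x \<noteq> 0} \<subseteq> S"
    proof
      fix x assume "x \<in> {x. \<Psi> n x \<noteq> 0}"
      then obtain j where "j \<in> J n" "c n j * w n j x \<noteq> 0"
        unfolding \<Psi>_def by (metis (mono_tags, lifting) mem_Collect_eq sum.neutral)
      then have "j \<in> {j\<in>J n. B n j \<subseteq> V}" "x \<in> B n j"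
        using w_supp[of n j x] by (auto simp: c_def split: if_splits)
      then show "x \<in> S" unfolding S_def by blast
    qed
    then have "closure {x. \<Psi> n x \<noteq> 0} \<subseteq> S"
      using S(1) by (simp add: closure_minimal compact_imp_closed)
    ultimately show "test_function V (\<Psi> n)"
      using S bounded_subset[OF compact_imp_bounded[OF S(1)] sub]
      by (auto simp: test_function_def)
  next
    fix n x
    have "\<bar>c n j\<bar> \<le> M" for j using M pB[of n j] by (cases "B n j \<subseteq> V") (auto simp: c_def)
    then have "\<bar>\<Psi> n x\<bar> \<le> (\<Sum>j\<in>J n. M * w n j x)"
      unfolding \<Psi>_def
      by (intro order_trans[OF sum_abs] sum_mono) (auto simp: abs_mult w_nonneg intro!: mult_right_mono)
    also have "\<dots> \<le> M * 1" unfolding sum_distrib_left[symmetric]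
      by (intro mult_left_mono w_le M)
    finally show "\<bar>\<Psi> n x\<bar> \<le> M" by simp
  next
    fix x assume x: "x \<in> V" "isCont \<psi> x"
    show "(\<lambda>n. \<Psi> n x) \<longlonglongrightarrow> \<psi> x"
    proof (rule LIMSEQ_I)
      fix e :: real assume "e > 0"
      obtain d1 where d1: "d1 > 0" "\<And>y. dist y x < d1 \<Longrightarrow> \<bar>\<psi> y - \<psi> x\<bar> < e/2"
        using x(2) \<open>e > 0\<close> unfolding continuous_at_eps_delta dist_real_def by (meson half_gt_zero)
      obtain d2 where d2: "d2 > 0" "ball x d2 \<subseteq> V" using V(1) x(1) by (meson openE)
      define d where "d = min d1 d2"
      have d: "d > 0" using d1 d2 by (simp add: d_def)
      \<comment> \<open>A cell has side \<open>2 / Suc n\<close>, so two of its points differ by at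
        most \<open>4 / Suc n\<close> in the l1 norm. From n0 on, every cell containing x lies in
        the ball of radius d, hence in V, and its node value is within e / 2 of
        \<open>\<psi> x\<close>.\<close>
      obtain n0 :: nat where n0: "n0 > 4 / d" using reals_Archimedean2 by blast
      have "norm (\<Psi> n x - \<psi> x) < e" if "n \<ge> n0" for n
      proof -
        have "4 / d < Suc n" using n0 that by linarith
        then have nd: "4 / Suc n < d" using d by (simp add: field_simps)
        have Bd: "dist y x < d" if "y \<in> B n j" "x \<in> B n j" for y j
        proof -
          have *: "\<bar>(y - x) $ i\<bar> \<le> 2 / Suc n" for i
          proof -
            have "(jv j i - 1) / Suc n \<le> y $ i" "y $ i \<le> (jv j i + 1) / Suc n"
              "(jv j i - 1) / Suc n \<le> x $ i" "x $ i \<le> (jv j i + 1) / Suc n"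
              using that by (auto simp: B_def mem_box_cart)
            then show ?thesis by (simp add: diff_divide_distrib add_divide_distrib)
          qed
          have "dist y x \<le> (\<Sum>i\<in>UNIV. \<bar>(y - x) $ i\<bar>)"
            unfolding dist_norm by (rule norm_le_l1_cart)
          also have "\<dots> \<le> 4 / Suc n" using *[of 1] *[of 2] by (simp add: sum_2)
          finally show ?thesis using nd by simp
        qed
        have cw: "\<bar>(c n j - \<psi> x) * w n j x\<bar> \<le> e / 2 * w n j x" for j
        proof (cases "w n j x = 0")
          case False
          then have "x \<in> B n j" by (rule w_supp)
          then have "B n j \<subseteq> ball x d" using Bd[of _ j] by (auto simp: dist_commute)
          moreover have "ball x d \<subseteq> V" using d2 by (auto simp: d_def)
          ultimately have "B n j \<subseteq> V" by blast
          moreover have "dist (p n j) x < d1" using Bd[OF pB \<open>x \<in> B n j\<close>] by (simp add: d_def)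
          ultimately have "\<bar>c n j - \<psi> x\<bar> \<le> e/2" using d1(2)[of "p n j"] by (simp add: c_def)
          then show ?thesis unfolding abs_mult abs_of_nonneg[OF w_nonneg]
            by (rule mult_right_mono[OF _ w_nonneg])
        qed simp
        have "\<Psi> n x - \<psi> x = (\<Sum>j\<in>J n. c n j * w n j x) - \<psi> x * (\<Sum>j\<in>J n. w n j x)"
          using w_eq[OF x(1)] by (simp add: \<Psi>_def)
        also have "\<dots> = (\<Sum>j\<in>J n. (c n j - \<psi> x) * w n j x)"
          by (simp add: sum_distrib_left sum_subtractf left_diff_distrib)
        also have "\<bar>\<dots>\<bar> \<le> (\<Sum>j\<in>J n. e / 2 * w n j x)"
          by (intro order_trans[OF sum_abs] sum_mono cw)
        also have "\<dots> = e / 2" unfolding sum_distrib_left[symmetric] w_eq[OF x(1)] by simp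
        finally show ?thesis using \<open>e > 0\<close> by simp
      qed
      then show "\<exists>n0. \<forall>n\<ge>n0. norm (\<Psi> n x - \<psi> x) < e" by blast
    qed
  qed
qed

subsection \<open>Translation estimates for weakly differentiable functions\<close>

lemma AE_lebesgue_translate:
  fixes a :: "'a::euclidean_space"
  assumes "AE x in lebesgue. P x"
  shows "AE x in lebesgue. P (x - a)"
proof -
  have "negligible {x. \<not> P x}"
    using assms by (simp add: negligible_iff_null_sets AE_iff_null_sets completion.complete2 eventually_ae_filter)
      (metis (no_types, lifting) completion.complete2 mem_Collect_eq subsetI)
  then have "negligible ((+) a ` {x. \<not> P x})" by (rule negligible_translation)
  moreover have "{x. \<not> P (x - a)} = (+) a ` {x. \<not> P x}"
    by (auto simp: image_iff) (metis add_diff_cancel_left' add.commute diff_add_cancel)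
  ultimately show ?thesis
    by (intro AE_I'[of "{x. \<not> P (x - a)}"]) (auto simp: negligible_iff_null_sets)
qed

lemma AE_not_in_negligible: "negligible N \<Longrightarrow> AE x in lebesgue. x \<notin> N"
  by (intro AE_not_in) (simp add: negligible_iff_null_sets)

text \<open>The affine change of variables with factor -1 has density 1. Reflections serve for the
  convolution in the Poincare inequality and for the vanishing mean of odd functions.\<close>

lemma lborel_integral_reflect:
  fixes f :: "'a::euclidean_space \<Rightarrow> real"
  assumes [measurable]: "f \<in> borel_measurable borel"
  shows "(LINT x|lborel. f (t - x)) = (LINT x|lborel. f x)"
proof -
  have *: "lborel = density (distr lborel borel (\<lambda>x::'a. t - x)) (\<lambda>_. 1)"
    using lborel_affine[of "-1" t] by simp
  show ?thesis by (subst (2) *) (simp add: integral_density integral_distr density_1)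
qed

lemma integrable_mult_bounded:
  fixes G \<phi> :: "'a \<Rightarrow> real"
  assumes "integrable M G" "\<phi> \<in> borel_measurable M" "\<And>x. \<bar>\<phi> x\<bar> \<le> B"
  shows "integrable M (\<lambda>x. G x * \<phi> x)"
proof (rule Bochner_Integration.integrable_bound)
  show "integrable M (\<lambda>x. G x * B)" using assms(1) by simp
  show "(\<lambda>x. G x * \<phi> x) \<in> borel_measurable M" using assms by measurable
  show "AE x in M. norm (G x * \<phi> x) \<le> norm (G x * B)"
  proof (rule AE_I2)
    fix x
    have "\<bar>\<phi> x\<bar> \<le> \<bar>B\<bar>" using assms(3)[of x] by linarith
    then show "norm (G x * \<phi> x) \<le> norm (G x * B)" by (simp add: abs_mult mult_left_mono)
  qed
qed

lemma abs_integral_mult_le: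
  fixes G \<phi> :: "'a \<Rightarrow> real"
  assumes "integrable M G" "\<phi> \<in> borel_measurable M" "\<And>x. \<bar>\<phi> x\<bar> \<le> B"
  shows "\<bar>LINT x|M. G x * \<phi> x\<bar> \<le> B * (LINT x|M. \<bar>G x\<bar>)"
proof -
  have "\<bar>LINT x|M. G x * \<phi> x\<bar> \<le> (LINT x|M. \<bar>G x * \<phi> x\<bar>)" by (rule integral_abs_bound)
  also have "\<dots> \<le> (LINT x|M. B * \<bar>G x\<bar>)"
  proof (rule integral_mono)
    show "integrable M (\<lambda>x. \<bar>G x * \<phi> x\<bar>)" by (intro integrable_abs integrable_mult_bounded[OF assms])
    show "integrable M (\<lambda>x. B * \<bar>G x\<bar>)" using assms(1) by simp
    show "\<bar>G x * \<phi> x\<bar> \<le> B * \<bar>G x\<bar>" for x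
      using mult_right_mono[OF assms(3)[of x] abs_ge_zero[of "G x"]] by (simp add: abs_mult mult.commute)
  qed
  finally show ?thesis by simp
qed

lemma test_function_eq_0: "test_function U \<phi> \<Longrightarrow> x \<notin> U \<Longrightarrow> \<phi> x = 0"
  using closure_subset[of "{x. \<phi> x \<noteq> 0}"] by (auto simp: test_function_def)

lemma test_function_partial_eq_0:
  assumes "test_function U \<phi>" "x \<notin> closure {x. \<phi> x \<noteq> 0}"
  shows "partial i \<phi> x = 0"
proof -
  have "partial i \<phi> x = partial i (\<lambda>x. 0) x"
    by (rule partial_cong[of "- closure {x. \<phi> x \<noteq> 0}"])
      (use assms(2) closure_subset[of "{x. \<phi> x \<noteq> 0}"] in auto)
  then show ?thesis using partial_eq[of "\<lambda>x. 0" "\<lambda>x. 0"] by simp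
qed

lemma test_function_subset: "test_function V \<phi> \<Longrightarrow> V \<subseteq> U \<Longrightarrow> test_function U \<phi>"
  by (auto simp: test_function_def)

text \<open>A test function on V is one on U and vanishes off V with its derivatives, so both
  integrals agree with those over U. This allows translation estimates on small convex pieces, in
  which only the local norm of the derivative appears.\<close>

lemma has_weak_partial_subset:
  assumes "has_weak_partial U i g v" "V \<subseteq> U" "open V"
  shows "has_weak_partial V i g v"
proof -
  have "(LINT x:V|lebesgue. g x * partial i \<phi> x) = - (LINT x:V|lebesgue. v x * \<phi> x)"
    if \<phi>: "test_function V \<phi>" for \<phi>
  proof -
    have "partial i \<phi> x = 0" if "x \<notin> V" for x
      using test_function_partial_eq_0[OF \<phi>] that \<phi> by (auto simp: test_function_def)
    then have "(LINT x:V|lebesgue. g x * partial i \<phi> x) = (LINT x:U|lebesgue. g x * partial i \<phi> x)"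
      unfolding set_lebesgue_integral_def using assms(2)
      by (intro Bochner_Integration.integral_cong) (auto simp: indicator_def)
    moreover have "(LINT x:V|lebesgue. v x * \<phi> x) = (LINT x:U|lebesgue. v x * \<phi> x)"
      unfolding set_lebesgue_integral_def using assms(2) test_function_eq_0[OF \<phi>]
      by (intro Bochner_Integration.integral_cong) (auto simp: indicator_def)
    ultimately show ?thesis
      using assms(1,2) test_function_subset[OF \<phi>] by (simp add: has_weak_partial_def)
  qed
  moreover have "set_integrable lebesgue V v"
    using assms by (auto simp: has_weak_partial_def intro: set_integrable_subset)
  ultimately show ?thesis by (simp add: has_weak_partial_def)
qed

lemma Cdiff_on_borel: "Cdiff_on m UNIV f \<Longrightarrow> f \<in> borel_measurable borel"
  using Cdiff_on_le[of m UNIV f 0] by (auto intro: borel_measurable_continuous_onI)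

lemma test_function_partial_bounded:
  assumes "test_function U \<phi>"
  obtains B where "0 \<le> B" "\<And>i x. \<bar>partial i \<phi> x\<bar> \<le> B"
proof -
  define S where "S = closure {x. \<phi> x \<noteq> 0}"
  have S: "compact S" using assms by (simp add: S_def test_function_def)
  have "\<exists>B. \<forall>x. \<bar>partial i \<phi> x\<bar> \<le> B" for i
  proof -
    have "Cdiff_on (Suc 0) UNIV \<phi>" using assms unfolding test_function_def by blast
    then have "continuous_on S (partial i \<phi>)" by (auto intro: continuous_on_subset)
    then have "bounded (partial i \<phi> ` S)" by (intro compact_imp_bounded compact_continuous_image S)
    then obtain B where B: "\<And>x. x \<in> S \<Longrightarrow> \<bar>partial i \<phi> x\<bar> \<le> B" by (auto simp: bounded_iff)
    then have "\<bar>partial i \<phi> x\<bar> \<le> max B 0" for x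
      using test_function_partial_eq_0[OF assms, of x i]
      by (cases "x \<in> S") (force simp: S_def)+
    then show ?thesis by blast
  qed
  then obtain B where B: "\<And>i x. \<bar>partial i \<phi> x\<bar> \<le> B i" by metis
  have "\<bar>partial i \<phi> x\<bar> \<le> \<bar>B 1\<bar> + \<bar>B 2\<bar>" for i x
    using B[of i x] exhaust_2[of i] by (auto intro: order_trans)
  then show ?thesis using that[of "\<bar>B 1\<bar> + \<bar>B 2\<bar>"] by auto
qed

text \<open>The integral of g against the moving function \<open>\<psi> (y - t *\<^sub>R a)\<close>
  is differentiable in t. Its derivative pairs g with partial derivatives of a test function; the
  weak derivatives absorb them, so that only the bound M on \<psi> survives. The mean value
  inequality on [0, 1] gives the claim.\<close>

lemma weak_translation_smooth:
  assumes U: "open U" "convex U"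
    and g: "set_integrable lebesgue U g" and v: "\<And>i. has_weak_partial U i g (v i)"
    and \<psi>: "test_function {x\<in>U. x + a \<in> U} \<psi>" and M: "\<And>x. \<bar>\<psi> x\<bar> \<le> M"
  shows "\<bar>LINT y:U|lebesgue. g y * (\<psi> (y - a) - \<psi> y)\<bar>
    \<le> M * (\<Sum>i\<in>UNIV. \<bar>a $ i\<bar> * (LINT y:U|lebesgue. \<bar>v i y\<bar>))"
proof -
  define G where "G y = indicator U y * g y" for y
  define V where "V i y = indicator U y * v i y" for i y
  have G: "integrable lebesgue G" and V: "integrable lebesgue (V i)" for i
    using g v by (auto simp: set_integrable_def G_def[abs_def] V_def[abs_def] has_weak_partial_def)
  have weak: "(LINT y|lebesgue. G y * partial i \<phi> y) = - (LINT y|lebesgue. V i y * \<phi> y)"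
    if "test_function U \<phi>" for \<phi> i
    using v[of i] that by (simp add: has_weak_partial_def set_lebesgue_integral_def G_def V_def mult.assoc)
  have sm: "Cdiff_on m UNIV \<psi>" for m using \<psi> by (simp add: test_function_def)
  define \<phi> where "\<phi> t y = \<psi> (y - t *\<^sub>R a)" for t y
  have sm': "Cdiff_on m UNIV (\<phi> t)" for m t
    using Cdiff_on_scale_translate[OF sm, of m 1 "- t *\<^sub>R a"] by (simp add: \<phi>_def[abs_def])
  have D: "(\<psi> has_derivative (\<lambda>d. \<Sum>i\<in>UNIV. d $ i * partial i \<psi> x)) (at x)" for x
    using Cdiff_on_Suc_derivative[OF sm[of "Suc 0"], of x] by simp
  have partial_\<phi>: "partial i (\<phi> t) y = partial i \<psi> (y - t *\<^sub>R a)" for i t y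
  proof -
    have "((\<lambda>y. y - t *\<^sub>R a) has_derivative (\<lambda>d. d)) (at y)"
      by (auto intro!: derivative_eq_intros)
    then have "(\<phi> t has_derivative (\<lambda>d. \<Sum>i\<in>UNIV. d $ i * partial i \<psi> (y - t *\<^sub>R a))) (at y)"
      unfolding \<phi>_def[abs_def] using has_derivative_compose[OF _ D] by blast
    from partial_eq[OF this] show ?thesis by (simp add: axis_sum)
  qed
  \<comment> \<open>A point of the moved support lies on the segment between x and x + a, both in U,
    so convexity keeps it in U.\<close>
  have test: "test_function U (\<phi> t)" if t: "t \<in> {0..1}" for t
  proof -
    define S where "S = (+) (t *\<^sub>R a) ` closure {x. \<psi> x \<noteq> 0}"
    have S: "compact S" using \<psi> by (auto simp: S_def test_function_def intro!: compact_translation)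
    have SU: "S \<subseteq> U"
    proof
      fix y assume "y \<in> S"
      then obtain x where x: "x \<in> U" "x + a \<in> U" "y = t *\<^sub>R a + x"
        using \<psi> by (auto simp: S_def test_function_def)
      have "(1 - t) *\<^sub>R x + t *\<^sub>R (x + a) \<in> U"
        using U(2) x(1,2) t unfolding convex_alt by auto
      then show "y \<in> U" using x(3) by (simp add: algebra_simps)
    qed
    have "{y. \<phi> t y \<noteq> 0} \<subseteq> S"
    proof
      fix y assume "y \<in> {y. \<phi> t y \<noteq> 0}"
      then have "y - t *\<^sub>R a \<in> closure {x. \<psi> x \<noteq> 0}"
        using closure_subset[of "{x. \<psi> x \<noteq> 0}"] by (auto simp: \<phi>_def)
      then show "y \<in> S" unfolding S_def by (force simp: image_iff)
    qed
    then have "closure {y. \<phi> t y \<noteq> 0} \<subseteq> S" by (simp add: S closure_minimal compact_imp_closed)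
    moreover have "compact (closure {y. \<phi> t y \<noteq> 0})"
      using \<open>{y. \<phi> t y \<noteq> 0} \<subseteq> S\<close> bounded_subset[OF compact_imp_bounded[OF S]] by auto
    ultimately show ?thesis using SU sm' by (auto simp: test_function_def)
  qed
  obtain B where B: "0 \<le> B" "\<And>i x. \<bar>partial i \<psi> x\<bar> \<le> B"
    using test_function_partial_bounded[OF \<psi>] by blast
  have [measurable]: "\<phi> t \<in> borel_measurable lebesgue" "partial i (\<phi> t) \<in> borel_measurable lebesgue" for t i
    using Cdiff_on_borel[OF sm'[of 0 t]] sm'[of "Suc 0" t] Cdiff_on_borel[of 0 "partial i (\<phi> t)"]
    by (auto intro!: measurable_completion)
  define h where "h t = (LINT y|lebesgue. G y * \<phi> t y)" for t
  define dh where "dh t = (LINT y|lebesgue. G y * (- (\<Sum>i\<in>UNIV. a $ i * partial i (\<phi> t) y)))" for t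
  define L where "L = (\<Sum>i\<in>UNIV. \<bar>a $ i\<bar>) * B"
  have pt: "((\<lambda>t. \<phi> t y) has_real_derivative (- (\<Sum>i\<in>UNIV. a $ i * partial i (\<phi> t) y))) (at t)" for t y
  proof -
    have "((\<lambda>t. y - t *\<^sub>R a) has_derivative (\<lambda>s. - (s *\<^sub>R a))) (at t)"
      by (auto intro!: derivative_eq_intros)
    from has_derivative_compose[OF this D] show ?thesis
      unfolding \<phi>_def[symmetric] has_field_derivative_def
      by (rule has_derivative_eq_rhs) (auto simp: fun_eq_iff partial_\<phi> sum_negf sum_distrib_left mult_ac)
  qed
  have L: "\<bar>- (\<Sum>i\<in>UNIV. a $ i * partial i (\<phi> t) y)\<bar> \<le> L" for t y
    unfolding L_def abs_minus_cancel sum_distrib_right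
    by (intro order_trans[OF sum_abs] sum_mono) (auto simp: abs_mult partial_\<phi> intro!: mult_left_mono B)
  have lip: "\<bar>\<phi> s y - \<phi> t y\<bar> \<le> L * \<bar>s - t\<bar>" for s t y
    using field_differentiable_bound[of UNIV "\<lambda>t. \<phi> t y" "\<lambda>t. - (\<Sum>i\<in>UNIV. a $ i * partial i (\<phi> t) y)" L s t]
      pt L by auto
  have int: "integrable lebesgue (\<lambda>y. G y * \<phi> t y)" for t
    by (rule integrable_mult_bounded[OF G, where B=M]) (measurable, simp add: \<phi>_def M)
  \<comment> \<open>Differentiation under the integral sign: the limit is tested on sequences, so
    that dominated convergence applies with the Lipschitz constant L as a bound for the difference
    quotients.\<close>
  have h_deriv: "(h has_real_derivative dh t) (at t)" for t
    unfolding has_field_derivative_iff tendsto_at_iff_sequentially comp_def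
  proof (intro allI impI)
    fix X :: "nat \<Rightarrow> real" assume X: "\<forall>i. X i \<in> UNIV - {t}" "X \<longlonglongrightarrow> t"
    have "(\<lambda>n. LINT y|lebesgue. G y * ((\<phi> (X n) y - \<phi> t y) / (X n - t))) \<longlonglongrightarrow> dh t"
      unfolding dh_def
    proof (rule integral_dominated_convergence[where w="\<lambda>y. \<bar>G y\<bar> * L"])
      show "integrable lebesgue (\<lambda>y. \<bar>G y\<bar> * L)" using G by auto
      have "(\<lambda>n. (\<phi> (X n) y - \<phi> t y) / (X n - t)) \<longlonglongrightarrow> - (\<Sum>i\<in>UNIV. a $ i * partial i (\<phi> t) y)" for y
        using pt[where t=t] X unfolding has_field_derivative_iff tendsto_at_iff_sequentially comp_def by blast
      then show "AE y in lebesgue. (\<lambda>n. G y * ((\<phi> (X n) y - \<phi> t y) / (X n - t)))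
          \<longlonglongrightarrow> G y * - (\<Sum>i\<in>UNIV. a $ i * partial i (\<phi> t) y)"
        by (intro AE_I2 tendsto_mult tendsto_const) 
      show "AE y in lebesgue. norm (G y * ((\<phi> (X n) y - \<phi> t y) / (X n - t))) \<le> \<bar>G y\<bar> * L" for n
      proof (rule AE_I2)
        fix y
        have "X n - t \<noteq> 0" using X(1)[rule_format, of n] by auto
        then have "\<bar>(\<phi> (X n) y - \<phi> t y) / (X n - t)\<bar> \<le> L"
          using lip[of "X n" y t] by (simp add: divide_le_eq)
        then show "norm (G y * ((\<phi> (X n) y - \<phi> t y) / (X n - t))) \<le> \<bar>G y\<bar> * L"
          unfolding real_norm_def abs_mult[of "G y"] by (rule mult_left_mono) simp
      qed
    qed (use G in measurable)
    moreover have "(LINT y|lebesgue. G y * ((\<phi> (X n) y - \<phi> t y) / (X n - t))) = (h (X n) - h t) / (X n - t)" for n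
    proof -
      have "(h (X n) - h t) / (X n - t) = (LINT y|lebesgue. (G y * \<phi> (X n) y - G y * \<phi> t y) / (X n - t))"
        unfolding h_def by (simp add: Bochner_Integration.integral_diff[OF int int])
      then show ?thesis by (simp only: right_diff_distrib times_divide_eq_right)
    qed
    ultimately show "(\<lambda>n. (h (X n) - h t) / (X n - t)) \<longlonglongrightarrow> dh t" by (simp only:)
  qed
  have dh_bound: "\<bar>dh t\<bar> \<le> M * (\<Sum>i\<in>UNIV. \<bar>a $ i\<bar> * (LINT y|lebesgue. \<bar>V i y\<bar>))" if t: "t \<in> {0..1}" for t
  proof -
    have i: "integrable lebesgue (\<lambda>y. G y * partial j (\<phi> t) y)" for j
      by (rule integrable_mult_bounded[OF G, where B=B]) (measurable, simp add: partial_\<phi> B)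
    have "dh t = - (LINT y|lebesgue. (\<Sum>i\<in>UNIV. a $ i * (G y * partial i (\<phi> t) y)))"
      unfolding dh_def by (simp add: sum_distrib_left mult.left_commute)
    also have "\<dots> = - (\<Sum>i\<in>UNIV. a $ i * (LINT y|lebesgue. G y * partial i (\<phi> t) y))"
      using i by (subst Bochner_Integration.integral_sum) auto
    also have "\<dots> = (\<Sum>i\<in>UNIV. a $ i * (LINT y|lebesgue. V i y * \<phi> t y))"
      by (simp add: weak[OF test[OF t]] sum_negf)
    also have "\<bar>\<dots>\<bar> \<le> (\<Sum>i\<in>UNIV. \<bar>a $ i\<bar> * (M * (LINT y|lebesgue. \<bar>V i y\<bar>)))"
    proof (intro order_trans[OF sum_abs] sum_mono)
      fix i :: 2
      have "\<bar>LINT y|lebesgue. V i y * \<phi> t y\<bar> \<le> M * (LINT y|lebesgue. \<bar>V i y\<bar>)"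
        by (rule abs_integral_mult_le[OF V]) (measurable, simp add: \<phi>_def M)
      then show "\<bar>a $ i * (LINT y|lebesgue. V i y * \<phi> t y)\<bar> \<le> \<bar>a $ i\<bar> * (M * (LINT y|lebesgue. \<bar>V i y\<bar>))"
        unfolding abs_mult by (rule mult_left_mono) simp
    qed
    also have "\<dots> = M * (\<Sum>i\<in>UNIV. \<bar>a $ i\<bar> * (LINT y|lebesgue. \<bar>V i y\<bar>))"
      by (simp add: sum_distrib_left mult_ac)
    finally show ?thesis .
  qed
  have "\<bar>h 1 - h 0\<bar> \<le> M * (\<Sum>i\<in>UNIV. \<bar>a $ i\<bar> * (LINT y|lebesgue. \<bar>V i y\<bar>)) * \<bar>1 - 0\<bar>"
    using field_differentiable_bound[of "{0..1}" h dh _ 1 0] dh_bound h_deriv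
    by (auto intro: has_field_derivative_at_within simp: convex_real_interval)
  moreover have "h 1 - h 0 = (LINT y:U|lebesgue. g y * (\<psi> (y - a) - \<psi> y))"
    unfolding h_def Bochner_Integration.integral_diff[OF int int, symmetric] set_lebesgue_integral_def
    by (simp add: \<phi>_def G_def algebra_simps)
  moreover have "(LINT y:U|lebesgue. \<bar>v i y\<bar>) = (LINT y|lebesgue. \<bar>V i y\<bar>)" for i
    by (simp add: set_lebesgue_integral_def V_def abs_mult)
  ultimately show ?thesis by simp
qed

text \<open>On V the function \<psi> is approximated by test functions with the same bound M, and
  dominated convergence passes to the limit. The approximants vanish off V, which is why the limit
  carries \<open>indicator V\<close>; the jump of that product at the frontier of V is therefore
  harmless.\<close>

lemma weak_translation:
  assumes U: "open U" "convex U" "bounded U"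
    and g: "set_integrable lebesgue U g" and v: "\<And>i. has_weak_partial U i g (v i)"
    and \<psi>: "\<psi> \<in> borel_measurable borel" "AE x in lebesgue. isCont \<psi> x"
    and M: "\<And>x. \<bar>\<psi> x\<bar> \<le> M"
    and V_def: "V = {x\<in>U. x + a \<in> U}"
  shows "\<bar>LINT y:U|lebesgue. g y * (indicator V (y - a) * \<psi> (y - a) - indicator V y * \<psi> y)\<bar>
    \<le> M * (\<Sum>i\<in>UNIV. \<bar>a $ i\<bar> * (LINT y:U|lebesgue. \<bar>v i y\<bar>))"
proof -
  have V_eq: "V = U \<inter> (\<lambda>x. x + a) -` U" by (auto simp: V_def)
  have V: "open V"
    unfolding V_eq by (intro open_Int open_vimage continuous_intros U)
  have V': "bounded V" by (rule bounded_subset[OF U(3)]) (auto simp: V_def)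
  have "0 \<le> M" using M[of 0] by linarith
  obtain \<Psi> where \<Psi>: "\<And>n::nat. test_function V (\<Psi> n)" "\<And>n x. \<bar>\<Psi> n x\<bar> \<le> M"
    "\<And>x. x \<in> V \<Longrightarrow> isCont \<psi> x \<Longrightarrow> (\<lambda>n. \<Psi> n x) \<longlonglongrightarrow> \<psi> x"
    using test_function_approx[OF V V' \<open>0 \<le> M\<close>, of \<psi>, OF M] by metis
  define \<psi>V where "\<psi>V x = indicator V x * \<psi> x" for x
  have [measurable]: "\<psi> \<in> borel_measurable borel" "V \<in> sets borel" using \<psi> V by auto
  have [measurable]: "(\<lambda>y. \<psi>V (y - a)) \<in> borel_measurable lebesgue" "\<psi>V \<in> borel_measurable lebesgue"
    unfolding \<psi>V_def[abs_def] by (rule measurable_completion, measurable)+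
  have [measurable]: "\<Psi> n \<in> borel_measurable borel" for n
    using \<Psi>(1)[of n] by (intro Cdiff_on_borel[of 0]) (simp only: test_function_def)
  have [measurable]: "(\<lambda>y. \<Psi> n (y - a)) \<in> borel_measurable lebesgue" "\<Psi> n \<in> borel_measurable lebesgue" for n
    by (rule measurable_completion, measurable)+
  have conv: "AE x in lebesgue. (\<lambda>n. \<Psi> n x) \<longlonglongrightarrow> \<psi>V x"
    using \<psi>(2)
  proof eventually_elim
    case (elim x)
    show ?case
    proof (cases "x \<in> V")
      case True
      then show ?thesis using \<Psi>(3) elim by (simp add: \<psi>V_def)
    next
      case False
      then have "\<Psi> n x = 0" for n using test_function_eq_0[OF \<Psi>(1)] by blast
      then show ?thesis using False by (simp add: \<psi>V_def)
    qed
  qed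
  define G where "G y = indicator U y * g y" for y
  have G: "integrable lebesgue G" using g by (simp add: set_integrable_def G_def[abs_def])
  have G_eq: "(LINT y:U|lebesgue. g y * f y) = (LINT y|lebesgue. G y * f y)" for f
    by (simp add: set_lebesgue_integral_def G_def mult.assoc)
  have "(\<lambda>n. LINT y|lebesgue. G y * (\<Psi> n (y - a) - \<Psi> n y))
      \<longlonglongrightarrow> (LINT y|lebesgue. G y * (\<psi>V (y - a) - \<psi>V y))"
  proof (rule integral_dominated_convergence[where w="\<lambda>y. \<bar>G y\<bar> * (2 * M)"])
    show "(\<lambda>y. G y * (\<psi>V (y - a) - \<psi>V y)) \<in> borel_measurable lebesgue"
      "(\<lambda>y. G y * (\<Psi> n (y - a) - \<Psi> n y)) \<in> borel_measurable lebesgue" for n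
      using G by measurable
    show "integrable lebesgue (\<lambda>y. \<bar>G y\<bar> * (2 * M))" using G by simp
    show "AE x in lebesgue. (\<lambda>n. G x * (\<Psi> n (x - a) - \<Psi> n x)) \<longlonglongrightarrow> G x * (\<psi>V (x - a) - \<psi>V x)"
      using conv AE_lebesgue_translate[OF conv, of a] by eventually_elim (intro tendsto_intros)
    show "AE x in lebesgue. norm (G x * (\<Psi> n (x - a) - \<Psi> n x)) \<le> \<bar>G x\<bar> * (2 * M)" for n
    proof (rule AE_I2)
      fix x
      have "\<bar>\<Psi> n (x - a) - \<Psi> n x\<bar> \<le> 2 * M" using \<Psi>(2)[of n x] \<Psi>(2)[of n "x-a"] by linarith
      then show "norm (G x * (\<Psi> n (x - a) - \<Psi> n x)) \<le> \<bar>G x\<bar> * (2 * M)"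
        unfolding real_norm_def abs_mult by (rule mult_left_mono) simp
    qed
  qed
  then have "(\<lambda>n. \<bar>LINT y:U|lebesgue. g y * (\<Psi> n (y - a) - \<Psi> n y)\<bar>)
      \<longlonglongrightarrow> \<bar>LINT y:U|lebesgue. g y * (\<psi>V (y - a) - \<psi>V y)\<bar>"
    unfolding G_eq by (rule tendsto_rabs)
  then have "\<bar>LINT y:U|lebesgue. g y * (\<psi>V (y - a) - \<psi>V y)\<bar>
      \<le> M * (\<Sum>i\<in>UNIV. \<bar>a $ i\<bar> * (LINT y:U|lebesgue. \<bar>v i y\<bar>))"
    by (rule LIMSEQ_le_const2)
      (intro exI allI impI weak_translation_smooth[OF U(1,2) g v \<Psi>(1)[unfolded V_def] \<Psi>(2)])
  then show ?thesis by (simp add: \<psi>V_def)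
qed

text \<open>Averaging over all translations \<open>a\<close> of \<open>U\<close> into itself gives a Poincare inequality
  in dual form.\<close>

lemma weak_poincare:
  assumes U: "open U" "convex U" "bounded U"
    and g: "set_integrable lebesgue U g" and v: "\<And>i. has_weak_partial U i g (v i)"
    and \<psi>: "\<psi> \<in> borel_measurable borel" "AE x in lebesgue. isCont \<psi> x"
    and M: "\<And>x. \<bar>\<psi> x\<bar> \<le> M"
    and mean: "(LINT y:U|lebesgue. \<psi> y) = 0"
    and d: "0 \<le> d" "\<And>x y. x \<in> U \<Longrightarrow> y \<in> U \<Longrightarrow> dist x y \<le> d"
  shows "measure lebesgue U * \<bar>LINT y:U|lebesgue. g y * \<psi> y\<bar>
    \<le> measure lebesgue (cball (0::real^2) d) * (M * d * (\<Sum>i\<in>UNIV. LINT y:U|lebesgue. \<bar>v i y\<bar>))"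
proof -
  have [measurable]: "\<psi> \<in> borel_measurable borel" "U \<in> sets borel" using \<psi> U by auto
  have "0 \<le> M" using M[of 0] by linarith
  have ig: "integrable lebesgue (\<lambda>y. indicator U y * g y)" using g by (simp add: set_integrable_def)
  \<comment> \<open>Fubini is applied to the product of two copies of \<open>lborel\<close>, so g is
    replaced by a Borel function that agrees with it almost everywhere.\<close>
  obtain G0 where G0[measurable]: "G0 \<in> borel_measurable lborel" and G0_eq: "AE x in lborel. indicator U x * g x = G0 x"
    using completion_ex_borel_measurable_real[of "\<lambda>y. indicator U y * g y" lborel] ig by auto
  define G where "G x = indicator U x * G0 x" for x
  have [measurable]: "G \<in> borel_measurable borel" using G0 unfolding G_def[abs_def] by measurable
  have G_eq: "AE x in lebesgue. indicator U x * g x = G x"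
    using AE_completion[OF G0_eq] by eventually_elim (auto simp: G_def indicator_def)
  have G_int: "integrable lborel G"
  proof -
    have "integrable lebesgue G"
      by (rule integrable_cong_AE_imp[OF ig]) (use G_eq in \<open>auto intro!: measurable_completion\<close>)
    then show ?thesis by (simp add: integrable_completion)
  qed
  define \<psi>U where "\<psi>U x = indicator U x * \<psi> x" for x
  have [measurable]: "\<psi>U \<in> borel_measurable borel" unfolding \<psi>U_def[abs_def] by measurable
  have \<psi>U_le: "\<bar>\<psi>U x\<bar> \<le> M" for x using M[of x] \<open>0 \<le> M\<close> by (auto simp: \<psi>U_def indicator_def)
  define W where "W = (\<Sum>i\<in>UNIV. LINT y:U|lebesgue. \<bar>v i y\<bar>)"
  \<comment> \<open>For fixed a this is the integrand of the translation estimate, as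
    \<open>indicator V y\<close> equals \<open>indicator U (y + a)\<close> for y in U. For fixed y,
    integration over a kills the first term, since \<psi> has mean zero over U, and turns the second
    into the measure of U.\<close>
  define F where "F = (\<lambda>(a, y). G y * (\<psi>U (y - a) - \<psi>U y * indicator U (y + a)))"
  have [measurable]: "F \<in> borel_measurable (lborel \<Otimes>\<^sub>M lborel)"
    unfolding F_def split_beta' by measurable
  \<comment> \<open>A nonzero value requires two points of U with difference a, so a is confined to
    the ball of radius d. This makes F integrable over all translations and produces the measure of
    that ball in the claim.\<close>
  have F_bound: "\<bar>F (a, y)\<bar> \<le> indicator (cball 0 d) a * (2 * M) * \<bar>G y\<bar>" for a y
  proof (cases "F (a, y) = 0")
    case False
    then have "y \<in> U" "y - a \<in> U \<or> y + a \<in> U"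
      by (auto simp: F_def G_def \<psi>U_def indicator_def split: if_splits)
    then have "norm a \<le> d" using d(2)[of "y - a" y] d(2)[of y "y + a"] by (auto simp: dist_norm)
    have "\<bar>\<psi>U y * indicator U (y + a)\<bar> \<le> M" using \<psi>U_le[of y] \<open>0 \<le> M\<close> by (auto simp: indicator_def)
    then have "\<bar>\<psi>U (y - a) - \<psi>U y * indicator U (y + a)\<bar> \<le> 2 * M"
      using \<psi>U_le[of "y - a"] by linarith
    then have "\<bar>F (a, y)\<bar> \<le> \<bar>G y\<bar> * (2 * M)"
      unfolding F_def split_conv abs_mult by (intro mult_left_mono) auto
    then show ?thesis using \<open>norm a \<le> d\<close> by (simp add: mult.commute)
  qed (use \<open>0 \<le> M\<close> in auto)
  have int_ball: "integrable lborel (\<lambda>a::real^2. indicator (cball 0 d) a * c)" for c :: real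
    using emeasure_lborel_cball_finite[of "0::real^2" d]
    by (intro integrable_mult_left integrable_real_indicator) auto
  have F_sec: "integrable lborel (\<lambda>y. F (a, y))" for a
    by (rule Bochner_Integration.integrable_bound[where f="\<lambda>y. (indicator (cball 0 d) a * (2 * M)) * \<bar>G y\<bar>"])
      (use G_int F_bound \<open>0 \<le> M\<close> in \<open>auto simp: abs_mult\<close>)
  have F_int: "integrable (lborel \<Otimes>\<^sub>M lborel) F"
  proof (rule lborel_pair.Fubini_integrable)
    show "integrable lborel (\<lambda>a. LINT y|lborel. norm (F (a, y)))"
    proof (rule Bochner_Integration.integrable_bound[OF int_ball[of "2 * M * (LINT y|lborel. \<bar>G y\<bar>)"]])
      show "AE a in lborel. norm (LINT y|lborel. norm (F (a, y)))
          \<le> norm (indicator (cball 0 d) a * (2 * M * (LINT y|lborel. \<bar>G y\<bar>)))"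
      proof (rule AE_I2)
        fix a :: "real^2"
        have "(LINT y|lborel. norm (F (a, y))) \<le> (LINT y|lborel. indicator (cball 0 d) a * (2 * M) * \<bar>G y\<bar>)"
          using F_sec[of a] F_bound[of a] G_int by (intro integral_mono) auto
        then show "norm (LINT y|lborel. norm (F (a, y)))
          \<le> norm (indicator (cball 0 d) a * (2 * M * (LINT y|lborel. \<bar>G y\<bar>)))"
          using \<open>0 \<le> M\<close> by (simp add: abs_mult mult.assoc)
      qed
    qed measurable
  qed (use F_sec in auto)
  have H_bound: "\<bar>LINT y|lborel. F (a, y)\<bar> \<le> indicator (cball 0 d) a * (M * d * W)" for a
  proof (cases "norm a \<le> d")
    case True
    define V where "V = {x\<in>U. x + a \<in> U}"
    have "(LINT y|lborel. F (a, y)) = (LINT y|lebesgue. F (a, y))"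
      by (rule integral_completion[symmetric]) measurable
    also have "\<dots> = (LINT y:U|lebesgue. g y * (indicator V (y - a) * \<psi> (y - a) - indicator V y * \<psi> y))"
      unfolding set_lebesgue_integral_def
    proof (rule integral_cong_AE)
      show "(\<lambda>y. F (a, y)) \<in> borel_measurable lebesgue" by (rule measurable_completion) measurable
      have [measurable]: "V \<in> sets borel" unfolding V_def by measurable
      have [measurable]: "(\<lambda>y. indicator V (y - a) * \<psi> (y - a) - indicator V y * \<psi> y) \<in> borel_measurable lebesgue"
        by (rule measurable_completion) measurable
      have [measurable]: "(\<lambda>y. indicator U y * g y) \<in> borel_measurable lebesgue" using ig by auto
      show "(\<lambda>y. indicator U y *\<^sub>R (g y * (indicator V (y - a) * \<psi> (y - a) - indicator V y * \<psi> y)))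
          \<in> borel_measurable lebesgue"
        unfolding real_scaleR_def mult.assoc[symmetric] by measurable
      show "AE y in lebesgue. F (a, y) = indicator U y *\<^sub>R (g y * (indicator V (y - a) * \<psi> (y - a) - indicator V y * \<psi> y))"
        using G_eq
      proof eventually_elim
        case (elim y)
        have "F (a, y) = (indicator U y * g y) * (\<psi>U (y - a) - \<psi>U y * indicator U (y + a))"
          unfolding F_def split_conv elim ..
        also have "\<dots> = indicator U y *\<^sub>R (g y * (indicator V (y - a) * \<psi> (y - a) - indicator V y * \<psi> y))"
          by (simp add: \<psi>U_def V_def indicator_def)
        finally show ?case .
      qed
    qed
    also have "\<bar>\<dots>\<bar> \<le> M * (\<Sum>i\<in>UNIV. \<bar>a $ i\<bar> * (LINT y:U|lebesgue. \<bar>v i y\<bar>))"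
      by (rule weak_translation[OF U g v \<psi> M V_def])
    also have "\<dots> \<le> M * (\<Sum>i\<in>UNIV. d * (LINT y:U|lebesgue. \<bar>v i y\<bar>))"
      using True component_le_norm_cart[of a] \<open>0 \<le> M\<close>
      by (intro mult_left_mono sum_mono mult_right_mono)
        (auto simp: set_lebesgue_integral_def intro: order_trans)
    finally show ?thesis using True by (simp add: W_def sum_distrib_left mult.assoc)
  next
    case False
    then have "F (a, y) = 0" for y using F_bound[of a y] by simp
    then show ?thesis using False by simp
  qed
  have "(LINT a|lborel. LINT y|lborel. F (a, y)) = (LINT y|lborel. LINT a|lborel. F (a, y))"
    using lborel_pair.Fubini_integral[of "\<lambda>a y. F (a, y)"] F_int by simp
  also have "\<dots> = (LINT y|lborel. - (measure lborel U * (G y * \<psi>U y)))"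
  proof (rule Bochner_Integration.integral_cong)
    fix y :: "real^2"
    have U_fin: "emeasure lborel U < \<infinity>" using U by (intro emeasure_bounded_finite)
    have U_int: "integrable lborel (indicator U :: real^2 \<Rightarrow> real)"
      using U_fin by (intro integrable_real_indicator) auto
    have \<psi>U_int: "integrable lborel \<psi>U"
    proof (rule Bochner_Integration.integrable_bound)
      show "integrable lborel (\<lambda>x. M * indicator U x :: real)" by (intro integrable_mult_right U_int)
      show "AE x in lborel. norm (\<psi>U x) \<le> norm (M * indicator U x)"
        using M \<open>0 \<le> M\<close> by (intro AE_I2) (simp add: \<psi>U_def indicator_def)
    qed measurable
    have 1: "(LINT a|lborel. \<psi>U (y - a)) = 0"
    proof -
      have "(LINT a|lborel. \<psi>U (y - a)) = (LINT a|lborel. \<psi>U a)"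
        by (rule lborel_integral_reflect) measurable
      also have "\<dots> = (LINT a|lebesgue. \<psi>U a)" by (rule integral_completion[symmetric]) measurable
      also have "\<dots> = 0" using mean by (simp add: \<psi>U_def set_lebesgue_integral_def)
      finally show ?thesis .
    qed
    have tr: "(LINT a|lborel. f (y + a)) = (LINT a|lborel. f a)" "integrable lborel (\<lambda>a. f (y + a)) = integrable lborel f"
      if [measurable]: "f \<in> borel_measurable borel" for f :: "real^2 \<Rightarrow> real"
      by (subst (2) lborel_distr_plus[symmetric, of y], simp add: integral_distr integrable_distr_eq)+
    have 2: "(LINT a|lborel. indicator U (y + a)) = measure lborel U"
      by (subst tr) auto
    have i2: "integrable lborel (\<lambda>a. indicator U (y + a) :: real)"
      by (subst tr) (use U_fin in auto)
    have i1: "integrable lborel (\<lambda>a. \<psi>U (y - a))"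
    proof -
      have *: "lborel = density (distr lborel borel (\<lambda>x::real^2. y - x)) (\<lambda>_. 1)"
        using lborel_affine[of "-1" y] by simp
      have "integrable (density (distr lborel borel (\<lambda>x::real^2. y - x)) (\<lambda>_. 1)) \<psi>U"
        using \<psi>U_int by (subst *[symmetric])
      then show ?thesis by (simp add: density_1 integrable_distr_eq)
    qed
    have "(LINT a|lborel. F (a, y)) = G y * (LINT a|lborel. \<psi>U (y - a) - \<psi>U y * indicator U (y + a))"
      by (simp add: F_def)
    also have "\<dots> = G y * (0 - \<psi>U y * measure lborel U)"
      using i1 i2 1 2 by (subst Bochner_Integration.integral_diff) auto
    finally show "(LINT a|lborel. F (a, y)) = - (measure lborel U * (G y * \<psi>U y))" by simp
  qed simp
  also have "\<dots> = - (measure lborel U * (LINT y|lborel. G y * \<psi>U y))" by simp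
  finally have "measure lborel U * \<bar>LINT y|lborel. G y * \<psi>U y\<bar> = \<bar>LINT a|lborel. LINT y|lborel. F (a, y)\<bar>"
    by (simp add: abs_mult)
  also have "\<dots> \<le> (LINT a|lborel. \<bar>LINT y|lborel. F (a, y)\<bar>)" by (rule integral_abs_bound)
  also have "\<dots> \<le> (LINT a|lborel. indicator (cball (0::real^2) d) a * (M * d * W))"
    using lborel_pair.integrable_fst'[OF F_int] int_ball H_bound by (intro integral_mono) auto
  also have "\<dots> = measure lborel (cball (0::real^2) d) * (M * d * W)" by simp
  finally have *: "measure lborel U * \<bar>LINT y|lborel. G y * \<psi>U y\<bar>
      \<le> measure lborel (cball (0::real^2) d) * (M * d * W)" .
  have "(LINT y|lborel. G y * \<psi>U y) = (LINT y|lebesgue. G y * \<psi>U y)"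
    by (rule integral_completion[symmetric]) measurable
  also have "\<dots> = (LINT y:U|lebesgue. g y * \<psi> y)"
    unfolding set_lebesgue_integral_def
  proof (rule integral_cong_AE)
    show "(\<lambda>y. G y * \<psi>U y) \<in> borel_measurable lebesgue" by (rule measurable_completion) measurable
    have [measurable]: "\<psi> \<in> borel_measurable lebesgue"
      by (rule measurable_completion) measurable
    have [measurable]: "(\<lambda>y. indicator U y * g y) \<in> borel_measurable lebesgue" using ig by auto
    show "(\<lambda>y. indicator U y *\<^sub>R (g y * \<psi> y)) \<in> borel_measurable lebesgue"
      unfolding real_scaleR_def mult.assoc[symmetric] by measurable
    show "AE y in lebesgue. G y * \<psi>U y = indicator U y *\<^sub>R (g y * \<psi> y)"
      using G_eq by eventually_elim (auto simp: \<psi>U_def indicator_def)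
  qed
  finally show ?thesis using * by (simp add: W_def)
qed

lemma AE_isCont_translate:
  fixes \<psi> :: "'a::euclidean_space \<Rightarrow> real"
  assumes "AE x in lebesgue. isCont \<psi> x"
  shows "AE x in lebesgue. isCont (\<lambda>x. \<psi> (x - a)) x"
proof -
  have "isCont (\<lambda>x. \<psi> (x - a)) x" if "isCont \<psi> (x - a)" for x
    using that by (intro isCont_o2[where f="\<lambda>x. x - a" and g=\<psi>]) auto
  then show ?thesis using AE_lebesgue_translate[OF assms, of a] by auto
qed

text \<open>A function \<open>\<psi>\<close> living on the slab \<open>l < L / N\<close> is moved in \<open>N\<close> steps of width \<open>L / N\<close>. Its
  translates have disjoint supports, and so have every other of the slabs swept in the steps.\<close>

lemma weak_slab:
  fixes l :: "real^2 \<Rightarrow> real"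
  assumes U: "open U" "convex U" "bounded U"
    and g: "set_integrable lebesgue U g" and v: "\<And>i. has_weak_partial U i g (v i)"
    and \<psi>: "\<psi> \<in> borel_measurable borel" "AE x in lebesgue. isCont \<psi> x"
    and M: "\<And>x. \<bar>\<psi> x\<bar> \<le> M"
    and l: "\<And>x. l x = n \<bullet> x + b" "n \<bullet> d = 1"
    and N: "0 < N" "0 < L"
    and supp: "\<And>x. \<psi> x \<noteq> 0 \<Longrightarrow> 0 < l x \<and> l x < L / real N \<and> (\<forall>s\<in>{0..L}. x + s *\<^sub>R d \<in> U)"
  shows "\<bar>LINT y:U|lebesgue. g y * \<psi> y\<bar> \<le> M / N * (LINT y:U|lebesgue. \<bar>g y\<bar>)
     + 2 * M * L / N * (\<Sum>i\<in>UNIV. \<bar>d $ i\<bar> * (LINT y:U|lebesgue. \<bar>v i y\<bar>))"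
proof -
  define \<delta> where "\<delta> = L / N"
  have \<delta>: "0 < \<delta>" "N * \<delta> = L" using N by (auto simp: \<delta>_def)
  have "0 \<le> M" using M[of 0] by linarith
  have [measurable]: "\<psi> \<in> borel_measurable borel" "U \<in> sets borel" using \<psi> U by auto
  define G where "G y = indicator U y * g y" for y
  have G: "integrable lebesgue G" using g by (simp add: set_integrable_def G_def[abs_def])
  define V where "V i y = indicator U y * v i y" for i y
  have V: "integrable lebesgue (V i)" for i
    using v[of i] by (simp add: set_integrable_def V_def[abs_def] has_weak_partial_def)
  define a where "a = \<delta> *\<^sub>R d"
  have la: "l (x + s *\<^sub>R a) = l x + s * \<delta>" "l (x - s *\<^sub>R a) = l x - s * \<delta>" for x s
    using l(2) by (simp_all add: l(1) a_def inner_add_right inner_diff_right)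
  define \<phi> where "\<phi> j y = \<psi> (y - real j *\<^sub>R a)" for j y
  have \<phi>_meas[measurable]: "\<phi> j \<in> borel_measurable borel" for j unfolding \<phi>_def[abs_def] by measurable
  have \<phi>_leb[measurable]: "\<phi> j \<in> borel_measurable lebesgue" for j by (rule measurable_completion) measurable
  have \<phi>_M: "\<bar>\<phi> j y\<bar> \<le> M" for j y by (simp add: \<phi>_def M)
  have \<phi>_supp: "real j * \<delta> < l y" "l y < real (Suc j) * \<delta>" "y \<in> U" "y + a \<in> U"
    if "\<phi> j y \<noteq> 0" "j < N" for j y
  proof -
    note s = supp[OF that(1)[unfolded \<phi>_def]]
    show "real j * \<delta> < l y" "l y < real (Suc j) * \<delta>"
      using s by (simp_all add: la \<delta>_def[symmetric] distrib_right)
    have "real j * \<delta> \<le> real N * \<delta>" "real (Suc j) * \<delta> \<le> real N * \<delta>"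
      using that(2) \<delta> by (intro mult_right_mono; simp)+
    then have "real j * \<delta> \<in> {0..L}" "real (Suc j) * \<delta> \<in> {0..L}"
      using \<delta> by auto
    then have "y - real j *\<^sub>R a + (real j * \<delta>) *\<^sub>R d \<in> U" "y - real j *\<^sub>R a + (real (Suc j) * \<delta>) *\<^sub>R d \<in> U"
      using s by blast+
    then show "y \<in> U" "y + a \<in> U" by (simp_all add: a_def algebra_simps)
  qed
  \<comment> \<open>Two steps wide, so that it holds \<open>\<phi> j\<close> together with its next
    translate, and still open and convex, so that the translation estimate applies with the norm of
    the weak derivatives over this piece alone.\<close>
  define Uj where "Uj j = {x\<in>U. real j * \<delta> < l x \<and> l x < (real j + 2) * \<delta>}" for j
  have Uj_eq: "Uj j = U \<inter> {x. n \<bullet> x > real j * \<delta> - b} \<inter> {x. n \<bullet> x < (real j + 2) * \<delta> - b}" for j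
    by (auto simp: Uj_def l(1))
  have Uj: "open (Uj j)" "convex (Uj j)" "Uj j \<subseteq> U" for j
    unfolding Uj_eq using U
    by (auto intro!: open_Int convex_Int open_halfspace_gt open_halfspace_lt convex_halfspace_gt convex_halfspace_lt)
  have Uj_bd: "bounded (Uj j)" for j using bounded_subset[OF U(3) Uj(3)] .
  have [measurable]: "Uj j \<in> sets borel" for j using Uj by auto
  have [measurable]: "Uj j \<in> sets lebesgue" for j by simp
  define K where "K = (\<Sum>i\<in>UNIV. \<bar>d $ i\<bar> * (LINT y|lebesgue. \<bar>V i y\<bar>))"
  have step: "\<bar>LINT y|lebesgue. G y * (\<phi> (Suc j) y - \<phi> j y)\<bar>
      \<le> M * (\<Sum>i\<in>UNIV. \<bar>a $ i\<bar> * (LINT y|lebesgue. \<bar>V i y\<bar> * indicator (Uj j) y))" if j: "j < N" for j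
  proof -
    define W where "W = {x\<in>Uj j. x + a \<in> Uj j}"
    have W: "\<phi> j y \<noteq> 0 \<Longrightarrow> y \<in> W" for y
      using \<phi>_supp[OF _ j, of y] la(1)[of y 1] \<delta> by (auto simp: W_def Uj_def distrib_right)
    have "\<bar>LINT y:Uj j|lebesgue. g y * (indicator W (y - a) * \<phi> j (y - a) - indicator W y * \<phi> j y)\<bar>
      \<le> M * (\<Sum>i\<in>UNIV. \<bar>a $ i\<bar> * (LINT y:Uj j|lebesgue. \<bar>v i y\<bar>))"
    proof (rule weak_translation[OF Uj(1,2) Uj_bd])
      show "set_integrable lebesgue (Uj j) g" using Uj by (intro set_integrable_subset[OF g]) auto
      show "has_weak_partial (Uj j) i g (v i)" for i using Uj by (intro has_weak_partial_subset[OF v]) auto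
      show "AE x in lebesgue. isCont (\<phi> j) x" unfolding \<phi>_def[abs_def] by (rule AE_isCont_translate[OF \<psi>(2)])
    qed (use \<phi>_M W_def in auto)
    moreover have "(LINT y:Uj j|lebesgue. g y * (indicator W (y - a) * \<phi> j (y - a) - indicator W y * \<phi> j y))
      = (LINT y|lebesgue. G y * (\<phi> (Suc j) y - \<phi> j y))"
      unfolding set_lebesgue_integral_def
    proof (rule Bochner_Integration.integral_cong)
      fix y
      have 1: "\<phi> (Suc j) y = \<phi> j (y - a)" by (simp add: \<phi>_def algebra_simps)
      have 2: "indicator W y * \<phi> j y = \<phi> j y" for y using W[of y] by (auto simp: indicator_def)
      have "\<phi> j (y - a) = 0 \<and> \<phi> j y = 0" if "y \<notin> Uj j"
        using W[of y] W[of "y - a"] that by (auto simp: W_def)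
      then show "indicator (Uj j) y *\<^sub>R (g y * (indicator W (y - a) * \<phi> j (y - a) - indicator W y * \<phi> j y))
          = G y * (\<phi> (Suc j) y - \<phi> j y)"
        using Uj(3)[of j] unfolding 1 2 by (auto simp: G_def indicator_def)
    qed simp
    moreover have "(LINT y:Uj j|lebesgue. \<bar>v i y\<bar>) = (LINT y|lebesgue. \<bar>V i y\<bar> * indicator (Uj j) y)" for i
      unfolding set_lebesgue_integral_def using Uj(3)[of j]
      by (intro Bochner_Integration.integral_cong) (auto simp: V_def indicator_def)
    ultimately show ?thesis by (simp only:)
  qed
  have overlap: "(\<Sum>j<N. LINT y|lebesgue. \<bar>V i y\<bar> * indicator (Uj j) y) \<le> 2 * (LINT y|lebesgue. \<bar>V i y\<bar>)" for i
  proof -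
    have int: "integrable lebesgue (\<lambda>y. \<bar>V i y\<bar> * indicator (Uj j) y)" for j
      using V[of i] by (intro integrable_mult_bounded[where B=1]) auto
    have count: "(\<Sum>j<N. indicator (Uj j) y) \<le> (2::real)" for y
    proof -
      \<comment> \<open>Membership confines \<open>l y / \<delta>\<close> to the open interval from
        j to j + 2, which leaves two values of j, written here through the ceiling.\<close>
      have "{j\<in>{..<N}. y \<in> Uj j} \<subseteq> {nat \<lceil>l y / \<delta>\<rceil> - 2, nat \<lceil>l y / \<delta>\<rceil> - 1}"
      proof
        fix j assume "j \<in> {j\<in>{..<N}. y \<in> Uj j}"
        then have "real j < l y / \<delta>" "l y / \<delta> < real j + 2"
          using \<delta> by (auto simp: Uj_def field_simps)
        then have "\<lceil>l y / \<delta>\<rceil> = int j + 1 \<or> \<lceil>l y / \<delta>\<rceil> = int j + 2" by linarith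
        then show "j \<in> {nat \<lceil>l y / \<delta>\<rceil> - 2, nat \<lceil>l y / \<delta>\<rceil> - 1}" by auto
      qed
      then have "card {j\<in>{..<N}. y \<in> Uj j} \<le> card {nat \<lceil>l y / \<delta>\<rceil> - 2, nat \<lceil>l y / \<delta>\<rceil> - 1}"
        by (intro card_mono) auto
      also have "\<dots> \<le> 2" by (simp add: card_insert_if)
      finally have "real (card {j\<in>{..<N}. y \<in> Uj j}) \<le> 2" by simp
      also have "real (card {j\<in>{..<N}. y \<in> Uj j}) = (\<Sum>j<N. indicator (Uj j) y)"
        by (simp add: indicator_def sum.If_cases Int_def)
      finally show ?thesis .
    qed
    have "(\<Sum>j<N. LINT y|lebesgue. \<bar>V i y\<bar> * indicator (Uj j) y)
        = (LINT y|lebesgue. \<bar>V i y\<bar> * (\<Sum>j<N. indicator (Uj j) y))"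
      unfolding sum_distrib_left by (rule Bochner_Integration.integral_sum[symmetric]) (rule int)
    also have "\<dots> \<le> (LINT y|lebesgue. \<bar>V i y\<bar> * 2)"
    proof (rule integral_mono)
      show "integrable lebesgue (\<lambda>y. \<bar>V i y\<bar> * (\<Sum>j<N. indicator (Uj j) y))"
        unfolding sum_distrib_left by (intro Bochner_Integration.integrable_sum int)
      show "integrable lebesgue (\<lambda>y. \<bar>V i y\<bar> * 2)" using V[of i] by simp
    qed (use count in \<open>auto intro: mult_left_mono\<close>)
    finally show ?thesis by simp
  qed
  have int: "integrable lebesgue (\<lambda>y. G y * \<phi> j y)" for j
    by (rule integrable_mult_bounded[OF G \<phi>_leb \<phi>_M])
  define A where "A j = (LINT y|lebesgue. G y * \<phi> j y)" for j
  have A_step: "\<bar>A (Suc j) - A j\<bar> \<le> M * (\<Sum>i\<in>UNIV. \<bar>a $ i\<bar> * (LINT y|lebesgue. \<bar>V i y\<bar> * indicator (Uj j) y))"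
    if "j < N" for j
    using step[OF that] unfolding A_def by (simp add: right_diff_distrib Bochner_Integration.integral_diff[OF int int])
  define S where "S = M * (\<Sum>i\<in>UNIV. \<bar>a $ i\<bar> * (2 * (LINT y|lebesgue. \<bar>V i y\<bar>)))"
  have A_sum: "(\<Sum>j<N. \<bar>A (Suc j) - A j\<bar>) \<le> S"
  proof -
    have "(\<Sum>j<N. \<bar>A (Suc j) - A j\<bar>)
        \<le> (\<Sum>j<N. M * (\<Sum>i\<in>UNIV. \<bar>a $ i\<bar> * (LINT y|lebesgue. \<bar>V i y\<bar> * indicator (Uj j) y)))"
      by (intro sum_mono A_step) auto
    also have "\<dots> = M * (\<Sum>i\<in>UNIV. \<bar>a $ i\<bar> * (\<Sum>j<N. LINT y|lebesgue. \<bar>V i y\<bar> * indicator (Uj j) y))"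
      unfolding sum_distrib_left by (rule sum.swap)
    also have "\<dots> \<le> S" unfolding S_def using \<open>0 \<le> M\<close>
      by (intro mult_left_mono sum_mono overlap) auto
    finally show ?thesis .
  qed
  \<comment> \<open>Each of the N integrals \<open>A m\<close> differs from \<open>A 0\<close> by at
    most S, while together they are bounded by M times the norm of g. Averaging over m puts the
    factor 1 / N in front of that norm.\<close>
  have A0: "\<bar>A 0\<bar> \<le> \<bar>A m\<bar> + S" if "m < N" for m
  proof -
    have "A m - A 0 = (\<Sum>j<m. A (Suc j) - A j)" by (simp add: sum_lessThan_telescope)
    then have "\<bar>A m - A 0\<bar> \<le> (\<Sum>j<m. \<bar>A (Suc j) - A j\<bar>)" by (simp add: sum_abs)
    also have "\<dots> \<le> (\<Sum>j<N. \<bar>A (Suc j) - A j\<bar>)" using that by (intro sum_mono2) auto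
    finally show ?thesis using A_sum by linarith
  qed
  have A_total: "(\<Sum>m<N. \<bar>A m\<bar>) \<le> M * (LINT y|lebesgue. \<bar>G y\<bar>)"
  proof -
    have count: "(\<Sum>m<N. \<bar>\<phi> m y\<bar>) \<le> M" for y
    proof (cases "\<exists>m<N. \<phi> m y \<noteq> 0")
      case True
      then obtain m where m: "m < N" "\<phi> m y \<noteq> 0" by auto
      have "\<phi> j y = 0" if "j \<noteq> m" "j < N" for j
      proof (rule ccontr)
        assume j: "\<phi> j y \<noteq> 0"
        have "real j * \<delta> < real (Suc m) * \<delta>" "real m * \<delta> < real (Suc j) * \<delta>"
          using \<phi>_supp[OF j that(2)] \<phi>_supp[OF m(2,1)] by linarith+
        then have "j < Suc m" "m < Suc j" using \<delta> by (simp_all only: mult_less_cancel_right_pos of_nat_less_iff)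
        then show False using that by simp
      qed
      then have "(\<Sum>m<N. \<bar>\<phi> m y\<bar>) = (\<Sum>j\<in>{m}. \<bar>\<phi> j y\<bar>)"
        using m by (intro sum.mono_neutral_right) auto
      then show ?thesis using \<phi>_M[of m y] by simp
    qed (use \<open>0 \<le> M\<close> in auto)
    have int': "integrable lebesgue (\<lambda>y. \<bar>G y\<bar> * \<bar>\<phi> m y\<bar>)" for m
      using integrable_abs[OF int[of m]] by (simp add: abs_mult)
    have "(\<Sum>m<N. \<bar>A m\<bar>) \<le> (\<Sum>m<N. LINT y|lebesgue. \<bar>G y\<bar> * \<bar>\<phi> m y\<bar>)"
      unfolding A_def abs_mult[symmetric] by (intro sum_mono integral_abs_bound)
    also have "\<dots> = (LINT y|lebesgue. \<bar>G y\<bar> * (\<Sum>m<N. \<bar>\<phi> m y\<bar>))"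
      unfolding sum_distrib_left by (rule Bochner_Integration.integral_sum[symmetric]) (rule int')
    also have "\<dots> \<le> (LINT y|lebesgue. \<bar>G y\<bar> * M)"
    proof (rule integral_mono)
      show "integrable lebesgue (\<lambda>y. \<bar>G y\<bar> * (\<Sum>m<N. \<bar>\<phi> m y\<bar>))"
        unfolding sum_distrib_left by (intro Bochner_Integration.integrable_sum int')
      show "integrable lebesgue (\<lambda>y. \<bar>G y\<bar> * M)" using G by simp
    qed (use count in \<open>auto intro: mult_left_mono\<close>)
    finally show ?thesis by (simp add: mult.commute)
  qed
  have "N * \<bar>A 0\<bar> \<le> (\<Sum>m<N. \<bar>A m\<bar> + S)"
    using sum_mono[of "{..<N}" "\<lambda>_. \<bar>A 0\<bar>" "\<lambda>m. \<bar>A m\<bar> + S"] A0 by simp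
  then have "N * \<bar>A 0\<bar> \<le> M * (LINT y|lebesgue. \<bar>G y\<bar>) + N * S"
    using A_total by (simp add: sum.distrib)
  then have "\<bar>A 0\<bar> \<le> M / N * (LINT y|lebesgue. \<bar>G y\<bar>) + S"
    using N by (simp add: field_simps)
  also have "S = 2 * M * L / N * K"
    using \<delta> N by (simp add: S_def K_def a_def \<delta>_def abs_mult sum_distrib_left mult_ac)
  finally have "\<bar>A 0\<bar> \<le> M / N * (LINT y|lebesgue. \<bar>G y\<bar>) + 2 * M * L / N * K" .
  moreover have "A 0 = (LINT y:U|lebesgue. g y * \<psi> y)"
    by (simp add: A_def set_lebesgue_integral_def G_def \<phi>_def mult.assoc)
  moreover have "(LINT y|lebesgue. \<bar>G y\<bar>) = (LINT y:U|lebesgue. \<bar>g y\<bar>)"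
    by (simp add: set_lebesgue_integral_def G_def abs_mult)
  moreover have "(LINT y|lebesgue. \<bar>V i y\<bar>) = (LINT y:U|lebesgue. \<bar>v i y\<bar>)" for i
    by (simp add: set_lebesgue_integral_def V_def abs_mult)
  ultimately show ?thesis by (simp add: K_def)
qed

subsection \<open>Triangles and reference maps\<close>

lemma T_ref_eq: "T_ref = {x. 0 \<le> x $ 1 \<and> 0 \<le> x $ 2 \<and> x $ 1 + x $ 2 \<le> 1}"
proof (intro set_eqI iffI)
  fix x :: "real^2" assume "x \<in> T_ref"
  then show "x \<in> {x. 0 \<le> x $ 1 \<and> 0 \<le> x $ 2 \<and> x $ 1 + x $ 2 \<le> 1}"
    by (auto simp: T_ref_def convex_hull_3 axis_def)
next
  fix x :: "real^2" assume x: "x \<in> {x. 0 \<le> x $ 1 \<and> 0 \<le> x $ 2 \<and> x $ 1 + x $ 2 \<le> 1}"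
  have "x = (1 - x $ 1 - x $ 2) *\<^sub>R 0 + x $ 1 *\<^sub>R axis 1 1 + x $ 2 *\<^sub>R axis 2 1"
    by (simp add: vec_eq_iff forall_2 axis_def)
  then show "x \<in> T_ref" unfolding T_ref_def convex_hull_3 using x
    by (intro CollectI exI[of _ "1 - x $ 1 - x $ 2"] exI[of _ "x $ 1"] exI[of _ "x $ 2"]) auto
qed

text \<open>Injectivity is given on \<open>T_ref\<close> only. It extends to the plane because
  \<open>T_ref\<close> has interior points: a kernel vector, scaled down, joins two points of
  \<open>T_ref\<close> with the same image.\<close>

lemma reference_map_affine:
  assumes "reference_map T F"
  obtains B where "linear B" "\<And>\<xi>. F \<xi> = F 0 + B \<xi>" "inj B"
proof -
  define B where "B \<xi> = F \<xi> - F 0" for \<xi>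
  have B: "linear B" "inj_on F T_ref"
    using assms by (auto simp: reference_map_def B_def[abs_def] bij_betw_def)
  have "inj B"
  proof (subst linear_injective_0[OF B(1)], intro allI impI, rule ccontr)
    fix \<xi> assume \<xi>: "B \<xi> = 0" "\<xi> \<noteq> 0"
    \<comment> \<open>Moving the centroid (1/3, 1/3) by at most 1/6 in each coordinate stays in
      \<open>T_ref\<close>: the coordinates stay positive, and their sum is at most 2/3 +
      1/3.\<close>
    define t where "t = 1 / (6 * norm \<xi>)"
    have t: "t > 0" "t * norm \<xi> = 1/6" using \<xi>(2) by (auto simp: t_def)
    define p :: "real^2" where "p = (\<chi> i. 1/3)"
    have *: "\<bar>t * \<xi> $ i\<bar> \<le> 1/6" for i
      using component_le_norm_cart[of \<xi> i] t unfolding abs_mult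
      by (metis abs_of_pos mult_left_mono less_imp_le)
    have "p \<in> T_ref" "p + t *\<^sub>R \<xi> \<in> T_ref"
      using *[of 1] *[of 2] by (auto simp: T_ref_eq p_def abs_le_iff)
    moreover have "F (p + t *\<^sub>R \<xi>) = F p"
    proof -
      have "B (p + t *\<^sub>R \<xi>) = B p" using B(1) \<xi>(1) by (simp add: linear_add linear_cmul)
      then show ?thesis by (simp add: B_def)
    qed
    ultimately have "p + t *\<^sub>R \<xi> = p" using B(2) by (auto dest: inj_onD)
    then show False using t \<xi>(2) by simp
  qed
  then show ?thesis using B that[of B] by (simp add: B_def)
qed

lemma reference_map_inverse:
  assumes "reference_map T F"
  obtains L c where "linear L" "\<And>x. F (L x + c) = x" "\<And>\<xi>. L (F \<xi>) + c = \<xi>"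
    "\<And>x. x \<in> T \<longleftrightarrow> L x + c \<in> T_ref"
proof -
  obtain B where B: "linear B" "\<And>\<xi>. F \<xi> = F 0 + B \<xi>" "inj B"
    by (rule reference_map_affine[OF assms], rule that)
  obtain L where L: "linear L" "\<And>x. L (B x) = x" "\<And>x. B (L x) = x"
    using linear_injective_isomorphism[OF B(1,3)] by blast
  have 1: "F (L x + - L (F 0)) = x" for x
    unfolding B(2)[of "L x + - L (F 0)"] using B(1) L by (simp add: linear_diff)
  have 2: "L (F \<xi>) + - L (F 0) = \<xi>" for \<xi>
    unfolding B(2)[of \<xi>] using L by (simp add: linear_add)
  have "x \<in> T \<longleftrightarrow> L x + - L (F 0) \<in> T_ref" for x
  proof
    assume "x \<in> T"
    then obtain \<xi> where "\<xi> \<in> T_ref" "x = F \<xi>"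
      using assms by (auto simp: reference_map_def bij_betw_def)
    then show "L x + - L (F 0) \<in> T_ref" using 2 by simp
  next
    assume "L x + - L (F 0) \<in> T_ref"
    then have "F (L x + - L (F 0)) \<in> T" using assms by (auto simp: reference_map_def bij_betw_def)
    then show "x \<in> T" using 1 by simp
  qed
  then show ?thesis by (rule that[OF L(1) 1 2])
qed

lemma affine_image_T_ref:
  fixes a b c :: "real^2"
  shows "(\<lambda>\<xi>::real^2. a + (\<xi> $ 1 *\<^sub>R (b - a) + \<xi> $ 2 *\<^sub>R (c - a))) ` T_ref = convex hull {a, b, c}"
proof -
  have lin: "linear (\<lambda>\<xi>::real^2. \<xi> $ 1 *\<^sub>R (b - a) + \<xi> $ 2 *\<^sub>R (c - a))"
    by (intro linearI) (auto simp: algebra_simps)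
  have "(\<lambda>\<xi>::real^2. a + (\<xi> $ 1 *\<^sub>R (b - a) + \<xi> $ 2 *\<^sub>R (c - a))) ` T_ref
      = (+) a ` ((\<lambda>\<xi>::real^2. \<xi> $ 1 *\<^sub>R (b - a) + \<xi> $ 2 *\<^sub>R (c - a)) ` T_ref)"
    by (simp only: image_image)
  also have "\<dots> = convex hull ((+) a ` (\<lambda>\<xi>::real^2. \<xi> $ 1 *\<^sub>R (b - a) + \<xi> $ 2 *\<^sub>R (c - a)) ` {0, axis 1 1, axis 2 1})"
    by (simp only: T_ref_def convex_hull_linear_image[OF lin] convex_hull_translation)
  also have "\<dots> = convex hull {a, b, c}" by (simp add: axis_def)
  finally show ?thesis .
qed

lemma simplex_reference_map:
  assumes "2 simplex (T :: (real^2) set)"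
  obtains F where "reference_map T F"
proof -
  obtain C where C: "\<not> affine_dependent C" "int (card C) = 2 + 1" "T = convex hull C"
    using assms by (auto simp: simplex_def)
  then have "card C = 3" by simp
  then obtain a b c where abc: "C = {a, b, c}" "a \<noteq> b" "a \<noteq> c" "b \<noteq> c"
    by (auto simp: card_3_iff)
  define B where "B \<xi> = \<xi> $ 1 *\<^sub>R (b - a) + \<xi> $ 2 *\<^sub>R (c - a)" for \<xi> :: "real^2"
  have lin: "linear B" unfolding B_def[abs_def] by (intro linearI) (auto simp: algebra_simps)
  have "inj B"
  proof (subst linear_injective_0[OF lin], intro allI impI, rule ccontr)
    fix \<xi> assume \<xi>: "B \<xi> = 0" "\<xi> \<noteq> 0"
    \<comment> \<open>A kernel vector is an affine relation between the vertices: its components are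
      the coefficients at b and c, and the one at a makes the sum zero.\<close>
    define u where "u x = (if x = a then - \<xi> $ 1 - \<xi> $ 2 else if x = b then \<xi> $ 1 else \<xi> $ 2)" for x
    have "sum u C = 0" using abc by (simp add: u_def)
    moreover have "(\<Sum>v\<in>C. u v *\<^sub>R v) = B \<xi>"
      using abc by (simp add: u_def B_def algebra_simps)
    moreover have "\<exists>v\<in>C. u v \<noteq> 0"
    proof -
      have "\<xi> $ 1 \<noteq> 0 \<or> \<xi> $ 2 \<noteq> 0" using \<xi>(2) by (auto simp: vec_eq_iff forall_2)
      then have "u b \<noteq> 0 \<or> u c \<noteq> 0" using abc by (simp add: u_def)
      then show ?thesis using abc(1) by blast
    qed
    ultimately have "sum u C = 0" "(\<Sum>v\<in>C. u v *\<^sub>R v) = 0" "\<exists>v\<in>C. u v \<noteq> 0"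
      using \<xi>(1) by auto
    moreover have "finite C" using abc(1) by simp
    ultimately have "affine_dependent C" unfolding affine_dependent_explicit_finite[OF \<open>finite C\<close>] by blast
    then show False using C(1) by blast
  qed
  then have "inj_on (\<lambda>\<xi>. a + B \<xi>) T_ref" by (auto simp: inj_on_def)
  moreover have "(\<lambda>\<xi>. a + B \<xi>) ` T_ref = T"
    using affine_image_T_ref[of a b c] C(3) abc(1) by (simp only: B_def)
  moreover have "linear (\<lambda>\<xi>. a + B \<xi> - (a + B 0))" using lin by (simp add: linear_0)
  ultimately have "reference_map T (\<lambda>\<xi>. a + B \<xi>)"
    unfolding reference_map_def bij_betw_def by blast
  then show ?thesis using that by blast
qed

text \<open>The coordinates \<open>n i \<bullet> x + b i\<close> are the barycentric ones for the vertices \<open>v i\<close>.\<close>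

lemma simplex_barycentric:
  assumes "2 simplex (\<Omega> :: (real^2) set)"
  obtains n b v where "\<And>x. (\<Sum>i<3::nat. n i \<bullet> x + b i) = (1::real)"
    "\<And>i j. i < 3 \<Longrightarrow> j < 3 \<Longrightarrow> n i \<bullet> v j + b i = (if i = j then 1 else 0)"
    "\<Omega> = {x. \<forall>i<3. 0 \<le> n i \<bullet> x + b i}"
    "interior \<Omega> = {x. \<forall>i<3. 0 < n i \<bullet> x + b i}"
proof -
  obtain F where F: "reference_map \<Omega> F" using simplex_reference_map[OF assms] .
  obtain L c where L: "linear L" "\<And>x. F (L x + c) = x" "\<And>\<xi>. L (F \<xi>) + c = \<xi>"
    "\<And>x. x \<in> \<Omega> \<longleftrightarrow> L x + c \<in> T_ref" by (rule reference_map_inverse[OF F], rule that)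
  \<comment> \<open>The adjoint turns the components of the linear part of the inverse reference map
    into inner products.\<close>
  define m where "m j = adjoint L (axis j 1)" for j
  have m: "m j \<bullet> x = L x $ j" for j x
    using adjoint_works[OF L(1), of x "axis j 1"]
    by (simp add: m_def inner_axis inner_commute)
  define n where "n i = (if i = (0::nat) then - m 1 - m 2 else if i = 1 then m 1 else m 2)" for i
  define b where "b i = (if i = (0::nat) then 1 - c $ 1 - c $ 2 else if i = 1 then c $ 1 else c $ 2)" for i
  define v where "v i = F (if i = (0::nat) then 0 else if i = 1 then axis 1 1 else axis 2 1)" for i
  have less3: "(i::nat) < 3 \<longleftrightarrow> i = 0 \<or> i = 1 \<or> i = 2" for i by auto
  have all3: "(\<forall>i<3::nat. P i) \<longleftrightarrow> P 0 \<and> P 1 \<and> P 2" for P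
    unfolding less3 by auto
  have nb: "n i \<bullet> x + b i = (if i = 0 then 1 - (L x + c) $ 1 - (L x + c) $ 2
      else if i = 1 then (L x + c) $ 1 else (L x + c) $ 2)" for i x
    by (simp add: n_def b_def inner_diff_left m)
  have 1: "(\<Sum>i<3::nat. n i \<bullet> x + b i) = 1" for x
    by (simp add: nb numeral_3_eq_3)
  have 2: "n i \<bullet> v j + b i = (if i = j then 1 else 0)" if "i < 3" "j < 3" for i j
  proof -
    have Lv: "L (v j) + c = (if j = 0 then 0 else if j = 1 then axis 1 1 else axis 2 1)"
      unfolding v_def by (rule L(3))
    have "i = 0 \<or> i = 1 \<or> i = 2" "j = 0 \<or> j = 1 \<or> j = 2" using that by auto
    then show ?thesis unfolding nb Lv by (elim disjE) (simp_all add: axis_def)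
  qed
  have nb': "n 0 \<bullet> x + b 0 = 1 - (L x + c) $ 1 - (L x + c) $ 2" "n 1 \<bullet> x + b 1 = (L x + c) $ 1"
    "n 2 \<bullet> x + b 2 = (L x + c) $ 2" for x
    by (simp_all only: nb) simp_all
  have "x \<in> \<Omega> \<longleftrightarrow> (\<forall>i<3. 0 \<le> n i \<bullet> x + b i)" for x
    unfolding L(4) T_ref_eq mem_Collect_eq all3 nb' by linarith
  then have 3: "\<Omega> = {x. \<forall>i<3. 0 \<le> n i \<bullet> x + b i}" by blast
  have n0: "n i \<noteq> 0" if "i < 3" for i
  proof
    assume 0: "n i = 0"
    obtain j :: nat where "j < 3" "j \<noteq> i" using that by (metis less3 zero_neq_one)
    then show False using 2[OF that that] 2[OF that \<open>j < 3\<close>] 0 by simp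
  qed
  have ge: "0 \<le> n i \<bullet> x + b i \<longleftrightarrow> - b i \<le> n i \<bullet> x" and gt: "0 < n i \<bullet> x + b i \<longleftrightarrow> - b i < n i \<bullet> x" for i x
    by linarith+
  have int: "interior {x. n i \<bullet> x \<ge> - b i} = {x. n i \<bullet> x > - b i}" if "i < 3" for i
    using n0[OF that] by (simp add: interior_halfspace_ge)
  have "\<Omega> = {x. n 0 \<bullet> x \<ge> - b 0} \<inter> {x. n 1 \<bullet> x \<ge> - b 1} \<inter> {x. n 2 \<bullet> x \<ge> - b 2}"
    unfolding 3 ge all3 by blast
  then have "interior \<Omega> = {x. n 0 \<bullet> x > - b 0} \<inter> {x. n 1 \<bullet> x > - b 1} \<inter> {x. n 2 \<bullet> x > - b 2}"
    using int[of 0] int[of 1] int[of 2] by (simp only: interior_Int)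
  also have "\<dots> = {x. \<forall>i<3. 0 < n i \<bullet> x + b i}" unfolding gt all3 by blast
  finally have 4: "interior \<Omega> = {x. \<forall>i<3. 0 < n i \<bullet> x + b i}" .
  show ?thesis by (rule that[of n b v]) (fact 1 2 3 4)+
qed

subsection \<open>The boundary strip\<close>

text \<open>The class of functions paired with g. It contains piecewise polynomials that jump across
  edges and is stable under cutting along sets with negligible frontier; the pointwise bound M is
  the only size that enters the estimates.\<close>

definition admissible :: "real \<Rightarrow> (real^2 \<Rightarrow> real) \<Rightarrow> bool" where
  "admissible M \<psi> \<longleftrightarrow> \<psi> \<in> borel_measurable borel \<and> (AE x in lebesgue. isCont \<psi> x) \<and> (\<forall>x. \<bar>\<psi> x\<bar> \<le> M)"

lemma admissible_indicator:
  assumes "admissible M \<psi>" "S \<in> sets borel" "negligible (frontier S)"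
  shows "admissible M (\<lambda>x. \<psi> x * indicator S x)"
  unfolding admissible_def
proof (intro conjI allI)
  show "(\<lambda>x. \<psi> x * indicator S x) \<in> borel_measurable borel"
    using assms by (auto simp: admissible_def)
  have "AE x in lebesgue. isCont \<psi> x" using assms by (simp add: admissible_def)
  with AE_not_in_negligible[OF assms(3)] show "AE x in lebesgue. isCont (\<lambda>x. \<psi> x * indicator S x) x"
    by eventually_elim (intro continuous_intros, auto simp: isCont_indicator)
  fix x show "\<bar>\<psi> x * indicator S x\<bar> \<le> M"
    using assms(1) abs_ge_zero[of "\<psi> x"] by (auto simp: admissible_def indicator_def intro: order_trans)
qed

lemma admissible_integrable:
  assumes "admissible M \<psi>" "set_integrable lebesgue U g"
  shows "set_integrable lebesgue U (\<lambda>y. g y * \<psi> y)"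
proof -
  have "integrable lebesgue (\<lambda>y. (indicator U y * g y) * \<psi> y)"
  proof (rule integrable_mult_bounded)
    show "integrable lebesgue (\<lambda>y. indicator U y * g y)" using assms(2) by (simp add: set_integrable_def)
    show "\<psi> \<in> borel_measurable lebesgue" "\<bar>\<psi> x\<bar> \<le> M" for x
      using assms(1) by (auto simp: admissible_def intro: measurable_completion)
  qed
  then show ?thesis by (simp add: set_integrable_def mult.assoc)
qed

lemma admissible_abs_integral_le:
  assumes "admissible M \<psi>" "set_integrable lebesgue U g"
  shows "\<bar>LINT y:U|lebesgue. g y * \<psi> y\<bar> \<le> M * (LINT y:U|lebesgue. \<bar>g y\<bar>)"
proof -
  have "\<bar>LINT y|lebesgue. (indicator U y * g y) * \<psi> y\<bar> \<le> M * (LINT y|lebesgue. \<bar>indicator U y * g y\<bar>)"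
  proof (rule abs_integral_mult_le)
    show "integrable lebesgue (\<lambda>y. indicator U y * g y)" using assms(2) by (simp add: set_integrable_def)
    show "\<psi> \<in> borel_measurable lebesgue" "\<bar>\<psi> x\<bar> \<le> M" for x
      using assms(1) by (auto simp: admissible_def intro: measurable_completion)
  qed
  then show ?thesis by (simp add: set_lebesgue_integral_def mult.assoc abs_mult)
qed

text \<open>Cutting \<psi> successively along the listed sets yields pieces that are again
  admissible with the same M, and the bound B is spent once per set. \<open>P\<close> carries along
  a support property common to all pieces.\<close>

lemma admissible_cover:
  fixes B :: real
  assumes g: "set_integrable lebesgue U g"
    and S: "\<And>S. S \<in> set Ss \<Longrightarrow> S \<in> sets borel \<and> negligible (frontier S)"
    and bound: "\<And>S \<psi>. S \<in> set Ss \<Longrightarrow> admissible M \<psi> \<Longrightarrow> (\<And>x. \<psi> x \<noteq> 0 \<Longrightarrow> x \<in> S \<and> P x)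
      \<Longrightarrow> \<bar>LINT y:U|lebesgue. g y * \<psi> y\<bar> \<le> B"
    and "admissible M \<psi>" "\<And>x. \<psi> x \<noteq> 0 \<Longrightarrow> x \<in> \<Union>(set Ss) \<and> P x"
  shows "\<bar>LINT y:U|lebesgue. g y * \<psi> y\<bar> \<le> length Ss * B"
  using S bound assms(4,5)
proof (induction Ss arbitrary: \<psi>)
  case Nil
  then have "\<psi> x = 0" for x by auto
  then show ?case by (simp add: set_lebesgue_integral_def)
next
  case (Cons S Ss)
  define \<psi>1 where "\<psi>1 x = \<psi> x * indicator S x" for x
  define \<psi>2 where "\<psi>2 x = \<psi> x * indicator (- S) x" for x
  have a: "admissible M \<psi>1" "admissible M \<psi>2"
    using Cons.prems(1)[of S] Cons.prems(3) unfolding \<psi>1_def[abs_def] \<psi>2_def[abs_def]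
    by (auto intro!: admissible_indicator simp: frontier_complement)
  have "\<bar>LINT y:U|lebesgue. g y * \<psi>1 y\<bar> \<le> B"
    using Cons.prems(4) by (intro Cons.prems(2)[of S] a) (auto simp: \<psi>1_def indicator_def split: if_splits)
  moreover have "\<bar>LINT y:U|lebesgue. g y * \<psi>2 y\<bar> \<le> length Ss * B"
  proof (rule Cons.IH[OF _ _ a(2)])
    show "x \<in> \<Union>(set Ss) \<and> P x" if "\<psi>2 x \<noteq> 0" for x
      using Cons.prems(4)[of x] that by (auto simp: \<psi>2_def indicator_def split: if_splits)
  qed (use Cons.prems(1,2) in auto)
  moreover have "(LINT y:U|lebesgue. g y * \<psi> y) = (LINT y:U|lebesgue. g y * \<psi>1 y + g y * \<psi>2 y)"
    unfolding set_lebesgue_integral_def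
    by (intro Bochner_Integration.integral_cong) (auto simp: \<psi>1_def \<psi>2_def indicator_def)
  ultimately show ?case
    using set_integral_add(2)[OF admissible_integrable[OF a(1) g] admissible_integrable[OF a(2) g]]
    by (simp add: distrib_right)
qed

lemma W11_norm_nonneg: "0 \<le> W11_norm \<Omega> g"
  by (auto simp: W11_norm_def set_lebesgue_integral_def intro!: add_nonneg_nonneg sum_nonneg)

lemma W11_space_weak_partial:
  "g \<in> W11_space \<Omega> \<Longrightarrow> has_weak_partial (interior \<Omega>) i g (weak_partial (interior \<Omega>) i g)"
  unfolding weak_partial_def by (rule someI_ex[of "has_weak_partial (interior \<Omega>) i g"]) (simp add: W11_space_def)

lemma W11_norm_ge:
  "(LINT x:interior \<Omega>|lebesgue. \<bar>g x\<bar>) \<le> W11_norm \<Omega> g"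
  "(\<Sum>i\<in>UNIV. LINT x:interior \<Omega>|lebesgue. \<bar>weak_partial (interior \<Omega>) i g x\<bar>) \<le> W11_norm \<Omega> g"
  by (auto simp: W11_norm_def set_lebesgue_integral_def intro!: sum_nonneg)

text \<open>The strip is covered by the six sets where one barycentric coordinate \<open>p\<close> is small and another
  one \<open>q\<close> is at least \<open>1/3\<close>. There is room to move such a set in the direction \<open>v p - v q\<close>, which is
  parallel to a side, without leaving \<open>\<Omega>\<close>, even near the vertices.\<close>

lemma boundary_strip:
  assumes "2 simplex (\<Omega> :: (real^2) set)"
  obtains C where "0 \<le> C"
    "\<And>h g \<psi> M. 0 < h \<Longrightarrow> g \<in> W11_space \<Omega> \<Longrightarrow> admissible M \<psi> \<Longrightarrow>
      (\<forall>x. \<psi> x \<noteq> 0 \<longrightarrow> x \<in> interior \<Omega> \<and> infdist x (frontier \<Omega>) \<le> h) \<Longrightarrow>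
      \<bar>LINT y:interior \<Omega>|lebesgue. g y * \<psi> y\<bar> \<le> C * h * M * W11_norm \<Omega> g"
proof -
  obtain n b v where bary: "\<And>x. (\<Sum>i<3::nat. n i \<bullet> x + b i) = (1::real)"
    "\<And>i j. i < 3 \<Longrightarrow> j < 3 \<Longrightarrow> n i \<bullet> v j + b i = (if i = j then 1 else 0)"
    "\<Omega> = {x. \<forall>i<3. 0 \<le> n i \<bullet> x + b i}"
    "interior \<Omega> = {x. \<forall>i<3. 0 < n i \<bullet> x + b i}"
    by (rule simplex_barycentric[OF assms], rule that)
  define l where "l i x = n i \<bullet> x + b i" for i x
  have l_move: "l i (x + s *\<^sub>R (v p - v q)) = l i x + s * ((if i = p then 1 else 0) - (if i = q then 1 else 0))"
    if "i < 3" "p < 3" "q < 3" for i p q x s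
  proof -
    have "n i \<bullet> v p - n i \<bullet> v q = (if i = p then 1 else 0) - (if i = q then 1 else 0)"
      using bary(2)[of i p] bary(2)[of i q] that by simp
    then show ?thesis by (simp add: l_def inner_add_right inner_diff_right)
  qed
  have "compact \<Omega>" "convex \<Omega>"
    using assms compact_simplex convex_simplex by blast+
  then have \<Omega>: "open (interior \<Omega>)" "convex (interior \<Omega>)" "bounded (interior \<Omega>)"
    by (auto intro: convex_interior bounded_interior compact_imp_bounded)
  \<comment> \<open>A common Lipschitz constant of the barycentric coordinates, made positive by the
    summand 1.\<close>
  define \<Lambda> where "\<Lambda> = 1 + (\<Sum>i<3::nat. norm (n i))"
  have "0 < \<Lambda>" unfolding \<Lambda>_def by (intro add_pos_nonneg sum_nonneg) auto
  have \<Lambda>: "norm (n i) \<le> \<Lambda>" if "i < 3" for i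
    unfolding \<Lambda>_def using that member_le_sum[of i "{..<3}" "\<lambda>i. norm (n i)"] by auto
  define D where "D = (\<Sum>i<3::nat. norm (v i)) + (\<Sum>i<3::nat. norm (v i))"
  have D: "\<bar>(v p - v q) $ i\<bar> \<le> D" if "p < 3" "q < 3" for p q i
  proof -
    have "\<bar>(v p - v q) $ i\<bar> \<le> norm (v p) + norm (v q)"
      using component_le_norm_cart[of "v p - v q" i] norm_triangle_ineq4[of "v p" "v q"] by linarith
    also have "\<dots> \<le> D" unfolding D_def using that by (intro add_mono member_le_sum) auto
    finally show ?thesis .
  qed
  have "0 \<le> D" by (simp add: D_def sum_nonneg)
  \<comment> \<open>At the nearest frontier point some barycentric coordinate is nonpositive, and
    the Lipschitz bound carries this back to x.\<close>
  have near: "\<exists>i<3. l i x \<le> \<Lambda> * h" if x: "x \<in> interior \<Omega>" "infdist x (frontier \<Omega>) \<le> h" for x h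
  proof -
    have "frontier \<Omega> \<noteq> {}"
      using \<open>compact \<Omega>\<close> x(1) interior_subset not_compact_UNIV by (auto simp: frontier_eq_empty)
    then obtain y where y: "y \<in> frontier \<Omega>" "infdist x (frontier \<Omega>) = dist x y"
      using infdist_attains_inf[of "frontier \<Omega>" x] by auto
    then have "y \<in> \<Omega>" "y \<notin> interior \<Omega>"
      using \<open>compact \<Omega>\<close> by (auto simp: frontier_def compact_imp_closed closure_closed)
    then obtain i where i: "i < 3" "l i y \<le> 0" unfolding bary(4) l_def by (auto simp: not_less)
    have "l i x - l i y = n i \<bullet> (x - y)" by (simp add: l_def inner_diff_right)
    also have "\<dots> \<le> norm (n i) * norm (x - y)" by (rule norm_cauchy_schwarz)
    also have "\<dots> \<le> \<Lambda> * h" using \<Lambda>[OF i(1)] \<open>0 < \<Lambda>\<close> x(2) y(2) by (intro mult_mono) (auto simp: dist_norm)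
    finally show ?thesis using i by auto
  qed
  define C1 where "C1 = 6 * (8 * \<Lambda> * (1 + D))"
  define C where "C = C1 + 8 * \<Lambda>"
  have C: "0 \<le> C1" "0 \<le> C" using \<open>0 < \<Lambda>\<close> \<open>0 \<le> D\<close> by (auto simp: C_def C1_def)
  show ?thesis
  proof (rule that[OF C(2)])
    fix h g \<psi> M
    assume h: "0 < h" and g: "g \<in> W11_space \<Omega>" and \<psi>: "admissible M \<psi>"
      and supp: "\<forall>x. \<psi> x \<noteq> 0 \<longrightarrow> x \<in> interior \<Omega> \<and> infdist x (frontier \<Omega>) \<le> h"
    have g': "set_integrable lebesgue (interior \<Omega>) g" using g by (simp add: W11_space_def)
    have "0 \<le> M" using \<psi> unfolding admissible_def by (meson abs_ge_zero order_trans)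
    show "\<bar>LINT y:interior \<Omega>|lebesgue. g y * \<psi> y\<bar> \<le> C * h * M * W11_norm \<Omega> g"
    proof (cases "8 * \<Lambda> * h \<ge> 1")
      \<comment> \<open>For coarse meshes the factor h costs nothing, and the trivial bound by the
        norm of g suffices.\<close>
      case True
      have "\<bar>LINT y:interior \<Omega>|lebesgue. g y * \<psi> y\<bar> \<le> M * W11_norm \<Omega> g"
        using admissible_abs_integral_le[OF \<psi> g'] W11_norm_ge(1)[of \<Omega> g] \<open>0 \<le> M\<close>
        by (meson mult_left_mono order_trans)
      also have "\<dots> \<le> (C * h) * (M * W11_norm \<Omega> g)"
      proof -
        have "0 \<le> C1 * h" using C(1) h by simp
        then have "1 \<le> C * h" using True by (simp add: C_def distrib_right)
        then show ?thesis using \<open>0 \<le> M\<close> W11_norm_nonneg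
          by (metis mult_1 mult_nonneg_nonneg mult_right_mono)
      qed
      finally show ?thesis by (simp add: mult.assoc)
    next
      case False
      \<comment> \<open>The largest integer strictly below \<open>1 / (4 * \<Lambda> * h)\<close>.
        Strictness makes the slab of width \<open>(1/4) / N\<close> wide enough for the strip, and
        \<open>N + 1 \<le> 2 * N\<close> yields
        \<open>1 / N \<le> 8 * \<Lambda> * h\<close>.\<close>
      define N where "N = nat (\<lceil>1 / (4 * \<Lambda> * h)\<rceil> - 1)"
      have \<Lambda>h: "0 < \<Lambda> * h" using h \<open>0 < \<Lambda>\<close> by simp
      have q: "1 / (4 * \<Lambda> * h) > 2" using False \<Lambda>h by (simp add: field_simps)
      have "N > 0" and N1: "real N < 1 / (4 * \<Lambda> * h)" and N2: "1 / (4 * \<Lambda> * h) \<le> real N + 1"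
        using q unfolding N_def by linarith+
      have Nh: "\<Lambda> * h < (1/4) / N" using N1 \<open>N > 0\<close> \<Lambda>h by (simp add: field_simps)
      have Nh2: "1 / N \<le> 8 * \<Lambda> * h"
      proof -
        have "1 / (4 * \<Lambda> * h) \<le> 2 * real N" using N2 \<open>N > 0\<close> by linarith
        then show ?thesis using \<open>N > 0\<close> \<Lambda>h by (simp add: field_simps)
      qed
      define S where "S = (\<lambda>(p, q). {x. l p x < (1/4) / N \<and> l q x \<ge> 1/3})"
      define Ss where "Ss = map S [(0,1),(0,2),(1,0),(1,2),(2,0),(2,1)]"
      have S_mem: "\<exists>p q. S' = S (p, q) \<and> p \<noteq> q \<and> p < 3 \<and> q < 3" if S': "S' \<in> set Ss" for S'
      proof -
        obtain pq where pq: "pq \<in> set [(0,1),(0,2),(1,0),(1,2),(2,0),(2,1)]" "S' = S pq"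
          using S' unfolding Ss_def set_map by blast
        then have "S' = S (fst pq, snd pq) \<and> fst pq \<noteq> snd pq \<and> fst pq < 3 \<and> snd pq < 3" by auto
        then show ?thesis by blast
      qed
      define B where "B = M * (8 * \<Lambda> * h * (1 + D)) * W11_norm \<Omega> g"
      have "\<bar>LINT y:interior \<Omega>|lebesgue. g y * \<psi> y\<bar> \<le> length Ss * B"
      proof (rule admissible_cover[where U="interior \<Omega>" and g=g and M=M and P="\<lambda>x. x \<in> interior \<Omega>"])
        show "set_integrable lebesgue (interior \<Omega>) g" by (rule g')
        show "admissible M \<psi>" by (rule \<psi>)
        show "S' \<in> sets borel \<and> negligible (frontier S')" if "S' \<in> set Ss" for S'
        proof -
          obtain p q where S': "S' = S (p, q)" using S_mem \<open>S' \<in> set Ss\<close> by blast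
          have "S' = {x. n p \<bullet> x < (1/4) / N - b p} \<inter> {x. n q \<bullet> x \<ge> 1/3 - b q}"
            by (auto simp: S' S_def l_def)
          then show ?thesis
            by (auto intro!: negligible_convex_frontier convex_Int convex_halfspace_lt convex_halfspace_ge
                borel_open[OF open_halfspace_lt] borel_closed[OF closed_halfspace_ge])
        qed
      next
        fix S' \<phi>
        assume "S' \<in> set Ss" and \<phi>: "admissible M \<phi>" "\<And>x. \<phi> x \<noteq> 0 \<Longrightarrow> x \<in> S' \<and> x \<in> interior \<Omega>"
        then obtain p q where pq: "S' = S (p, q)" "p \<noteq> q" "p < 3" "q < 3" using S_mem by blast
        let ?w = "\<lambda>i. LINT y:interior \<Omega>|lebesgue. \<bar>weak_partial (interior \<Omega>) i g y\<bar>"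
        have "\<bar>LINT y:interior \<Omega>|lebesgue. g y * \<phi> y\<bar> \<le> M / N * (LINT y:interior \<Omega>|lebesgue. \<bar>g y\<bar>)
          + 2 * M * (1/4) / N * (\<Sum>i\<in>UNIV. \<bar>(v p - v q) $ i\<bar> * ?w i)"
        proof (rule weak_slab[OF \<Omega> g' W11_space_weak_partial[OF g], where l="l p" and n="n p" and b="b p"])
          show "n p \<bullet> (v p - v q) = 1"
            using bary(2)[of p p] bary(2)[of p q] pq by (simp add: inner_diff_right)
          fix x assume "\<phi> x \<noteq> 0"
          then have x: "l p x < (1/4) / N" "l q x \<ge> 1/3" "\<And>i. i < 3 \<Longrightarrow> 0 < l i x"
            using \<phi>(2)[of x] by (auto simp: pq S_def bary(4) l_def)
          \<comment> \<open>Only the coordinate of q decreases, from at least 1/3 by at most 1/4;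
            this is where the travel length 1/4 comes from.\<close>
          have "x + s *\<^sub>R (v p - v q) \<in> interior \<Omega>" if "s \<in> {0..1/4}" for s
          proof -
            have "0 < l i (x + s *\<^sub>R (v p - v q))" if "i < 3" for i
              using l_move[OF that pq(3,4)] x(2) x(3)[OF \<open>i < 3\<close>] \<open>s \<in> {0..1/4}\<close> \<open>i < 3\<close> pq(2) by auto
            then show ?thesis by (simp add: bary(4) l_def)
          qed
          then show "0 < l p x \<and> l p x < (1/4) / N \<and> (\<forall>s\<in>{0..1/4}. x + s *\<^sub>R (v p - v q) \<in> interior \<Omega>)"
            using x pq by auto
        qed (use \<phi> \<open>N > 0\<close> in \<open>auto simp: admissible_def l_def\<close>)
        also have "\<dots> \<le> M / N * W11_norm \<Omega> g + M / N * (D * W11_norm \<Omega> g)"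
        proof (rule add_mono)
          show "M / N * (LINT y:interior \<Omega>|lebesgue. \<bar>g y\<bar>) \<le> M / N * W11_norm \<Omega> g"
            using \<open>0 \<le> M\<close> W11_norm_ge(1) by (intro mult_left_mono) auto
          have "(\<Sum>i\<in>UNIV. \<bar>(v p - v q) $ i\<bar> * ?w i) \<le> (\<Sum>i\<in>UNIV. D * ?w i)"
            by (intro sum_mono mult_right_mono D pq) (auto simp: set_lebesgue_integral_def)
          also have "\<dots> \<le> D * W11_norm \<Omega> g"
            unfolding sum_distrib_left[symmetric] using \<open>0 \<le> D\<close> W11_norm_ge(2) by (rule mult_left_mono[rotated])
          finally have "(\<Sum>i\<in>UNIV. \<bar>(v p - v q) $ i\<bar> * ?w i) \<le> D * W11_norm \<Omega> g" .
          then have "2 * M * (1/4) / N * (\<Sum>i\<in>UNIV. \<bar>(v p - v q) $ i\<bar> * ?w i) \<le> 2 * M * (1/4) / N * (D * W11_norm \<Omega> g)"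
            using \<open>0 \<le> M\<close> by (intro mult_left_mono) auto
          also have "\<dots> \<le> M / N * (D * W11_norm \<Omega> g)"
            using \<open>0 \<le> M\<close> \<open>0 \<le> D\<close> W11_norm_nonneg[of \<Omega> g] \<open>N > 0\<close> by (intro mult_right_mono divide_right_mono) auto
          finally show "2 * M * (1/4) / N * (\<Sum>i\<in>UNIV. \<bar>(v p - v q) $ i\<bar> * ?w i) \<le> M / N * (D * W11_norm \<Omega> g)" .
        qed
        also have "\<dots> = 1 / N * (M * (1 + D) * W11_norm \<Omega> g)" by (simp add: algebra_simps)
        also have "\<dots> \<le> (8 * \<Lambda> * h) * (M * (1 + D) * W11_norm \<Omega> g)"
          using Nh2 \<open>0 \<le> M\<close> \<open>0 \<le> D\<close> W11_norm_nonneg[of \<Omega> g] by (intro mult_right_mono) auto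
        finally show "\<bar>LINT y:interior \<Omega>|lebesgue. g y * \<phi> y\<bar> \<le> B" by (simp add: B_def mult_ac)
      next
        fix x assume "\<psi> x \<noteq> 0"
        then have x: "x \<in> interior \<Omega>" "infdist x (frontier \<Omega>) \<le> h" using supp by auto
        then obtain p where p: "p < 3" "l p x \<le> \<Lambda> * h" using near by blast
        then have lp: "l p x < (1/4) / N" using Nh by linarith
        \<comment> \<open>With \<open>l p x\<close> below 1/4 the other two coordinates add up to
          more than 3/4, so one of them is at least 1/3.\<close>
        have N4: "(1/4) / real N \<le> 1/4" using \<open>N > 0\<close> by (simp add: divide_simps)
        have s: "l 0 x + l 1 x + l 2 x = 1" using bary(1)[of x] by (simp add: l_def numeral_3_eq_3 numeral_2_eq_2)
        have "p = 0 \<or> p = 1 \<or> p = 2" using p(1) by auto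
        then obtain q where "(p, q) \<in> {(0,1),(0,2),(1,0),(1,2),(2,0),(2,1)}" "l q x \<ge> 1/3"
        proof (elim disjE)
          assume "p = 0"
          then have "l 1 x \<ge> 1/3 \<or> l 2 x \<ge> 1/3" using s lp[unfolded \<open>p = 0\<close>] N4 by linarith
          then show ?thesis using that[of 1] that[of 2] \<open>p = 0\<close> by auto
        next
          assume "p = 1"
          then have "l 0 x \<ge> 1/3 \<or> l 2 x \<ge> 1/3" using s lp[unfolded \<open>p = 1\<close>] N4 by linarith
          then show ?thesis using that[of 0] that[of 2] \<open>p = 1\<close> by auto
        next
          assume "p = 2"
          then have "l 0 x \<ge> 1/3 \<or> l 1 x \<ge> 1/3" using s lp[unfolded \<open>p = 2\<close>] N4 by linarith
          then show ?thesis using that[of 0] that[of 1] \<open>p = 2\<close> by auto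
        qed
        then show "x \<in> \<Union>(set Ss) \<and> x \<in> interior \<Omega>"
          using lp x(1) by (auto simp: Ss_def S_def)
      qed
      also have "length Ss * B = C1 * h * M * W11_norm \<Omega> g" by (simp add: Ss_def B_def C1_def)
      also have "\<dots> \<le> C * h * M * W11_norm \<Omega> g"
        using h \<open>0 \<le> M\<close> W11_norm_nonneg \<open>0 < \<Lambda>\<close> by (intro mult_right_mono) (auto simp: C_def)
      finally show ?thesis .
    qed
  qed
qed

subsection \<open>Iterated partial derivatives and polynomials\<close>

text \<open>Derivatives are indexed by words: a word can be extended or shortened at either end, so
  inductions on the order proceed without commuting derivatives. The passage back to
  \<open>mi_deriv\<close> is a matter of sorting the word.\<close>

definition Dw :: "2 list \<Rightarrow> (real^2 \<Rightarrow> real) \<Rightarrow> real^2 \<Rightarrow> real" where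
  "Dw w f = foldr partial w f"

lemma Dw_simps [simp]: "Dw [] f = f" "Dw (i # w) f = partial i (Dw w f)"
  by (simp_all add: Dw_def)

lemma Dw_append: "Dw (v @ w) f = Dw v (Dw w f)"
  by (simp add: Dw_def)

lemma Dw_replicate: "Dw (replicate n i) f = (partial i ^^ n) f"
  by (induction n) auto

lemma mi_deriv_eq_Dw: "mi_deriv \<beta> f = Dw (replicate (\<beta> $ 1) 1 @ replicate (\<beta> $ 2) 2) f"
  by (simp add: mi_deriv_def Dw_append Dw_replicate)

lemma mi_order_eq: "mi_order \<beta> = \<beta> $ 1 + \<beta> $ 2"
  by (simp add: mi_order_def sum_2)

lemma Cdiff_on_Dw: "Cdiff_on (length w + m) U f \<Longrightarrow> Cdiff_on m U (Dw w f)"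
proof (induction w arbitrary: m)
  case (Cons i w)
  have "Cdiff_on (Suc m) U (Dw w f)"
    using Cons.IH[of "Suc m"] Cons.prems by (simp del: Cdiff_on.simps)
  then show ?case by simp
qed simp

lemma Dw_cong:
  assumes "open U" "\<And>x. x \<in> U \<Longrightarrow> f x = g x"
  shows "x \<in> U \<Longrightarrow> Dw w f x = Dw w g x"
proof (induction w arbitrary: x)
  case (Cons i w)
  then show ?case using partial_cong[OF assms(1), of x "Dw w f" "Dw w g"] by simp
qed (simp add: assms)

lemma partial_lincomb:
  assumes "\<And>j. j \<in> J \<Longrightarrow> f j differentiable (at x)"
  shows "partial i (\<lambda>x. \<Sum>j\<in>J. a j * f j x) x = (\<Sum>j\<in>J. a j * partial i (f j) x)"
proof -
  have "((\<lambda>x. \<Sum>j\<in>J. a j * f j x) has_derivative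
      (\<lambda>d. \<Sum>j\<in>J. a j * (\<Sum>i\<in>UNIV. d $ i * partial i (f j) x))) (at x)"
    by (intro has_derivative_sum has_derivative_mult_right differentiable_partial assms)
  from partial_eq[OF this] show ?thesis by (simp add: axis_sum)
qed

lemma Dw_lincomb:
  assumes "open U"
  shows "(\<And>j. j \<in> J \<Longrightarrow> Cdiff_on (length w) U (f j)) \<Longrightarrow> x \<in> U \<Longrightarrow>
    Dw w (\<lambda>x. \<Sum>j\<in>J. a j * f j x) x = (\<Sum>j\<in>J. a j * Dw w (f j) x)"
proof (induction w arbitrary: x)
  case (Cons i w)
  have C: "Cdiff_on (length w) U (f j)" "Cdiff_on (Suc 0) U (Dw w (f j))" if "j \<in> J" for j
    using Cons.prems(1)[OF that] Cdiff_on_Suc_imp[of "length w" U "f j"] Cdiff_on_Dw[of w 1 U "f j"]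
    by (auto simp del: Cdiff_on.simps)
  have "Dw (i # w) (\<lambda>x. \<Sum>j\<in>J. a j * f j x) x = partial i (\<lambda>x. \<Sum>j\<in>J. a j * Dw w (f j) x) x"
    unfolding Dw_simps by (rule partial_cong[OF assms Cons.prems(2)]) (rule Cons.IH[OF C(1)])
  also have "\<dots> = (\<Sum>j\<in>J. a j * partial i (Dw w (f j)) x)"
    using C(2) Cons.prems(2) by (intro partial_lincomb) auto
  finally show ?case by simp
qed simp

lemma Dw_diff:
  assumes "open U" "Cdiff_on (length w) U f" "Cdiff_on (length w) U g" "x \<in> U"
  shows "Dw w (\<lambda>x. f x - g x) x = Dw w f x - Dw w g x"
  using Dw_lincomb[OF assms(1), of "UNIV :: bool set" w "\<lambda>b. if b then f else g" x "\<lambda>b. if b then 1 else - 1"] assms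
  by (simp add: UNIV_bool)

text \<open>The family \<phi> is kept arbitrary so that monomials and Newton products share the same
  linear algebra and a change of basis relates two instances.\<close>

definition mi_span :: "(nat^2 \<Rightarrow> 'a \<Rightarrow> real) \<Rightarrow> nat \<Rightarrow> ('a \<Rightarrow> real) \<Rightarrow> bool" where
  "mi_span \<phi> k p \<longleftrightarrow> (\<exists>c. p = (\<lambda>x. \<Sum>\<alpha>\<in>{\<alpha>. mi_order \<alpha> \<le> k}. c \<alpha> * \<phi> \<alpha> x))"

lemma mi_span_basis: "mi_order \<alpha> \<le> k \<Longrightarrow> mi_span \<phi> k (\<phi> \<alpha>)"
  unfolding mi_span_def
  by (intro exI[of _ "\<lambda>\<gamma>. if \<gamma> = \<alpha> then 1 else 0"])
    (simp add: finite_mi_order_le if_distrib[where f="\<lambda>x. x * _"] cong: if_cong)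

lemma mi_span_add:
  assumes "mi_span \<phi> k p" "mi_span \<phi> k q"
  shows "mi_span \<phi> k (\<lambda>x. p x + q x)"
proof -
  obtain c d where "p = (\<lambda>x. \<Sum>\<alpha>\<in>{\<alpha>. mi_order \<alpha> \<le> k}. c \<alpha> * \<phi> \<alpha> x)"
    "q = (\<lambda>x. \<Sum>\<alpha>\<in>{\<alpha>. mi_order \<alpha> \<le> k}. d \<alpha> * \<phi> \<alpha> x)"
    using assms by (auto simp: mi_span_def)
  then show ?thesis unfolding mi_span_def
    by (intro exI[of _ "\<lambda>\<alpha>. c \<alpha> + d \<alpha>"]) (simp add: sum.distrib distrib_right)
qed

lemma mi_span_cmult:
  assumes "mi_span \<phi> k p"
  shows "mi_span \<phi> k (\<lambda>x. a * p x)"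
proof -
  obtain c where "p = (\<lambda>x. \<Sum>\<alpha>\<in>{\<alpha>. mi_order \<alpha> \<le> k}. c \<alpha> * \<phi> \<alpha> x)"
    using assms by (auto simp: mi_span_def)
  then show ?thesis unfolding mi_span_def
    by (intro exI[of _ "\<lambda>\<alpha>. a * c \<alpha>"]) (simp add: sum_distrib_left mult.assoc)
qed

lemma mi_span_zero: "mi_span \<phi> k (\<lambda>x. 0)"
  unfolding mi_span_def by (intro exI[of _ "\<lambda>_. 0"]) simp

lemma mi_span_lincomb:
  "(\<And>j. j \<in> J \<Longrightarrow> mi_span \<phi> k (p j)) \<Longrightarrow> mi_span \<phi> k (\<lambda>x. \<Sum>j\<in>J. a j * p j x)"
  by (induction J rule: infinite_finite_induct) (auto intro!: mi_span_add mi_span_cmult mi_span_zero)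

text \<open>G stands for a linear operator, such as differentiation, multiplication by a fixed
  function or composition with an affine map; linearity reduces its mapping property to the spanning
  family.\<close>

lemma mi_span_trans:
  assumes "mi_span \<phi> k p" "\<And>\<alpha>. mi_order \<alpha> \<le> k \<Longrightarrow> mi_span \<psi> m (\<lambda>x. G x (\<phi> \<alpha>))"
    "\<And>c x. G x (\<lambda>x. \<Sum>\<alpha>\<in>{\<alpha>. mi_order \<alpha> \<le> k}. c \<alpha> * \<phi> \<alpha> x) = (\<Sum>\<alpha>\<in>{\<alpha>. mi_order \<alpha> \<le> k}. c \<alpha> * G x (\<phi> \<alpha>))"
  shows "mi_span \<psi> m (\<lambda>x. G x p)"
proof -
  obtain c where c: "p = (\<lambda>x. \<Sum>\<alpha>\<in>{\<alpha>. mi_order \<alpha> \<le> k}. c \<alpha> * \<phi> \<alpha> x)"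
    using assms(1) by (auto simp: mi_span_def)
  show ?thesis unfolding c assms(3) by (rule mi_span_lincomb) (use assms(2) in auto)
qed

lemma mi_span_mono: "mi_span \<phi> k p \<Longrightarrow> k \<le> m \<Longrightarrow> mi_span \<phi> m p"
  by (rule mi_span_trans[where G="\<lambda>x p. p x"]) (auto intro: mi_span_basis)

definition monom2 :: "nat^2 \<Rightarrow> real^2 \<Rightarrow> real" where
  "monom2 \<alpha> x = (\<Prod>i\<in>UNIV. (x $ i) ^ (\<alpha> $ i))"

lemma poly_deg_le_eq: "poly_deg_le k = mi_span monom2 k"
  by (simp add: poly_deg_le_def[abs_def] mi_span_def[abs_def] monom2_def)

lemma poly_deg_le_const: "poly_deg_le k (\<lambda>x. c)"
  using mi_span_cmult[OF mi_span_basis[of 0 k monom2], of c]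
  by (simp add: poly_deg_le_eq monom2_def mi_order_def)

lemma poly_deg_le_component: "poly_deg_le 1 (\<lambda>x. x $ i)"
proof -
  have "monom2 (axis i 1) = (\<lambda>x. x $ i)"
    using exhaust_2[of i] by (auto simp: monom2_def axis_def UNIV_2)
  moreover have "mi_order (axis i 1) \<le> 1"
    using exhaust_2[of i] by (auto simp: mi_order_eq axis_def)
  ultimately show ?thesis using mi_span_basis[of "axis i 1" 1 monom2] by (simp add: poly_deg_le_eq)
qed

lemma poly_deg_le_add: "poly_deg_le k p \<Longrightarrow> poly_deg_le k q \<Longrightarrow> poly_deg_le k (\<lambda>x. p x + q x)"
  and poly_deg_le_cmult: "poly_deg_le k p \<Longrightarrow> poly_deg_le k (\<lambda>x. a * p x)"
  and poly_deg_le_lincomb: "(\<And>j. j \<in> J \<Longrightarrow> poly_deg_le k (f j)) \<Longrightarrow> poly_deg_le k (\<lambda>x. \<Sum>j\<in>J. b j * f j x)"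
  and poly_deg_le_mono: "poly_deg_le k p \<Longrightarrow> k \<le> m \<Longrightarrow> poly_deg_le m p"
  unfolding poly_deg_le_eq by (rule mi_span_add mi_span_cmult mi_span_lincomb mi_span_mono; assumption)+

lemma poly_deg_le_diff: "poly_deg_le k p \<Longrightarrow> poly_deg_le k q \<Longrightarrow> poly_deg_le k (\<lambda>x. p x - q x)"
  using poly_deg_le_add[of k p "\<lambda>x. (-1) * q x"] poly_deg_le_cmult[of k q "-1"] by simp

lemma poly_deg_le_mult:
  assumes "poly_deg_le k p" "poly_deg_le m q"
  shows "poly_deg_le (k + m) (\<lambda>x. p x * q x)"
proof -
  have 1: "poly_deg_le (k + m) (\<lambda>x. monom2 \<alpha> x * monom2 \<gamma> x)" if "mi_order \<alpha> \<le> k" "mi_order \<gamma> \<le> m" for \<alpha> \<gamma>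
  proof -
    have "mi_order (\<alpha> + \<gamma>) \<le> k + m" using that by (simp add: mi_order_eq)
    moreover have "monom2 (\<alpha> + \<gamma>) = (\<lambda>x. monom2 \<alpha> x * monom2 \<gamma> x)"
      by (auto simp: monom2_def power_add prod.distrib)
    ultimately show ?thesis using mi_span_basis[of "\<alpha> + \<gamma>" "k + m" monom2]
      by (simp add: poly_deg_le_eq)
  qed
  have 2: "poly_deg_le (k + m) (\<lambda>x. monom2 \<alpha> x * q x)" if "mi_order \<alpha> \<le> k" for \<alpha>
    using assms(2) unfolding poly_deg_le_eq
    by (rule mi_span_trans[where G="\<lambda>x q. monom2 \<alpha> x * q x"])
      (use 1[OF that] in \<open>auto simp: poly_deg_le_eq sum_distrib_left mult_ac\<close>)
  show ?thesis
    using assms(1) unfolding poly_deg_le_eq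
    by (rule mi_span_trans[where G="\<lambda>x p. p x * q x"])
      (use 2 in \<open>auto simp: poly_deg_le_eq sum_distrib_right sum_distrib_left mult_ac\<close>)
qed

lemma poly_deg_le_prod:
  "finite J \<Longrightarrow> (\<And>j. j \<in> J \<Longrightarrow> poly_deg_le 1 (p j)) \<Longrightarrow> poly_deg_le (card J) (\<lambda>x. \<Prod>j\<in>J. p j x)"
proof (induction J rule: finite_induct)
  case (insert j J)
  then show ?case using poly_deg_le_mult[of 1 "p j" "card J" "\<lambda>x. \<Prod>j\<in>J. p j x"] by simp
qed (simp add: poly_deg_le_const)

lemma poly_deg_le_power: "poly_deg_le 1 p \<Longrightarrow> poly_deg_le n (\<lambda>x. p x ^ n)"
  using poly_deg_le_prod[of "{..<n}" "\<lambda>_. p"] by simp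

lemma monom2_eq: "monom2 \<alpha> x = x $ 1 ^ (\<alpha> $ 1) * x $ 2 ^ (\<alpha> $ 2)"
  by (simp add: monom2_def UNIV_2)

lemma linear_component:
  fixes L :: "real^2 \<Rightarrow> real^2"
  assumes "linear L"
  shows "L x $ j = (\<Sum>i\<in>UNIV. L (axis i 1) $ j * x $ i)"
proof -
  have "L x = L (\<Sum>i\<in>UNIV. x $ i *\<^sub>R axis i 1)"
    by (simp only: basis_expansion[of x, unfolded scalar_mult_eq_scaleR])
  also have "\<dots> = (\<Sum>i\<in>UNIV. x $ i *\<^sub>R L (axis i 1))"
    by (simp only: linear_sum[OF assms] linear_cmul[OF assms])
  finally show ?thesis by (simp add: mult.commute)
qed

lemma poly_deg_le_affine_comp:
  assumes "poly_deg_le k p" "linear L"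
  shows "poly_deg_le k (\<lambda>x. p (L x + c))"
proof -
  have 1: "poly_deg_le 1 (\<lambda>x. (L x + c) $ i)" for i
  proof -
    have "(L x + c) $ i = (\<Sum>j\<in>UNIV. L (axis j 1) $ i * x $ j) + c $ i" for x
      unfolding vector_add_component
      by (rule arg_cong[where f="\<lambda>t. t + c $ i"]) (rule linear_component[OF assms(2)])
    then have "(\<lambda>x. (L x + c) $ i) = (\<lambda>x. (\<Sum>j\<in>UNIV. L (axis j 1) $ i * x $ j) + c $ i)"
      by (rule ext)
    moreover have "poly_deg_le 1 \<dots>"
      by (intro poly_deg_le_add poly_deg_le_lincomb poly_deg_le_component poly_deg_le_const)
    ultimately show ?thesis by (simp only:)
  qed
  have "poly_deg_le k (\<lambda>x. monom2 \<alpha> (L x + c))" if "mi_order \<alpha> \<le> k" for \<alpha>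
    unfolding monom2_eq
    by (rule poly_deg_le_mono[OF poly_deg_le_mult[OF poly_deg_le_power[OF 1] poly_deg_le_power[OF 1]]])
      (use that in \<open>simp add: mi_order_eq\<close>)
  then show ?thesis unfolding poly_deg_le_eq
    by (intro mi_span_trans[OF assms(1)[unfolded poly_deg_le_eq], where G="\<lambda>x p. p (L x + c)"]) auto
qed

lemma Cdiff_on_poly: "poly_deg_le k p \<Longrightarrow> Cdiff_on m UNIV p"
  unfolding poly_deg_le_def
  by (auto intro!: Cdiff_on_sum Cdiff_on_mult Cdiff_on_const Cdiff_on_prod Cdiff_on_power Cdiff_on_component)

lemma partial_monom2:
  "partial i (monom2 \<alpha>) x = real (\<alpha> $ i) * monom2 (\<alpha> - axis i 1) x"
proof -
  have c: "((\<lambda>x::real^2. x $ j) has_derivative (\<lambda>d. d $ j)) (at x)" for j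
    by (auto intro!: bounded_linear_imp_has_derivative bounded_linear_vec_nth)
  have "(monom2 \<alpha> has_derivative (\<lambda>d. x $ 1 ^ (\<alpha> $ 1) * (real (\<alpha> $ 2) * d $ 2 * x $ 2 ^ (\<alpha> $ 2 - 1)) +
      real (\<alpha> $ 1) * d $ 1 * x $ 1 ^ (\<alpha> $ 1 - 1) * x $ 2 ^ (\<alpha> $ 2))) (at x)"
    unfolding monom2_eq[abs_def]
    by (rule has_derivative_eq_rhs, rule has_derivative_mult[OF has_derivative_power[OF c] has_derivative_power[OF c]])
      (auto simp: fun_eq_iff mult_ac)
  from partial_eq[OF this] show ?thesis
    using exhaust_2[of i] by (auto simp: monom2_eq axis_def)
qed

lemma poly_deg_le_partial:
  assumes "poly_deg_le (Suc k) p"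
  shows "poly_deg_le k (partial i p)"
proof -
  have "poly_deg_le k (partial i (monom2 \<alpha>))" if "mi_order \<alpha> \<le> Suc k" for \<alpha>
  proof (cases "\<alpha> $ i = 0")
    case True
    then have "partial i (monom2 \<alpha>) = (\<lambda>x. 0)" by (auto simp: partial_monom2)
    then show ?thesis by (simp add: poly_deg_le_const)
  next
    case False
    then have "mi_order (\<alpha> - axis i 1) \<le> k"
      using that exhaust_2[of i] by (auto simp: mi_order_eq axis_def)
    then show ?thesis unfolding partial_monom2[abs_def] poly_deg_le_eq
      by (intro mi_span_cmult mi_span_basis)
  qed
  moreover have "monom2 \<alpha> differentiable (at x)" for \<alpha> x
    using Cdiff_on_poly[of "mi_order \<alpha>" "monom2 \<alpha>" "Suc 0"] mi_span_basis[of \<alpha> "mi_order \<alpha>" monom2]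
    by (simp add: poly_deg_le_eq)
  ultimately show ?thesis unfolding poly_deg_le_eq
    by (intro mi_span_trans[OF assms[unfolded poly_deg_le_eq], where G="\<lambda>x p. partial i p x"])
      (simp_all add: partial_lincomb)
qed

lemma poly_deg_le_0_partial: "poly_deg_le 0 p \<Longrightarrow> partial i p = (\<lambda>x. 0)"
proof -
  assume "poly_deg_le 0 p"
  moreover have "{\<alpha>::nat^2. mi_order \<alpha> \<le> 0} = {0}"
    by (auto simp: mi_order_eq vec_eq_iff forall_2)
  ultimately obtain c where "p = (\<lambda>x. c)" by (auto simp: poly_deg_le_def)
  then show ?thesis using partial_eq[OF has_derivative_const] by auto
qed

lemma Dw_poly_eq_0: "poly_deg_le k p \<Longrightarrow> k < length w \<Longrightarrow> Dw w p = (\<lambda>x. 0)"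
proof (induction k arbitrary: p w)
  case 0
  then obtain v i where w: "w = v @ [i]" by (cases w rule: rev_cases) auto
  have "Dw v (\<lambda>x. 0) = (\<lambda>x. 0)"
  proof (induction v)
    case (Cons j v)
    then show ?case using poly_deg_le_0_partial[OF poly_deg_le_const[of 0 0], of j] by simp
  qed simp
  then show ?case using 0 by (simp add: w Dw_append poly_deg_le_0_partial)
next
  case (Suc k)
  then obtain v i where w: "w = v @ [i]" by (cases w rule: rev_cases) auto
  show ?case using Suc.IH[OF poly_deg_le_partial[OF Suc.prems(1)], of v i] Suc.prems(2)
    by (simp add: w Dw_append)
qed

subsection \<open>Lagrange interpolation on the reference triangle\<close>

text \<open>Unisolvence: in the Newton basis \<open>newton k\<close> the interpolation conditions at the Lagrange nodes
  form a triangular system.\<close>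

definition newton :: "nat \<Rightarrow> nat^2 \<Rightarrow> real^2 \<Rightarrow> real" where
  "newton k \<alpha> x = (\<Prod>i\<in>UNIV. \<Prod>j<\<alpha> $ i. real k * x $ i - real j)"

text \<open>The new factor of the longer product is
  \<open>real k * x $ i - real (\<alpha> $ i)\<close>. Multiplication by a coordinate thus stays
  within the Newton span, which is how monomials become Newton combinations.\<close>

lemma newton_mult:
  "real k * x $ i * newton k \<alpha> x = newton k (\<alpha> + axis i 1) x + real (\<alpha> $ i) * newton k \<alpha> x"
  using exhaust_2[of i] by (auto simp: newton_def UNIV_2 axis_def algebra_simps)

lemma newton_span_mult:
  assumes "mi_span (newton k) m p" "k \<ge> 1"
  shows "mi_span (newton k) (Suc m) (\<lambda>x. x $ i * p x)"
  using assms(1)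
proof (rule mi_span_trans[where G="\<lambda>x p. x $ i * p x"])
  fix \<alpha> :: "nat^2" assume \<alpha>: "mi_order \<alpha> \<le> m"
  have eq: "x $ i * newton k \<alpha> x = 1 / k * newton k (\<alpha> + axis i 1) x + \<alpha> $ i / k * newton k \<alpha> x" for x
    using newton_mult[of k x i \<alpha>] assms(2) by (simp add: field_simps)
  have "mi_order (\<alpha> + axis i 1) \<le> Suc m" using \<alpha> exhaust_2[of i] by (auto simp: mi_order_eq axis_def)
  then show "mi_span (newton k) (Suc m) (\<lambda>x. x $ i * newton k \<alpha> x)"
    unfolding eq using \<alpha> by (intro mi_span_add mi_span_cmult mi_span_basis) auto
qed (simp add: sum_distrib_left mult_ac)

lemma newton_span_monom2:
  assumes "k \<ge> 1" shows "mi_span (newton k) (mi_order \<alpha>) (monom2 \<alpha>)"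
proof -
  have "mi_span (newton k) (a + b) (\<lambda>x. x $ 1 ^ a * x $ 2 ^ b)" for a b
  proof (induction a)
    case 0
    show ?case
    proof (induction b)
      case 0
      then show ?case using mi_span_basis[of 0 0 "newton k"] by (simp add: newton_def[abs_def] mi_order_eq)
    next
      case (Suc b)
      then show ?case using newton_span_mult[OF Suc assms, of 2] by (simp add: mult_ac)
    qed
  next
    case (Suc a)
    then show ?case using newton_span_mult[OF Suc assms, of 1] by (simp add: mult_ac)
  qed
  then show ?thesis by (simp add: mi_order_eq monom2_eq[abs_def])
qed

definition node :: "nat \<Rightarrow> nat^2 \<Rightarrow> real^2" where
  "node k \<alpha> = (\<chi> i. real (\<alpha> $ i) / real k)"

lemma lagrange_nodes_eq: "lagrange_nodes k = node k ` {\<alpha>. mi_order \<alpha> \<le> k}"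
  by (simp add: lagrange_nodes_def node_def)

lemma falling_at_nat: "(\<Prod>j<a. real n - real j) = (if n < a then 0 else (\<Prod>j<a. real (n - j)))"
proof (cases "n < a")
  case True
  then show ?thesis by (auto intro: prod_zero)
qed (auto intro!: prod.cong simp: of_nat_diff)

lemma poly_zero_on_nodes:
  assumes "k \<ge> 1" "poly_deg_le k p" "\<And>\<alpha>. mi_order \<alpha> \<le> k \<Longrightarrow> p (node k \<alpha>) = 0"
  shows "p = (\<lambda>x. 0)"
proof -
  have "mi_span (newton k) k p"
    using assms(2) unfolding poly_deg_le_eq
    by (rule mi_span_trans[where G="\<lambda>x p. p x"])
      (auto intro: mi_span_mono[OF newton_span_monom2[OF assms(1)]])
  then obtain d where d: "p = (\<lambda>x. \<Sum>\<alpha>\<in>{\<alpha>. mi_order \<alpha> \<le> k}. d \<alpha> * newton k \<alpha> x)"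
    by (auto simp: mi_span_def)
  have nw: "newton k \<gamma> (node k \<alpha>) = (\<Prod>i\<in>UNIV. \<Prod>j<\<gamma> $ i. real (\<alpha> $ i) - real j)" for \<alpha> \<gamma>
    using assms(1) by (simp add: newton_def node_def)
  have "d \<alpha> = 0" if "mi_order \<alpha> \<le> k" for \<alpha>
    using that
  proof (induction "mi_order \<alpha>" arbitrary: \<alpha> rule: less_induct)
    case less
    have "d \<gamma> * newton k \<gamma> (node k \<alpha>) = 0" if "\<gamma> \<in> {\<alpha>. mi_order \<alpha> \<le> k} - {\<alpha>}" for \<gamma>
    proof (cases "mi_order \<gamma> < mi_order \<alpha>")
      case True
      then show ?thesis using less that by simp
    next
      case False
      \<comment> \<open>A different multi-index of at least the same order exceeds \<alpha> in some
        component, and there the falling product contains a zero factor.\<close>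
      have "\<alpha> $ 1 < \<gamma> $ 1 \<or> \<alpha> $ 2 < \<gamma> $ 2"
      proof (rule ccontr)
        assume "\<not> ?thesis"
        then have "\<gamma> = \<alpha>" using False by (auto simp: mi_order_eq vec_eq_iff forall_2)
        then show False using that by simp
      qed
      then show ?thesis unfolding nw falling_at_nat by (auto simp: UNIV_2)
    qed
    then have "p (node k \<alpha>) = (\<Sum>\<gamma>\<in>{\<alpha>}. d \<gamma> * newton k \<gamma> (node k \<alpha>))"
      unfolding d using less.prems by (intro sum.mono_neutral_right finite_mi_order_le) auto
    moreover have "newton k \<alpha> (node k \<alpha>) \<noteq> 0"
      unfolding nw falling_at_nat by simp
    ultimately show ?case using assms(3)[OF less.prems] by simp
  qed
  then show ?thesis unfolding d by (auto intro!: sum.neutral)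
qed

text \<open>The classical product formula in the three barycentric coordinates: falling products of
  lengths \<open>\<alpha> $ 1\<close>, \<open>\<alpha> $ 2\<close> and
  \<open>k - mi_order \<alpha>\<close>, which add up to degree k, normalised to the value 1 at the
  node of \<alpha>.\<close>

definition lagrange_basis :: "nat \<Rightarrow> nat^2 \<Rightarrow> real^2 \<Rightarrow> real" where
  "lagrange_basis k \<alpha> x =
    (\<Prod>j<\<alpha> $ 1. (real k * x $ 1 - real j) / (real (\<alpha> $ 1) - real j)) *
    (\<Prod>j<\<alpha> $ 2. (real k * x $ 2 - real j) / (real (\<alpha> $ 2) - real j)) *
    (\<Prod>j<k - mi_order \<alpha>. (real k * (1 - x $ 1 - x $ 2) - real j) / (real (k - mi_order \<alpha>) - real j))"

lemma poly_lagrange_basis: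
  assumes "mi_order \<alpha> \<le> k"
  shows "poly_deg_le k (lagrange_basis k \<alpha>)"
proof -
  have 1: "poly_deg_le 1 (\<lambda>x. (real k * x $ i - c) / d)" for i c d
    using poly_deg_le_add[OF poly_deg_le_cmult[OF poly_deg_le_component[of i], of "real k / d"] poly_deg_le_const[of 1 "- c / d"]]
    by (simp add: diff_divide_distrib)
  have "poly_deg_le 1 (\<lambda>x. (real k / d + (- (c / d))) + (- real k / d) * x $ 1 + (- real k / d) * x $ 2)" for c d
    by (intro poly_deg_le_add poly_deg_le_cmult poly_deg_le_component poly_deg_le_const)
  moreover have "(real k * (1 - x $ 1 - x $ 2) - c) / d = (real k / d + (- (c / d))) + (- real k / d) * x $ 1 + (- real k / d) * x $ 2"
    for c d and x :: "real^2"
    by (cases "d = 0") (auto simp: field_simps)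
  ultimately have 2: "poly_deg_le 1 (\<lambda>x. (real k * (1 - x $ 1 - x $ 2) - c) / d)" for c d
    by (simp only:)
  have "poly_deg_le (card {..<\<alpha> $ 1} + card {..<\<alpha> $ 2} + card {..<k - mi_order \<alpha>}) (lagrange_basis k \<alpha>)"
    unfolding lagrange_basis_def[abs_def]
    by (intro poly_deg_le_mult poly_deg_le_prod 1 2 finite_lessThan)
  then show ?thesis using assms by (simp add: mi_order_eq)
qed

lemma falling_quotient:
  "n < a \<Longrightarrow> (\<Prod>j<a. (real n - real j) / (real a - real j)) = 0"
  "(\<Prod>j<a. (real a - real j) / (real a - real j)) = 1"
  by (auto intro!: prod.neutral prod_zero)

lemma lagrange_basis_node:
  assumes "k \<ge> 1" "mi_order \<alpha> \<le> k" "mi_order \<gamma> \<le> k"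
  shows "lagrange_basis k \<alpha> (node k \<gamma>) = (if \<alpha> = \<gamma> then 1 else 0)"
proof -
  have 1: "real k * node k \<gamma> $ i = real (\<gamma> $ i)" for i using assms by (simp add: node_def)
  have 2: "real k * (1 - node k \<gamma> $ 1 - node k \<gamma> $ 2) = real (k - mi_order \<gamma>)"
    using 1[of 1] 1[of 2] assms(3) by (simp add: right_diff_distrib mi_order_eq of_nat_diff)
  show ?thesis
  proof (cases "\<alpha> = \<gamma>")
    case True
    then show ?thesis unfolding lagrange_basis_def 1 2 by (simp only: falling_quotient) simp
  next
    case False
    \<comment> \<open>The three indices of a node add up to k, so for distinct nodes at least one
      index of \<gamma> is strictly below that of \<alpha>.\<close>
    then have "\<gamma> $ 1 < \<alpha> $ 1 \<or> \<gamma> $ 2 < \<alpha> $ 2 \<or> k - mi_order \<gamma> < k - mi_order \<alpha>"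
      using assms by (auto simp: mi_order_eq vec_eq_iff forall_2)
    then show ?thesis using False unfolding lagrange_basis_def 1 2 by (auto simp: falling_quotient)
  qed
qed

text \<open>Replaces the definite description by a formula that is linear in the nodal values: the
  basis polynomials give existence, \<open>poly_zero_on_nodes\<close> uniqueness.\<close>

lemma ref_interpolant_eq:
  assumes "k \<ge> 1"
  shows "ref_interpolant k u = (\<lambda>x. \<Sum>\<alpha>\<in>{\<alpha>. mi_order \<alpha> \<le> k}. u (node k \<alpha>) * lagrange_basis k \<alpha> x)" (is "_ = ?p")
  unfolding ref_interpolant_def
proof (rule the_equality)
  have p: "poly_deg_le k ?p" by (intro poly_deg_le_lincomb poly_lagrange_basis) auto
  have node: "?p (node k \<gamma>) = u (node k \<gamma>)" if "mi_order \<gamma> \<le> k" for \<gamma>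
  proof -
    have "?p (node k \<gamma>) = (\<Sum>\<alpha>\<in>{\<alpha>. mi_order \<alpha> \<le> k}. if \<alpha> = \<gamma> then u (node k \<alpha>) else 0)"
      using assms that by (intro sum.cong) (auto simp: lagrange_basis_node)
    then show ?thesis using that by (simp add: finite_mi_order_le)
  qed
  show "poly_deg_le k ?p \<and> (\<forall>\<xi>\<in>lagrange_nodes k. ?p \<xi> = u \<xi>)"
    using p node by (auto simp: lagrange_nodes_eq)
  fix q assume q: "poly_deg_le k q \<and> (\<forall>\<xi>\<in>lagrange_nodes k. q \<xi> = u \<xi>)"
  have "(\<lambda>x. q x - ?p x) = (\<lambda>x. 0)"
    using q p node by (intro poly_zero_on_nodes[OF assms] poly_deg_le_diff) (auto simp: lagrange_nodes_eq)
  then show "q = ?p" by (metis (no_types, lifting) eq_iff_diff_eq_0 ext)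
qed

subsection \<open>Interpolation on an element\<close>

text \<open>With \<open>inv F\<close> on the whole plane instead of \<open>inv_into T_ref F\<close>,
  this is one polynomial on the plane, which can be differentiated and reflected without regard to
  T; on T both inverses agree.\<close>

definition interp :: "nat \<Rightarrow> (real^2 \<Rightarrow> real^2) \<Rightarrow> (real^2 \<Rightarrow> real) \<Rightarrow> real^2 \<Rightarrow> real" where
  "interp k F u x = ref_interpolant k (u \<circ> F) (inv F x)"

lemma reference_map_inv:
  assumes "reference_map T F"
  obtains L c where "linear L" "inv F = (\<lambda>x. L x + c)"
proof -
  obtain L c where L: "linear L" "\<And>x. F (L x + c) = x" "\<And>\<xi>. L (F \<xi>) + c = \<xi>"
    by (rule reference_map_inverse[OF assms], rule that)
  have "inv F = (\<lambda>x. L x + c)" using L(2,3) by (intro inv_unique_comp) (auto simp: fun_eq_iff)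
  then show ?thesis using that L(1) by blast
qed

lemma reference_map_inv_eq:
  assumes "reference_map T F"
  shows "F (inv F x) = x" "inv F (F \<xi>) = \<xi>" "x \<in> T \<longleftrightarrow> inv F x \<in> T_ref"
    "x \<in> T \<Longrightarrow> inv_into T_ref F x = inv F x"
proof -
  obtain L c where L: "linear L" "\<And>x. F (L x + c) = x" "\<And>\<xi>. L (F \<xi>) + c = \<xi>"
    "\<And>x. x \<in> T \<longleftrightarrow> L x + c \<in> T_ref"
    by (rule reference_map_inverse[OF assms], rule that)
  have inv: "inv F = (\<lambda>x. L x + c)" using L(2,3) by (intro inv_unique_comp) (auto simp: fun_eq_iff)
  show 1: "F (inv F x) = x" "inv F (F \<xi>) = \<xi>" for x \<xi> using L by (auto simp: inv)
  show 2: "x \<in> T \<longleftrightarrow> inv F x \<in> T_ref" for x using L(4) by (simp add: inv)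
  assume "x \<in> T"
  then show "inv_into T_ref F x = inv F x"
    using assms 1 2 by (intro inv_into_f_eq) (auto simp: reference_map_def bij_betw_def)
qed

lemma interp_eq:
  assumes "k \<ge> 1"
  shows "interp k F u x = (\<Sum>\<alpha>\<in>{\<alpha>. mi_order \<alpha> \<le> k}. u (F (node k \<alpha>)) * lagrange_basis k \<alpha> (inv F x))"
  by (simp add: interp_def ref_interpolant_eq[OF assms])

lemma node_T_ref: "mi_order \<alpha> \<le> k \<Longrightarrow> k \<ge> 1 \<Longrightarrow> node k \<alpha> \<in> T_ref"
  by (simp add: T_ref_eq node_def mi_order_eq flip: add_divide_distrib of_nat_add)

lemma reference_map_node:
  assumes "reference_map T F" "mi_order \<alpha> \<le> k" "k \<ge> 1"
  shows "F (node k \<alpha>) \<in> T"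
  using assms node_T_ref[OF assms(2,3)] by (auto simp: reference_map_def bij_betw_def)

lemma interp_poly:
  assumes "k \<ge> 1" "reference_map T F"
  shows "poly_deg_le k (interp k F u)"
proof -
  obtain L c where L: "linear L" "inv F = (\<lambda>x. L x + c)"
    by (rule reference_map_inv[OF assms(2)], rule that)
  show ?thesis unfolding interp_eq[OF assms(1), abs_def] L(2)
    by (intro poly_deg_le_lincomb poly_deg_le_affine_comp poly_lagrange_basis L) auto
qed

lemma interp_node:
  assumes "k \<ge> 1" "reference_map T F" "mi_order \<gamma> \<le> k"
  shows "interp k F u (F (node k \<gamma>)) = u (F (node k \<gamma>))"
proof -
  have "interp k F u (F (node k \<gamma>)) = (\<Sum>\<alpha>\<in>{\<alpha>. mi_order \<alpha> \<le> k}. if \<alpha> = \<gamma> then u (F (node k \<alpha>)) else 0)"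
    unfolding interp_eq[OF assms(1)] reference_map_inv_eq(2)[OF assms(2)]
    using assms by (intro sum.cong) (auto simp: lagrange_basis_node)
  then show ?thesis using assms by (simp add: finite_mi_order_le)
qed

lemma interp_unique:
  assumes "k \<ge> 1" "reference_map T F" "poly_deg_le k p"
    "\<And>\<alpha>. mi_order \<alpha> \<le> k \<Longrightarrow> p (F (node k \<alpha>)) = u (F (node k \<alpha>))"
  shows "p = interp k F u"
proof -
  obtain B where B: "linear B" "\<And>\<xi>. F \<xi> = F 0 + B \<xi>"
    by (rule reference_map_affine[OF assms(2)], rule that)
  have F: "B \<xi> + F 0 = F \<xi>" for \<xi> unfolding B(2)[of \<xi>] by (rule add.commute)
  have "poly_deg_le k (\<lambda>\<xi>. p (B \<xi> + F 0) - interp k F u (B \<xi> + F 0))"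
    by (intro poly_deg_le_diff poly_deg_le_affine_comp assms(3) B(1) interp_poly[OF assms(1,2)])
  then have P: "poly_deg_le k (\<lambda>\<xi>. p (F \<xi>) - interp k F u (F \<xi>))"
    by (simp only: F)
  have "(\<lambda>\<xi>. p (F \<xi>) - interp k F u (F \<xi>)) = (\<lambda>\<xi>. 0)"
    by (rule poly_zero_on_nodes[OF assms(1) P]) (simp add: assms(4) interp_node[OF assms(1,2)])
  then have "p (F \<xi>) = interp k F u (F \<xi>)" for \<xi> by (metis eq_iff_diff_eq_0)
  then have "p x = interp k F u x" for x using reference_map_inv_eq(1)[OF assms(2), of x] by metis
  then show ?thesis by (rule ext)
qed

lemma interp_poly_eq:
  assumes "k \<ge> 1" "reference_map T F" "poly_deg_le k p"
  shows "interp k F p = p"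
  using interp_unique[OF assms] by simp

lemma interp_diff:
  "k \<ge> 1 \<Longrightarrow> interp k F (\<lambda>x. u x - v x) x = interp k F u x - interp k F v x"
  by (simp add: interp_eq left_diff_distrib sum_subtractf)

lemma interp_cmult:
  "k \<ge> 1 \<Longrightarrow> interp k F (\<lambda>x. a * u x) x = a * interp k F u x"
  by (simp add: interp_eq sum_distrib_left mult.assoc)

text \<open>Points whose barycentric weights are multiples of 1 / k. Indexing the weights by the
  vertices themselves removes the order of the vertices, which a reference map fixes.\<close>

definition simplex_nodes :: "nat \<Rightarrow> (real^2) set \<Rightarrow> (real^2) set" where
  "simplex_nodes k C = (\<lambda>m. \<Sum>v\<in>C. (real (m v) / real k) *\<^sub>R v) ` {m. (\<Sum>v\<in>C. m v) = k}"

text \<open>The right-hand side does not mention \<open>F\<close>, so interpolation does not depend on the reference map.\<close>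

lemma reference_map_nodes:
  assumes "k \<ge> 1" "reference_map T F" "\<not> affine_dependent C" "card C = 3" "T = convex hull C"
  shows "F ` node k ` {\<alpha>. mi_order \<alpha> \<le> k} = simplex_nodes k C"
proof -
  obtain B where B: "linear B" "\<And>\<xi>. F \<xi> = F 0 + B \<xi>" "inj B"
    by (rule reference_map_affine[OF assms(2)], rule that)
  define p q r where "p = F 0" and "q = F (axis 1 1)" and "r = F (axis 2 1)"
  have Bpq: "B (axis 1 1) = q - p" "B (axis 2 1) = r - p"
    using B(2)[of "axis 1 1"] B(2)[of "axis 2 1"] by (auto simp: p_def q_def r_def)
  have F: "F \<xi> = p + (\<xi> $ 1 *\<^sub>R (q - p) + \<xi> $ 2 *\<^sub>R (r - p))" for \<xi>
  proof -
    have "\<xi> = \<xi> $ 1 *\<^sub>R axis 1 1 + \<xi> $ 2 *\<^sub>R axis 2 1"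
      by (simp add: vec_eq_iff forall_2 axis_def)
    then have "B \<xi> = B (\<xi> $ 1 *\<^sub>R axis 1 1 + \<xi> $ 2 *\<^sub>R axis 2 1)" by (rule arg_cong)
    also have "\<dots> = \<xi> $ 1 *\<^sub>R (q - p) + \<xi> $ 2 *\<^sub>R (r - p)"
      by (simp only: linear_add[OF B(1)] linear_cmul[OF B(1)] Bpq)
    finally show ?thesis using B(2)[of \<xi>] by (simp add: p_def)
  qed
  have "convex hull {p, q, r} = convex hull C"
    using assms(2,5) affine_image_T_ref[of p q r] F by (simp add: reference_map_def bij_betw_def)
  \<comment> \<open>Affinely independent vertices are extreme points of their hull, and an extreme
    point of a hull belongs to every generating set.\<close>
  then have "C \<subseteq> {p, q, r}"
    using extreme_point_of_convex_hull_affine_independent[OF assms(3)] extreme_point_of_convex_hull[of _ "{p, q, r}"]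
    by (metis subsetI)
  moreover have "card {p, q, r} \<le> 3" by (simp add: card_insert_if)
  ultimately have C: "C = {p, q, r}" using assms(4) by (intro card_seteq) auto
  then have dist: "p \<noteq> q" "p \<noteq> r" "q \<noteq> r"
    using assms(4) by (auto simp: card_insert_if split: if_splits)
  have Fn: "F (node k \<alpha>) = (real (k - \<alpha> $ 1 - \<alpha> $ 2) / k) *\<^sub>R p + (real (\<alpha> $ 1) / k) *\<^sub>R q + (real (\<alpha> $ 2) / k) *\<^sub>R r"
    if "mi_order \<alpha> \<le> k" for \<alpha>
  proof -
    have "real (k - \<alpha> $ 1 - \<alpha> $ 2) = real k - \<alpha> $ 1 - \<alpha> $ 2" using that by (simp add: mi_order_eq)
    then have e: "real (k - \<alpha> $ 1 - \<alpha> $ 2) / k = 1 - \<alpha> $ 1 / k - \<alpha> $ 2 / k"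
      using assms(1) by (simp add: diff_divide_distrib)
    show ?thesis unfolding F e by (simp add: node_def algebra_simps)
  qed
  show ?thesis
  proof (intro equalityI subsetI)
    fix x assume "x \<in> F ` node k ` {\<alpha>. mi_order \<alpha> \<le> k}"
    then obtain \<alpha> where \<alpha>: "mi_order \<alpha> \<le> k" "x = F (node k \<alpha>)" by auto
    define m where "m v = (if v = p then k - \<alpha> $ 1 - \<alpha> $ 2 else if v = q then \<alpha> $ 1 else \<alpha> $ 2)" for v
    have "(\<Sum>v\<in>C. m v) = k" using dist \<alpha>(1) by (simp add: C m_def mi_order_eq)
    moreover have "x = (\<Sum>v\<in>C. (real (m v) / real k) *\<^sub>R v)"
      using dist unfolding \<alpha>(2) Fn[OF \<alpha>(1)] by (simp add: C m_def)
    ultimately show "x \<in> simplex_nodes k C" unfolding simplex_nodes_def by blast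
  next
    fix x assume "x \<in> simplex_nodes k C"
    then obtain m where m: "(\<Sum>v\<in>C. m v) = k" "x = (\<Sum>v\<in>C. (real (m v) / real k) *\<^sub>R v)"
      unfolding simplex_nodes_def by blast
    define \<alpha> :: "nat^2" where "\<alpha> = (\<chi> i. if i = 1 then m q else m r)"
    have \<alpha>: "\<alpha> $ 1 = m q" "\<alpha> $ 2 = m r" by (simp_all add: \<alpha>_def)
    have s: "m p + m q + m r = k" using m(1) dist by (simp add: C)
    then have o: "mi_order \<alpha> \<le> k" by (simp add: mi_order_eq \<alpha>)
    have "k - m q - m r = m p" using s by simp
    then have "x = F (node k \<alpha>)" using dist unfolding Fn[OF o] m(2) by (simp add: C \<alpha>)
    then show "x \<in> F ` node k ` {\<alpha>. mi_order \<alpha> \<le> k}" using o by blast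
  qed
qed

text \<open>A symmetric pair comes with reference maps of its own, which may differ from the maps in
  the interpolation operator; this identifies the two interpolants.\<close>

lemma interp_indep:
  assumes "k \<ge> 1" "2 simplex T" "reference_map T F" "reference_map T G"
  shows "interp k F u = interp k G u"
proof -
  obtain C where C: "\<not> affine_dependent C" "int (card C) = 2 + 1" "T = convex hull C"
    using assms(2) by (auto simp: simplex_def)
  have "card C = 3" using C(2) by simp
  then have nodes: "F ` node k ` {\<alpha>. mi_order \<alpha> \<le> k} = G ` node k ` {\<alpha>. mi_order \<alpha> \<le> k}"
    using reference_map_nodes[OF assms(1) _ C(1) _ C(3)] assms(3,4) by metis
  show ?thesis
  proof (rule interp_unique[OF assms(1,4) interp_poly[OF assms(1,3)]])
    fix \<alpha> :: "nat^2" assume "mi_order \<alpha> \<le> k"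
    then have "G (node k \<alpha>) \<in> F ` node k ` {\<alpha>. mi_order \<alpha> \<le> k}" unfolding nodes by blast
    then show "interp k F u (G (node k \<alpha>)) = u (G (node k \<alpha>))"
      using interp_node[OF assms(1,3)] by auto
  qed
qed

text \<open>Corresponding nodes of the two elements are reflections of each other, so both sides
  have the same values at the nodes of S and uniqueness applies. With z twice the common vertex,
  this transports parity from a function to its interpolant.\<close>

lemma interp_reflect:
  assumes "k \<ge> 1" "reference_map S F" "reference_map T G" "\<And>\<xi>. \<xi> \<in> T_ref \<Longrightarrow> G \<xi> = z - F \<xi>"
  shows "interp k G u (z - x) = interp k F (\<lambda>x. u (z - x)) x"
proof -
  have "linear (\<lambda>x::real^2. - x)" by (simp add: linear_iff)
  then have "poly_deg_le k (\<lambda>x. interp k G u (- x + z))"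
    by (rule poly_deg_le_affine_comp[OF interp_poly[OF assms(1,3)]])
  then have "(\<lambda>x. interp k G u (z - x)) = interp k F (\<lambda>x. u (z - x))"
    using assms(4)[OF node_T_ref[OF _ assms(1)]] interp_node[OF assms(1,3)]
    by (intro interp_unique[OF assms(1,2)]) (simp, metis)
  then show ?thesis by metis
qed

lemma partial_affine_comp:
  assumes "Cdiff_on (Suc 0) UNIV p" "linear L"
  shows "partial i (\<lambda>x. p (L x + c)) = (\<lambda>x. \<Sum>j\<in>UNIV. L (axis i 1) $ j * partial j p (L x + c))"
proof (rule ext)
  fix x
  have "((\<lambda>x. L x + c) has_derivative L) (at x)"
    using assms(2) by (auto intro!: derivative_eq_intros linear_imp_has_derivative)
  moreover have "(p has_derivative (\<lambda>d. \<Sum>j\<in>UNIV. d $ j * partial j p (L x + c))) (at (L x + c))"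
    by (rule Cdiff_on_Suc_derivative[OF assms(1)]) simp
  ultimately have "((\<lambda>x. p (L x + c)) has_derivative (\<lambda>d. \<Sum>j\<in>UNIV. L d $ j * partial j p (L x + c))) (at x)"
    by (rule has_derivative_compose)
  from partial_eq[OF this] show "partial i (\<lambda>x. p (L x + c)) x = (\<Sum>j\<in>UNIV. L (axis i 1) $ j * partial j p (L x + c))" .
qed

text \<open>By the chain rule each differentiation brings out entries of L, bounded by s, and leaves
  partial derivatives of p composed with the same affine map; these are bounded on the compact
  \<open>T_ref\<close>. The constant is chosen before L and c, so one constant serves all
  elements.\<close>

lemma Dw_affine_comp_bound:
  assumes "poly_deg_le k p"
  shows "\<exists>C\<ge>0. \<forall>L c s w x. linear L \<longrightarrow> (\<forall>i j. \<bar>L (axis i 1) $ j\<bar> \<le> s) \<longrightarrow> L x + c \<in> T_ref \<longrightarrow>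
    length w = n \<longrightarrow> \<bar>Dw w (\<lambda>x. p (L x + c)) x\<bar> \<le> C * s ^ n"
  using assms
proof (induction n arbitrary: p k)
  case 0
  have "compact T_ref" unfolding T_ref_def by (simp add: finite_imp_compact_convex_hull)
  moreover have "continuous_on T_ref p"
    using Cdiff_on_poly[OF 0, of 0] by (auto intro: continuous_on_subset)
  ultimately have "bounded (p ` T_ref)" by (intro compact_imp_bounded compact_continuous_image)
  then obtain C where C: "C > 0" "\<And>x. x \<in> T_ref \<Longrightarrow> \<bar>p x\<bar> \<le> C" by (auto simp: bounded_pos)
  then show ?case by (intro exI[of _ C]) auto
next
  case (Suc n)
  have "poly_deg_le k (partial j p)" for j
    using Suc.prems by (intro poly_deg_le_partial poly_deg_le_mono[of k p "Suc k"]) auto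
  note P = this
  from Suc.IH[OF this] obtain C where C: "\<And>j. C j \<ge> 0" "\<And>j L c s w x. linear L \<Longrightarrow> (\<And>i l. \<bar>L (axis i 1) $ l\<bar> \<le> s) \<Longrightarrow> L x + c \<in> T_ref \<Longrightarrow>
    length w = n \<Longrightarrow> \<bar>Dw w (\<lambda>x. partial j p (L x + c)) x\<bar> \<le> C j * s ^ n"
    by metis
  show ?case
  proof (intro exI[of _ "\<Sum>j\<in>UNIV. C j"] conjI allI impI)
    show "0 \<le> (\<Sum>j\<in>UNIV. C j)" by (simp add: sum_nonneg C)
    fix L :: "real^2 \<Rightarrow> real^2" and c s x and w :: "2 list"
    assume L: "linear L" "\<forall>i j. \<bar>L (axis i 1) $ j\<bar> \<le> s" "L x + c \<in> T_ref" and "length w = Suc n"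
    \<comment> \<open>The word is split at its last letter, whose derivative acts first.\<close>
    then obtain v i where w: "w = v @ [i]" "length v = n" by (cases w rule: rev_cases) auto
    have "0 \<le> s" using L(2) abs_ge_zero order_trans by blast
    have "Dw w (\<lambda>x. p (L x + c)) x = Dw v (\<lambda>x. \<Sum>j\<in>UNIV. L (axis i 1) $ j * partial j p (L x + c)) x"
      by (simp only: w(1) Dw_append Dw_simps partial_affine_comp[OF Cdiff_on_poly[OF Suc.prems] L(1)])
    also have "\<dots> = (\<Sum>j\<in>UNIV. L (axis i 1) $ j * Dw v (\<lambda>x. partial j p (L x + c)) x)"
      by (rule Dw_lincomb[OF open_UNIV]) (auto intro!: Cdiff_on_poly poly_deg_le_affine_comp P L)
    also have "\<bar>\<dots>\<bar> \<le> (\<Sum>j\<in>UNIV. s * (C j * s ^ n))"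
      unfolding abs_mult
      by (intro order_trans[OF sum_abs] sum_mono)
        (use L C(2)[OF L(1) _ L(3) w(2)] \<open>0 \<le> s\<close> in \<open>auto simp: abs_mult intro!: mult_mono\<close>)
    finally show "\<bar>Dw w (\<lambda>x. p (L x + c)) x\<bar> \<le> (\<Sum>j\<in>UNIV. C j) * s ^ Suc n"
      by (simp add: sum_distrib_left sum_distrib_right mult_ac)
  qed
qed

text \<open>A step of length r along an axis from the centre of the ball stays in T. Its image, r
  times a column of L, is a difference of two points of \<open>T_ref\<close>, whose coordinates lie
  in [0, 1].\<close>

lemma reference_map_inverse_bound:
  assumes "reference_map T F" "linear L" "inv F = (\<lambda>x. L x + c)" "cball y r \<subseteq> T" "0 < r"
  shows "\<bar>L (axis i 1) $ j\<bar> \<le> 1 / r"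
proof -
  have "y + r *\<^sub>R axis i 1 \<in> T" "y \<in> T"
    using assms(4,5) by (auto intro!: subsetD[OF assms(4)] simp: dist_norm)
  then have "L (y + r *\<^sub>R axis i 1) + c \<in> T_ref" "L y + c \<in> T_ref"
    using reference_map_inv_eq(3)[OF assms(1)] assms(3) by auto
  then have "\<bar>(L (y + r *\<^sub>R axis i 1) + c - (L y + c)) $ j\<bar> \<le> 1"
    using exhaust_2[of j] by (auto simp: T_ref_eq)
  also have "L (y + r *\<^sub>R axis i 1) + c - (L y + c) = r *\<^sub>R L (axis i 1)"
    using assms(2) by (simp add: linear_add linear_cmul)
  finally show ?thesis using assms(5) by (simp add: abs_mult field_simps)
qed

text \<open>Stability and inverse estimate in one: only the nodal values of u enter, and each
  derivative costs a factor 1 / r. The bound m on the length of w lets one constant serve all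
  orders.\<close>

lemma interp_stable:
  assumes "k \<ge> 1"
  obtains C where "0 \<le> C" "\<And>T F y r u M w x. reference_map T F \<Longrightarrow> cball y r \<subseteq> T \<Longrightarrow> 0 < r \<Longrightarrow>
    (\<forall>z\<in>F ` node k ` {\<alpha>. mi_order \<alpha> \<le> k}. \<bar>u z\<bar> \<le> M) \<Longrightarrow> x \<in> T \<Longrightarrow> length w \<le> m \<Longrightarrow>
    \<bar>Dw w (interp k F u) x\<bar> \<le> C * M * (1 / r) ^ length w"
proof -
  have "\<exists>C\<ge>0. \<forall>L c s w x. linear L \<longrightarrow> (\<forall>i j. \<bar>L (axis i 1) $ j\<bar> \<le> s) \<longrightarrow> L x + c \<in> T_ref \<longrightarrow>
    length w = n \<longrightarrow> \<bar>Dw w (\<lambda>x. lagrange_basis k \<alpha> (L x + c)) x\<bar> \<le> C * s ^ n" if "mi_order \<alpha> \<le> k" for \<alpha> n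
    by (rule Dw_affine_comp_bound[OF poly_lagrange_basis[OF that]])
  then obtain C where C: "\<And>\<alpha> n. mi_order \<alpha> \<le> k \<Longrightarrow> 0 \<le> C \<alpha> n"
    "\<And>\<alpha> n L c s w x. mi_order \<alpha> \<le> k \<Longrightarrow> linear L \<Longrightarrow> (\<And>i j. \<bar>L (axis i 1) $ j\<bar> \<le> s) \<Longrightarrow> L x + c \<in> T_ref \<Longrightarrow>
    length w = n \<Longrightarrow> \<bar>Dw w (\<lambda>x. lagrange_basis k \<alpha> (L x + c)) x\<bar> \<le> C \<alpha> n * s ^ n"
    by metis
  define K where "K = (\<Sum>n\<le>m. \<Sum>\<alpha>\<in>{\<alpha>. mi_order \<alpha> \<le> k}. C \<alpha> n)"
  show ?thesis
  proof (rule that)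
    show "0 \<le> K" unfolding K_def by (intro sum_nonneg) (auto intro: C)
    fix T F y r x and u :: "real^2 \<Rightarrow> real" and M :: real and w :: "2 list"
    assume F: "reference_map T F" and r: "cball y r \<subseteq> T" "0 < r"
      and u: "\<forall>z\<in>F ` node k ` {\<alpha>. mi_order \<alpha> \<le> k}. \<bar>u z\<bar> \<le> M"
      and x: "x \<in> T" and w: "length w \<le> m"
    obtain L c where L: "linear L" "inv F = (\<lambda>x. L x + c)"
      by (rule reference_map_inv[OF F], rule that)
    have "mi_order 0 \<le> k" by (simp add: mi_order_eq)
    then have "0 \<le> M" using u by fastforce
    have "Dw w (interp k F u) x = Dw w (\<lambda>x. \<Sum>\<alpha>\<in>{\<alpha>. mi_order \<alpha> \<le> k}. u (F (node k \<alpha>)) * lagrange_basis k \<alpha> (L x + c)) x"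
      unfolding interp_eq[OF assms, abs_def] L(2) ..
    also have "\<dots> = (\<Sum>\<alpha>\<in>{\<alpha>. mi_order \<alpha> \<le> k}. u (F (node k \<alpha>)) * Dw w (\<lambda>x. lagrange_basis k \<alpha> (L x + c)) x)"
      by (rule Dw_lincomb[OF open_UNIV])
        (auto intro!: Cdiff_on_poly poly_deg_le_affine_comp poly_lagrange_basis L)
    also have "\<bar>\<dots>\<bar> \<le> (\<Sum>\<alpha>\<in>{\<alpha>. mi_order \<alpha> \<le> k}. M * (C \<alpha> (length w) * (1 / r) ^ length w))"
    proof (intro order_trans[OF sum_abs] sum_mono)
      fix \<alpha> assume "\<alpha> \<in> {\<alpha>. mi_order \<alpha> \<le> k}"
      then have \<alpha>: "mi_order \<alpha> \<le> k" by simp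
      have "\<bar>Dw w (\<lambda>x. lagrange_basis k \<alpha> (L x + c)) x\<bar> \<le> C \<alpha> (length w) * (1 / r) ^ length w"
        using x reference_map_inv_eq(3)[OF F] L(2)
        by (intro C(2)[OF \<alpha> L(1)] reference_map_inverse_bound[OF F L r]) auto
      then show "\<bar>u (F (node k \<alpha>)) * Dw w (\<lambda>x. lagrange_basis k \<alpha> (L x + c)) x\<bar> \<le> M * (C \<alpha> (length w) * (1 / r) ^ length w)"
        unfolding abs_mult using u \<alpha> \<open>0 \<le> M\<close> by (intro mult_mono) auto
    qed
    also have "\<dots> = (\<Sum>\<alpha>\<in>{\<alpha>. mi_order \<alpha> \<le> k}. C \<alpha> (length w)) * (M * (1 / r) ^ length w)"
      by (simp add: sum_distrib_right sum_distrib_left mult_ac)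
    also have "\<dots> \<le> K * (M * (1 / r) ^ length w)"
    proof (rule mult_right_mono)
      show "(\<Sum>\<alpha>\<in>{\<alpha>. mi_order \<alpha> \<le> k}. C \<alpha> (length w)) \<le> K"
        unfolding K_def using w
        by (intro member_le_sum[of "length w" "{..m}" "\<lambda>n. \<Sum>\<alpha>\<in>{\<alpha>. mi_order \<alpha> \<le> k}. C \<alpha> n"])
          (auto intro!: sum_nonneg C)
    qed (use \<open>0 \<le> M\<close> r in auto)
    finally show "\<bar>Dw w (interp k F u) x\<bar> \<le> K * M * (1 / r) ^ length w" by (simp add: mult.assoc)
  qed
qed

lemma Dw_reflect:
  assumes "poly_deg_le k p"
  shows "Dw w (\<lambda>x. p (z - x)) = (\<lambda>x. (- 1) ^ length w * Dw w p (z - x))"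
proof (induction w)
  case (Cons i w)
  define q where "q = Dw w p"
  have q: "Cdiff_on (Suc 0) UNIV q"
    unfolding q_def by (rule Cdiff_on_Dw) (rule Cdiff_on_poly[OF assms])
  have "partial i (\<lambda>x. (- 1) ^ length w * q (z - x)) x = (- 1) ^ Suc (length w) * partial i q (z - x)" for x
  proof -
    have "((\<lambda>x. z - x) has_derivative (\<lambda>d. - d)) (at x)"
      by (auto intro!: derivative_eq_intros)
    from has_derivative_compose[OF this Cdiff_on_Suc_derivative[OF q]]
    have "((\<lambda>x. (- 1) ^ length w * q (z - x)) has_derivative
        (\<lambda>d. (- 1) ^ length w * (\<Sum>i\<in>UNIV. (- d) $ i * partial i q (z - x)))) (at x)"
      by (intro has_derivative_mult_right) auto
    from partial_eq[OF this] show ?thesis by (simp add: sum_negf axis_sum)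
  qed
  then have "partial i (\<lambda>x. (- 1) ^ length w * q (z - x)) = (\<lambda>x. (- 1) ^ length (i # w) * partial i q (z - x))"
    by (simp add: fun_eq_iff)
  then show ?case unfolding Dw_simps Cons.IH q_def .
qed simp

text \<open>The common face meets the interior of S and is therefore all of S; so S is a face of T,
  and a proper face would have smaller dimension.\<close>

lemma triangulation_interior_disjoint:
  assumes "conforming_triangulation_of \<Omega> \<T>" "S \<in> \<T>" "T \<in> \<T>" "x \<in> interior S" "x \<in> T"
  shows "S = T"
proof -
  have simplex: "2 simplex S" "2 simplex T" and face: "S \<inter> T face_of S" "T \<inter> S face_of T"
    using assms(1,2,3) by (auto simp: conforming_triangulation_of_def triangulation_def)
  have "interior S = rel_interior S" using assms(4) by (intro rel_interior_nonempty_interior[symmetric]) auto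
  then have "S \<subseteq> S \<inter> T"
    using assms(4,5) interior_subset by (intro subset_of_face_of[OF face(1)]) auto
  then have "S \<inter> T = S" by blast
  then have "S face_of T" using face(2) by (simp add: Int_commute)
  then show ?thesis
    using face_of_aff_dim_lt[OF convex_simplex[OF simplex(2)]] aff_dim_simplex[OF simplex(1)] aff_dim_simplex[OF simplex(2)]
    by (metis less_irrefl)
qed

text \<open>At an interior point the choice of the element is forced. As the interior is open,
  derivatives of the global interpolant can be computed there from the polynomial of T.\<close>

lemma lagrange_interpolant_eq_interp:
  assumes "k \<ge> 1" "conforming_triangulation_of \<Omega> \<T>" "T \<in> \<T>" "x \<in> interior T" "reference_map T (F T)"
  shows "lagrange_interpolant k \<T> F f x = interp k (F T) f x"
proof -
  have x: "x \<in> T" using assms(4) interior_subset by blast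
  have "(SOME S. S \<in> \<T> \<and> x \<in> S) = T"
  proof (rule some_equality)
    show "T \<in> \<T> \<and> x \<in> T" using assms(3) x by blast
    show "S = T" if "S \<in> \<T> \<and> x \<in> S" for S
      using triangulation_interior_disjoint[OF assms(2,3) _ assms(4)] that by blast
  qed
  then show ?thesis
    unfolding lagrange_interpolant_def Let_def interp_def
    by (simp add: reference_map_inv_eq(4)[OF assms(5) x])
qed

subsection \<open>Taylor polynomials\<close>

lemma DERIV_line:
  fixes f :: "real^2 \<Rightarrow> real"
  assumes "f differentiable (at (z + s *\<^sub>R d))"
  shows "((\<lambda>s. f (z + s *\<^sub>R d)) has_real_derivative (\<Sum>i\<in>UNIV. d $ i * partial i f (z + s *\<^sub>R d))) (at s)"
proof -
  have "((\<lambda>s. z + s *\<^sub>R d) has_derivative (\<lambda>s. s *\<^sub>R d)) (at s)"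
    by (auto intro!: derivative_eq_intros)
  from has_derivative_compose[OF this differentiable_partial[OF assms]]
  show ?thesis unfolding has_field_derivative_def
    by (rule has_derivative_eq_rhs) (auto simp: fun_eq_iff sum_distrib_left mult_ac)
qed

lemma DERIV_axis:
  fixes f :: "real^2 \<Rightarrow> real"
  assumes "f differentiable (at (z + s *\<^sub>R axis i 1))"
  shows "((\<lambda>s. f (z + s *\<^sub>R axis i 1)) has_real_derivative partial i f (z + s *\<^sub>R axis i 1)) (at s)"
  using DERIV_line[OF assms] by (simp add: axis_sum)

text \<open>Exchanging \<open>i\<close> and \<open>j\<close> leaves the second difference unchanged; hence partial derivatives commute.\<close>

lemma mixed_difference:
  assumes "Cdiff_on 2 U f" "ball x r \<subseteq> U" "0 < h" "2 * h < r"
  obtains \<xi> where "dist x \<xi> \<le> 2 * h"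
    "f (x + h *\<^sub>R axis i 1 + h *\<^sub>R axis j 1) - f (x + h *\<^sub>R axis i 1) - f (x + h *\<^sub>R axis j 1) + f x
      = h * h * partial j (partial i f) \<xi>"
proof -
  have near: "dist x (x + s *\<^sub>R axis i 1 + t *\<^sub>R axis j 1) \<le> 2 * h" if "0 \<le> s" "s \<le> h" "0 \<le> t" "t \<le> h" for s t
  proof -
    have "dist x (x + s *\<^sub>R axis i 1 + t *\<^sub>R axis j 1) = norm (s *\<^sub>R axis i (1::real) + t *\<^sub>R axis j 1)"
      unfolding dist_commute[of x] by (simp add: dist_norm add.assoc)
    then show ?thesis
      using norm_triangle_ineq[of "s *\<^sub>R axis i (1::real)" "t *\<^sub>R axis j 1"] that by simp
  qed
  have inU: "x + s *\<^sub>R axis i 1 + t *\<^sub>R axis j 1 \<in> U" if "0 \<le> s" "s \<le> h" "0 \<le> t" "t \<le> h" for s t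
    using near[OF that] assms(2,4) by (auto simp: mem_ball intro!: subsetD[OF assms(2)])
  have d1: "f differentiable (at y)" "partial i f differentiable (at y)" if "y \<in> U" for y
    using assms(1) that by (auto simp: numeral_2_eq_2)
  \<comment> \<open>The second difference is a first difference of \<phi>. The mean value theorem is
    applied to \<phi> in direction i and then to \<open>partial i f\<close> in direction j.\<close>
  define \<phi> where "\<phi> s = f (x + h *\<^sub>R axis j 1 + s *\<^sub>R axis i 1) - f (x + s *\<^sub>R axis i 1)" for s
  have "(\<phi> has_real_derivative partial i f (x + h *\<^sub>R axis j 1 + s *\<^sub>R axis i 1) - partial i f (x + s *\<^sub>R axis i 1)) (at s)"
    if "0 \<le> s" "s \<le> h" for s
    unfolding \<phi>_def[abs_def] using inU[of s h] inU[of s 0] that assms(3)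
    by (intro DERIV_diff DERIV_axis d1) (auto simp: add_ac)
  from MVT2[OF assms(3) this]
  obtain s where s: "0 < s" "s < h" "\<phi> h - \<phi> 0 = h * (partial i f (x + h *\<^sub>R axis j 1 + s *\<^sub>R axis i 1) - partial i f (x + s *\<^sub>R axis i 1))"
    by auto
  define z where "z = x + s *\<^sub>R axis i 1"
  have "((\<lambda>t. partial i f (z + t *\<^sub>R axis j 1)) has_real_derivative partial j (partial i f) (z + t *\<^sub>R axis j 1)) (at t)"
    if "0 \<le> t" "t \<le> h" for t
    using inU[of s t] that s by (intro DERIV_axis d1) (auto simp: z_def)
  from MVT2[OF assms(3) this]
  obtain t where t: "0 < t" "t < h" "partial i f (z + h *\<^sub>R axis j 1) - partial i f (z + 0 *\<^sub>R axis j 1) = h * partial j (partial i f) (z + t *\<^sub>R axis j 1)"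
    by auto
  show ?thesis
  proof (rule that[of "z + t *\<^sub>R axis j 1"])
    show "dist x (z + t *\<^sub>R axis j 1) \<le> 2 * h" unfolding z_def using s t by (intro near) auto
    have e: "z + h *\<^sub>R axis j 1 = x + h *\<^sub>R axis j 1 + s *\<^sub>R axis i 1" by (simp add: z_def add_ac)
    have "\<phi> h - \<phi> 0 = h * (h * partial j (partial i f) (z + t *\<^sub>R axis j 1))"
      using s(3) t(3)[unfolded e] by (simp add: z_def)
    then show "f (x + h *\<^sub>R axis i 1 + h *\<^sub>R axis j 1) - f (x + h *\<^sub>R axis i 1) - f (x + h *\<^sub>R axis j 1) + f x
      = h * h * partial j (partial i f) (z + t *\<^sub>R axis j 1)"
      by (simp add: \<phi>_def add_ac)
  qed
qed

lemma partial_commute: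
  assumes "open U" "Cdiff_on 2 U f" "x \<in> U"
  shows "partial i (partial j f) x = partial j (partial i f) x"
proof (rule ccontr)
  let ?A = "partial j (partial i f)" and ?B = "partial i (partial j f)"
  assume "?B x \<noteq> ?A x"
  then have e: "\<bar>?B x - ?A x\<bar> / 2 > 0" by simp
  obtain r where r: "r > 0" "ball x r \<subseteq> U" using assms by (meson openE)
  have "continuous_on U ?A" "continuous_on U ?B" using assms(2) by (auto simp: numeral_2_eq_2)
  then have "isCont ?A x" "isCont ?B x" using assms continuous_on_eq_continuous_at by blast+
  then obtain d1 d2 where d: "d1 > 0" "\<And>y. dist y x < d1 \<Longrightarrow> dist (?A y) (?A x) < \<bar>?B x - ?A x\<bar> / 2"
    "d2 > 0" "\<And>y. dist y x < d2 \<Longrightarrow> dist (?B y) (?B x) < \<bar>?B x - ?A x\<bar> / 2"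
    using e unfolding continuous_at_eps_delta by metis
  \<comment> \<open>Small enough that at both intermediate points the mixed derivatives are within
    half of their supposed gap of their values at x.\<close>
  define h where "h = min r (min d1 d2) / 4"
  have h: "0 < h" "2 * h < r" "2 * h < d1" "2 * h < d2" using r d by (auto simp: h_def)
  obtain \<xi> where \<xi>: "dist x \<xi> \<le> 2 * h" "f (x + h *\<^sub>R axis i 1 + h *\<^sub>R axis j 1) - f (x + h *\<^sub>R axis i 1) - f (x + h *\<^sub>R axis j 1) + f x
      = h * h * ?A \<xi>"
    by (rule mixed_difference[OF assms(2) r(2) h(1,2)], rule that)
  obtain \<eta> where \<eta>: "dist x \<eta> \<le> 2 * h" "f (x + h *\<^sub>R axis j 1 + h *\<^sub>R axis i 1) - f (x + h *\<^sub>R axis j 1) - f (x + h *\<^sub>R axis i 1) + f x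
      = h * h * ?B \<eta>"
    by (rule mixed_difference[OF assms(2) r(2) h(1,2)], rule that)
  have "h * h * ?A \<xi> = h * h * ?B \<eta>"
    unfolding \<xi>(2)[symmetric] \<eta>(2)[symmetric] by (simp add: add_ac)
  then have "?A \<xi> = ?B \<eta>" using h by simp
  moreover have "dist (?A \<xi>) (?A x) < \<bar>?B x - ?A x\<bar> / 2" "dist (?B \<eta>) (?B x) < \<bar>?B x - ?A x\<bar> / 2"
    using d(2)[of \<xi>] d(4)[of \<eta>] \<xi>(1) \<eta>(1) h by (simp_all add: dist_commute)
  ultimately show False by (simp add: dist_real_def abs_if split: if_splits)
qed

text \<open>The letter j is exchanged with one letter of the block at a time. The remaining
  exchanges take place under an outer derivative, so the induction hypothesis is used on the whole
  open set.\<close>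

lemma Dw_move:
  assumes "open U"
  shows "Cdiff_on (Suc (n + length v)) U f \<Longrightarrow> x \<in> U \<Longrightarrow>
    Dw (j # replicate n i @ v) f x = Dw (replicate n i @ j # v) f x"
proof (induction n arbitrary: x)
  case (Suc n)
  define G where "G = Dw (replicate n i @ v) f"
  have "Cdiff_on 2 U G"
    unfolding G_def by (rule Cdiff_on_Dw) (use Suc.prems(1) in \<open>simp del: Cdiff_on.simps add: numeral_2_eq_2\<close>)
  then have "partial j (partial i G) x = partial i (partial j G) x"
    by (rule partial_commute[OF assms _ Suc.prems(2)])
  also have "\<dots> = partial i (Dw (replicate n i @ j # v) f) x"
  proof (rule partial_cong[OF assms Suc.prems(2)])
    fix y assume "y \<in> U"
    have "Cdiff_on (Suc (n + length v)) U f"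
      using Suc.prems(1) by (auto intro: Cdiff_on_Suc_imp simp del: Cdiff_on.simps)
    from Suc.IH[OF this \<open>y \<in> U\<close>] show "partial j G y = Dw (replicate n i @ j # v) f y"
      by (simp add: G_def)
  qed
  finally show ?case by (simp add: G_def)
qed simp

text \<open>Insertion sort: a new letter 1 joins the front block, a new letter 2 is moved past it.
  \<open>Cm_norm\<close> controls only the sorted derivatives, and this makes its bounds available
  for all words.\<close>

lemma Dw_eq_mi_deriv:
  assumes "open U"
  shows "Cdiff_on (length w) U f \<Longrightarrow> \<exists>\<beta>. mi_order \<beta> = length w \<and> (\<forall>x\<in>U. Dw w f x = mi_deriv \<beta> f x)"
proof (induction w)
  case Nil
  then show ?case by (intro exI[of _ 0]) (simp add: mi_order_eq mi_deriv_def)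
next
  case (Cons i w)
  have "Cdiff_on (length w) U f" using Cons.prems by (auto intro: Cdiff_on_Suc_imp simp del: Cdiff_on.simps)
  then obtain \<beta> where \<beta>: "mi_order \<beta> = length w" "\<And>x. x \<in> U \<Longrightarrow> Dw w f x = mi_deriv \<beta> f x"
    using Cons.IH by blast
  have 1: "Dw (i # w) f x = Dw (i # replicate (\<beta> $ 1) 1 @ replicate (\<beta> $ 2) 2) f x" if "x \<in> U" for x
    using partial_cong[OF assms that \<beta>(2)] by (simp add: mi_deriv_eq_Dw)
  have len: "Suc (\<beta> $ 1 + length (replicate (\<beta> $ 2) (2::2))) = length (i # w)"
    using \<beta>(1) by (simp add: mi_order_eq)
  consider "i = 1" | "i = 2" using exhaust_2 by blast
  then show ?case
  proof cases
    case 1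
    define \<gamma> where "\<gamma> = \<beta> + axis 1 1"
    have "\<gamma> $ 1 = Suc (\<beta> $ 1)" "\<gamma> $ 2 = \<beta> $ 2" by (auto simp: \<gamma>_def axis_def)
    then show ?thesis using \<open>\<And>x. x \<in> U \<Longrightarrow> Dw (i # w) f x = _\<close> \<beta>(1) 1
      by (intro exI[of _ \<gamma>]) (simp add: mi_order_eq mi_deriv_eq_Dw)
  next
    case 2
    define \<gamma> where "\<gamma> = \<beta> + axis 2 1"
    have \<gamma>: "\<gamma> $ 1 = \<beta> $ 1" "\<gamma> $ 2 = Suc (\<beta> $ 2)" by (auto simp: \<gamma>_def axis_def)
    have "Dw (i # w) f x = mi_deriv \<gamma> f x" if "x \<in> U" for x
      using 1[OF that] Dw_move[OF assms, of "\<beta> $ 1" "replicate (\<beta> $ 2) 2" f x 2 1] that Cons.prems len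
      unfolding 2 mi_deriv_eq_Dw \<gamma> by (simp del: Cdiff_on.simps Dw_simps(2))
    then show ?thesis using \<gamma> \<beta>(1) by (intro exI[of _ \<gamma>]) (simp add: mi_order_eq)
  qed
qed

text \<open>Descending induction on the order: a derivative that vanishes at c is bounded on the
  segment from c to x by the derivatives of the next order, at the cost of twice the distance; the 2
  counts the two partial derivatives in a directional one. This bounds all derivatives of a Taylor
  remainder at once.\<close>

lemma remainder_bound:
  assumes "open U" "convex U" "c \<in> U" "Cdiff_on n U R"
    "\<And>w. length w < n \<Longrightarrow> Dw w R c = 0" "\<And>w x. length w = n \<Longrightarrow> x \<in> U \<Longrightarrow> \<bar>Dw w R x\<bar> \<le> N" "0 \<le> N"
  shows "length w \<le> n \<Longrightarrow> x \<in> U \<Longrightarrow> \<bar>Dw w R x\<bar> \<le> (2 * dist x c) ^ (n - length w) * N"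
proof (induction "n - length w" arbitrary: w x)
  case 0
  then show ?case using assms(6)[of w x] by simp
next
  case (Suc m)
  then have lw: "length w < n" "n - length w = Suc m" by auto
  define d where "d = x - c"
  have seg: "c + t *\<^sub>R d \<in> U" if "t \<in> {0..1}" for t
  proof -
    have "(1 - t) *\<^sub>R c + t *\<^sub>R x \<in> U" using assms(2,3) Suc.prems(2) that unfolding convex_alt by auto
    then show ?thesis by (simp add: d_def algebra_simps)
  qed
  have "Cdiff_on (Suc m) U (Dw w R)"
  proof (rule Cdiff_on_Dw)
    have "length w + Suc m = n" using lw by simp
    then show "Cdiff_on (length w + Suc m) U R" using assms(4) by (simp only:)
  qed
  then have "((\<lambda>s. Dw w R (c + s *\<^sub>R d)) has_real_derivative (\<Sum>i\<in>UNIV. d $ i * Dw (i # w) R (c + s *\<^sub>R d))) (at s within {0..1})"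
    if "s \<in> {0..1}" for s
    using seg[OF that] unfolding Dw_simps
    by (intro has_field_derivative_at_within[OF DERIV_line]) auto
  moreover have "\<bar>\<Sum>i\<in>UNIV. d $ i * Dw (i # w) R (c + s *\<^sub>R d)\<bar> \<le> (2 * dist x c) ^ Suc m * N" if s: "s \<in> {0..1}" for s
  proof -
    have "dist (c + s *\<^sub>R d) c \<le> dist x c" using s by (simp add: dist_norm d_def mult_left_le_one_le)
    then have *: "\<bar>Dw (i # w) R (c + s *\<^sub>R d)\<bar> \<le> (2 * dist x c) ^ m * N" for i
    proof -
      have len: "m = n - length (i # w)" "length (i # w) \<le> n" using lw by auto
      have "\<bar>Dw (i # w) R (c + s *\<^sub>R d)\<bar> \<le> (2 * dist (c + s *\<^sub>R d) c) ^ m * N"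
        using Suc.hyps(1)[OF len seg[OF s]] unfolding len(1)[symmetric] .
      also have "\<dots> \<le> (2 * dist x c) ^ m * N"
        using \<open>dist (c + s *\<^sub>R d) c \<le> dist x c\<close> assms(7) by (intro mult_right_mono power_mono) auto
      finally show ?thesis .
    qed
    have "\<bar>\<Sum>i\<in>UNIV. d $ i * Dw (i # w) R (c + s *\<^sub>R d)\<bar> \<le> (\<Sum>i\<in>(UNIV::2 set). dist x c * ((2 * dist x c) ^ m * N))"
      using * component_le_norm_cart[of d]
      by (intro order_trans[OF sum_abs] sum_mono) (auto simp: abs_mult d_def dist_norm intro!: mult_mono simp del: Dw_simps)
    then show ?thesis by (simp add: sum_2)
  qed
  ultimately have "\<bar>Dw w R (c + 1 *\<^sub>R d) - Dw w R (c + 0 *\<^sub>R d)\<bar> \<le> (2 * dist x c) ^ Suc m * N * \<bar>1 - 0\<bar>"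
    using field_differentiable_bound[of "{0..1}" "\<lambda>s. Dw w R (c + s *\<^sub>R d)" "\<lambda>s. \<Sum>i\<in>UNIV. d $ i * Dw (i # w) R (c + s *\<^sub>R d)"
        "(2 * dist x c) ^ Suc m * N" 1 0]
    by (simp only: real_norm_def convex_real_interval) simp
  then show ?case using assms(5)[OF lw(1)] lw(2) by (simp add: d_def)
qed

lemma monom2_zero: "monom2 \<alpha> 0 = (if \<alpha> = 0 then 1 else 0)"
  by (auto simp: monom2_eq vec_eq_iff forall_2 power_0_left)

lemma partial_monom2_shift:
  "partial i (\<lambda>x. K * monom2 \<alpha> (x - c)) = (\<lambda>x. K * real (\<alpha> $ i) * monom2 (\<alpha> - axis i 1) (x - c))"
proof (rule ext)
  fix x
  have p: "poly_deg_le (mi_order \<alpha>) (monom2 \<alpha>)" by (simp add: poly_deg_le_eq mi_span_basis)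
  have "((\<lambda>x. x - c) has_derivative (\<lambda>d. d)) (at x)"
    by (auto intro!: derivative_eq_intros)
  from has_derivative_compose[OF this Cdiff_on_Suc_derivative[OF Cdiff_on_poly[OF p, of "Suc 0"]]]
  have "((\<lambda>x. K * monom2 \<alpha> (x - c)) has_derivative
      (\<lambda>d. K * (\<Sum>i\<in>UNIV. d $ i * partial i (monom2 \<alpha>) (x - c)))) (at x)"
    by (intro has_derivative_mult_right) auto
  from partial_eq[OF this]
  show "partial i (\<lambda>x. K * monom2 \<alpha> (x - c)) x = K * real (\<alpha> $ i) * monom2 (\<alpha> - axis i 1) (x - c)"
    by (simp add: axis_sum partial_monom2)
qed

text \<open>Truncated subtraction does no harm: once n exceeds \<open>\<alpha> $ i\<close>, the
  product contains the factor 0.\<close>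

lemma funpow_partial_monom2:
  "(partial i ^^ n) (\<lambda>x. K * monom2 \<alpha> (x - c)) = (\<lambda>x. K * (\<Prod>j<n. real (\<alpha> $ i - j)) * monom2 (\<alpha> - axis i n) (x - c))"
proof (induction n)
  case 0
  have "\<alpha> - axis i 0 = \<alpha>" by (simp add: vec_eq_iff axis_def)
  then show ?case by simp
next
  case (Suc n)
  have "\<alpha> - axis i n - axis i 1 = \<alpha> - axis i (Suc n)" by (simp add: vec_eq_iff axis_def)
  moreover have "(\<alpha> - axis i n) $ i = \<alpha> $ i - n" by (simp add: axis_def)
  ultimately show ?case unfolding funpow.simps comp_def Suc partial_monom2_shift by (simp add: mult.assoc)
qed

lemma mi_deriv_monom2:
  "mi_deriv \<gamma> (\<lambda>x. monom2 \<alpha> (x - c)) c = (if \<gamma> = \<alpha> then fact (\<alpha> $ 1) * fact (\<alpha> $ 2) else 0)"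
proof -
  define \<delta> where "\<delta> = \<alpha> - axis 2 (\<gamma> $ 2) - axis 1 (\<gamma> $ 1)"
  have "mi_deriv \<gamma> (\<lambda>x. 1 * monom2 \<alpha> (x - c)) c =
    (\<Prod>j<\<gamma> $ 2. real (\<alpha> $ 2 - j)) * (\<Prod>j<\<gamma> $ 1. real (\<alpha> $ 1 - j)) * monom2 \<delta> 0"
    unfolding mi_deriv_def funpow_partial_monom2 by (simp add: \<delta>_def axis_def)
  moreover have "\<delta> = 0 \<longleftrightarrow> \<alpha> $ 1 \<le> \<gamma> $ 1 \<and> \<alpha> $ 2 \<le> \<gamma> $ 2"
    by (auto simp: \<delta>_def vec_eq_iff forall_2 axis_def)
  moreover have "(\<Prod>j<n. real (m - j)) = 0" if "m < n" for m n :: nat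
    using that by (intro prod_zero) (auto intro!: bexI[of _ m])
  moreover have "(\<Prod>j<n. real (n - j)) = fact n" for n
    using fact_prod_rev[of n, where 'a=real] by (simp add: lessThan_atLeast0)
  ultimately show ?thesis
    by (auto simp: monom2_zero vec_eq_iff forall_2)
qed

definition taylor_poly :: "nat \<Rightarrow> real^2 \<Rightarrow> (real^2 \<Rightarrow> real) \<Rightarrow> real^2 \<Rightarrow> real" where
  "taylor_poly m c f x = (\<Sum>\<alpha>\<in>{\<alpha>. mi_order \<alpha> \<le> m}. mi_deriv \<alpha> f c / (fact (\<alpha> $ 1) * fact (\<alpha> $ 2)) * monom2 \<alpha> (x - c))"

lemma poly_monom2_shift: "mi_order \<alpha> \<le> m \<Longrightarrow> poly_deg_le m (\<lambda>x. monom2 \<alpha> (x - c))"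
  using poly_deg_le_affine_comp[of m "monom2 \<alpha>" "\<lambda>x. x" "- c"] by (simp add: poly_deg_le_eq mi_span_basis linear_id[unfolded id_def])

lemma poly_taylor_poly: "poly_deg_le m (taylor_poly m c f)"
  unfolding taylor_poly_def[abs_def] by (intro poly_deg_le_lincomb poly_monom2_shift) auto

lemma mi_deriv_taylor_poly:
  assumes "mi_order \<gamma> \<le> m"
  shows "mi_deriv \<gamma> (taylor_poly m c f) c = mi_deriv \<gamma> f c"
proof -
  have "mi_deriv \<gamma> (taylor_poly m c f) c = (\<Sum>\<alpha>\<in>{\<alpha>. mi_order \<alpha> \<le> m}. mi_deriv \<alpha> f c / (fact (\<alpha> $ 1) * fact (\<alpha> $ 2)) * mi_deriv \<gamma> (\<lambda>x. monom2 \<alpha> (x - c)) c)"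
    unfolding taylor_poly_def[abs_def] mi_deriv_eq_Dw
    by (rule Dw_lincomb[OF open_UNIV]) (auto intro!: Cdiff_on_poly poly_monom2_shift)
  also have "\<dots> = (\<Sum>\<alpha>\<in>{\<alpha>. mi_order \<alpha> \<le> m}. if \<gamma> = \<alpha> then mi_deriv \<gamma> f c else 0)"
    by (intro sum.cong) (auto simp: mi_deriv_monom2)
  also have "\<dots> = mi_deriv \<gamma> f c" using assms by (simp add: finite_mi_order_le)
  finally show ?thesis .
qed

text \<open>The difference of consecutive Taylor polynomials consists of the monomials of degree
  \<open>Suc m\<close> in x - c, and the reflection about c changes the sign of x - c.\<close>

lemma taylor_poly_odd:
  "taylor_poly (Suc m) c f (2 *\<^sub>R c - x) - taylor_poly m c f (2 *\<^sub>R c - x) =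
    (- 1) ^ Suc m * (taylor_poly (Suc m) c f x - taylor_poly m c f x)"
proof -
  let ?t = "\<lambda>\<alpha> x. mi_deriv \<alpha> f c / (fact (\<alpha> $ 1) * fact (\<alpha> $ 2)) * monom2 \<alpha> (x - c)"
  have eq: "taylor_poly (Suc m) c f x - taylor_poly m c f x = (\<Sum>\<alpha>\<in>{\<alpha>. mi_order \<alpha> = Suc m}. ?t \<alpha> x)" for x
  proof -
    have "{\<alpha>. mi_order \<alpha> \<le> Suc m} = {\<alpha>. mi_order \<alpha> \<le> m} \<union> {\<alpha>. mi_order \<alpha> = Suc m}" by auto
    moreover have "finite {\<alpha>. mi_order \<alpha> = Suc m}" by (rule finite_subset[OF _ finite_mi_order_le[of "Suc m"]]) auto
    ultimately have "taylor_poly (Suc m) c f x = taylor_poly m c f x + (\<Sum>\<alpha>\<in>{\<alpha>. mi_order \<alpha> = Suc m}. ?t \<alpha> x)"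
      unfolding taylor_poly_def by (simp only:) (rule sum.union_disjoint, auto simp: finite_mi_order_le)
    then show ?thesis by simp
  qed
  have "monom2 \<alpha> (2 *\<^sub>R c - x - c) = (- 1) ^ Suc m * monom2 \<alpha> (x - c)" if "mi_order \<alpha> = Suc m" for \<alpha>
  proof -
    have "(2 *\<^sub>R c - x - c) $ i = - ((x - c) $ i)" for i by simp
    then have "monom2 \<alpha> (2 *\<^sub>R c - x - c) = (- 1) ^ mi_order \<alpha> * monom2 \<alpha> (x - c)"
      unfolding monom2_eq mi_order_eq power_add
      by (simp only: power_minus[of "(x - c) $ _"] mult_ac)
    then show ?thesis using that by simp
  qed
  then show ?thesis unfolding eq sum_distrib_left by (intro sum.cong) (auto simp del: power_Suc)
qed

text \<open>A supremum of reals is informative only for a bounded set; here the continuous extension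
  of each derivative to the compact \<Omega> provides the bound. The other suprema are nonnegative,
  so the sum dominates each term.\<close>

lemma Cm_norm_upper:
  assumes "compact \<Omega>" "f \<in> Cm_space m \<Omega>" "mi_order \<beta> \<le> m" "x \<in> interior \<Omega>"
  shows "\<bar>mi_deriv \<beta> f x\<bar> \<le> Cm_norm m \<Omega> f"
proof -
  have bdd: "bdd_above ((\<lambda>x. \<bar>mi_deriv \<gamma> f x\<bar>) ` interior \<Omega>)" if "mi_order \<gamma> \<le> m" for \<gamma>
  proof -
    have "\<exists>G. continuous_on \<Omega> G \<and> (\<forall>x\<in>interior \<Omega>. G x = mi_deriv \<gamma> f x)"
      using assms(2) that by (simp add: Cm_space_def)
    then obtain G where G: "continuous_on \<Omega> G" "\<forall>x\<in>interior \<Omega>. G x = mi_deriv \<gamma> f x" by auto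
    have "bounded (G ` \<Omega>)" using G(1) assms(1) by (intro compact_imp_bounded compact_continuous_image)
    then obtain B where "\<And>x. x \<in> \<Omega> \<Longrightarrow> \<bar>G x\<bar> \<le> B" by (auto simp: bounded_iff)
    then have B: "\<bar>mi_deriv \<gamma> f x\<bar> \<le> B" if "x \<in> interior \<Omega>" for x
      using bspec[OF G(2) that] that interior_subset[of \<Omega>] by force
    show ?thesis by (rule bdd_aboveI2[of _ _ B]) (rule B)
  qed
  have "\<bar>mi_deriv \<beta> f x\<bar> \<le> (SUP x\<in>interior \<Omega>. \<bar>mi_deriv \<beta> f x\<bar>)"
    using bdd[OF assms(3)] assms(4) by (rule cSUP_upper[rotated])
  also have "\<dots> \<le> Cm_norm m \<Omega> f"
    unfolding Cm_norm_def
  proof (rule member_le_sum)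
    show "0 \<le> (SUP x\<in>interior \<Omega>. \<bar>mi_deriv \<gamma> f x\<bar>)" if "\<gamma> \<in> {\<beta>. mi_order \<beta> \<le> m} - {\<beta>}" for \<gamma>
      using bdd[of \<gamma>] assms(4) that by (intro cSUP_upper2[of _ _ x]) auto
  qed (use assms(3) finite_mi_order_le in auto)
  finally show ?thesis .
qed

text \<open>The derivatives of the remainder vanish at c up to order m, and those of order
  \<open>Suc m\<close> are the ones of f. The last part reaches the boundary by continuity: Lagrange
  nodes can lie on the boundary of \<Omega>, where only the values of f itself are
  available.\<close>

lemma taylor_remainder:
  assumes \<Omega>: "compact \<Omega>" "convex \<Omega>" and f: "f \<in> Cm_space n \<Omega>" and "m < n" and c: "c \<in> interior \<Omega>"
  defines "R \<equiv> \<lambda>x. f x - taylor_poly m c f x"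
  shows "Cdiff_on (Suc m) (interior \<Omega>) R"
    "\<And>w x. length w \<le> Suc m \<Longrightarrow> x \<in> interior \<Omega> \<Longrightarrow> \<bar>Dw w R x\<bar> \<le> (2 * dist x c) ^ (Suc m - length w) * Cm_norm n \<Omega> f"
    "\<And>x. x \<in> \<Omega> \<Longrightarrow> \<bar>R x\<bar> \<le> (2 * dist x c) ^ Suc m * Cm_norm n \<Omega> f"
proof -
  let ?U = "interior \<Omega>"
  let ?N = "Cm_norm n \<Omega> f"
  have U: "open ?U" "convex ?U" using \<Omega> by (auto intro: convex_interior)
  have Cf: "Cdiff_on l ?U f" if "l \<le> n" for l
    using f that by (auto simp: Cm_space_def intro: Cdiff_on_le)
  have P: "Cdiff_on l UNIV (taylor_poly m c f)" for l by (rule Cdiff_on_poly[OF poly_taylor_poly])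
  then have P': "Cdiff_on l ?U (taylor_poly m c f)" for l by (rule Cdiff_on_subset) simp
  have N: "\<bar>mi_deriv \<beta> f x\<bar> \<le> ?N" if "mi_order \<beta> \<le> n" "x \<in> ?U" for \<beta> x
    using Cm_norm_upper[OF \<Omega>(1) f] that by blast
  have "0 \<le> ?N" using N[of 0 c] c by (simp add: mi_order_eq)
  have "Cdiff_on (Suc m) ?U (\<lambda>x. f x + (- 1) * taylor_poly m c f x)"
    by (intro Cdiff_on_add Cdiff_on_mult Cdiff_on_const Cf P' U) (use \<open>m < n\<close> in auto)
  then show R: "Cdiff_on (Suc m) ?U R" by (simp only: R_def mult_minus1 add_uminus_conv_diff)
  have DwR: "Dw w R x = Dw w f x - Dw w (taylor_poly m c f) x" if "length w \<le> Suc m" "x \<in> ?U" for w x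
    unfolding R_def by (rule Dw_diff[OF U(1) Cf P' that(2)]) (use that \<open>m < n\<close> in auto)
  show bound: "\<bar>Dw w R x\<bar> \<le> (2 * dist x c) ^ (Suc m - length w) * ?N"
    if "length w \<le> Suc m" "x \<in> ?U" for w x
  proof (rule remainder_bound[OF U c R _ _ \<open>0 \<le> ?N\<close> that])
    fix w :: "2 list" assume w: "length w < Suc m"
    obtain \<beta> where \<beta>: "mi_order \<beta> = length w" "\<And>x. x \<in> ?U \<Longrightarrow> Dw w R x = mi_deriv \<beta> R x"
      using Dw_eq_mi_deriv[OF U(1), of w R] Cdiff_on_le[OF R, of "length w"] w by auto
    have "mi_deriv \<beta> R c = mi_deriv \<beta> f c - mi_deriv \<beta> (taylor_poly m c f) c"
      using DwR[of "replicate (\<beta> $ 1) 1 @ replicate (\<beta> $ 2) 2" c] \<beta>(1) w c by (simp add: mi_deriv_eq_Dw mi_order_eq)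
    then show "Dw w R c = 0" using mi_deriv_taylor_poly[of \<beta> m c f] \<beta> w c by simp
  next
    fix w :: "2 list" and x assume w: "length w = Suc m" "x \<in> ?U"
    obtain \<beta> where \<beta>: "mi_order \<beta> = length w" "\<And>x. x \<in> ?U \<Longrightarrow> Dw w f x = mi_deriv \<beta> f x"
      using Dw_eq_mi_deriv[OF U(1), of w f] Cf[of "length w"] w \<open>m < n\<close> by auto
    have "Dw w R x = mi_deriv \<beta> f x"
      using DwR[of w x] Dw_poly_eq_0[OF poly_taylor_poly, of m w c f] \<beta>(2) w by simp
    then show "\<bar>Dw w R x\<bar> \<le> ?N" using N[of \<beta> x] \<beta>(1) w \<open>m < n\<close> by simp
  qed
  fix x assume x: "x \<in> \<Omega>"
  have cl: "closure ?U = \<Omega>"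
    using \<Omega> c by (subst convex_closure_interior) (auto simp: compact_imp_closed)
  have "continuous_on \<Omega> f" using f by (simp add: Cm_space_def)
  moreover have "continuous_on \<Omega> (taylor_poly m c f)" using P[of 0] by (auto intro: continuous_on_subset)
  ultimately have "continuous_on (closure ?U) (\<lambda>x. \<bar>R x\<bar> - (2 * dist x c) ^ Suc m * ?N)"
    unfolding cl R_def by (intro continuous_intros)
  then have "\<bar>R x\<bar> - (2 * dist x c) ^ Suc m * ?N \<le> 0"
    by (rule continuous_le_on_closure) (use bound[of "[]"] x cl in auto)
  then show "\<bar>R x\<bar> \<le> (2 * dist x c) ^ Suc m * ?N" by simp
qed

subsection \<open>Error estimates\<close>

text \<open>The remainder has size \<open>h ^ Suc m\<close> at the nodes, and by stability each
  derivative of its interpolant loses one power of h, as does each derivative of the remainder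
  itself. The centre c may lie outside T.\<close>

lemma element_error_remainder:
  assumes "k \<ge> 1" "0 < \<kappa>" "\<kappa> \<le> 1"
  obtains C where "0 \<le> C"
    "\<And>\<Omega> f T F y c h m w x. compact \<Omega> \<Longrightarrow> convex \<Omega> \<Longrightarrow> f \<in> Cm_space (k + 2) \<Omega> \<Longrightarrow> c \<in> interior \<Omega> \<Longrightarrow>
      reference_map T F \<Longrightarrow> T \<subseteq> \<Omega> \<Longrightarrow> T \<subseteq> cball c h \<Longrightarrow> cball y (\<kappa> * h) \<subseteq> T \<Longrightarrow> 0 < h \<Longrightarrow>
      m \<le> Suc k \<Longrightarrow> length w \<le> k \<Longrightarrow> length w \<le> m \<Longrightarrow> x \<in> interior T \<Longrightarrow>
      \<bar>Dw w (interp k F (\<lambda>x. f x - taylor_poly m c f x)) x - Dw w (\<lambda>x. f x - taylor_poly m c f x) x\<bar>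
        \<le> C * h ^ (Suc m - length w) * Cm_norm (k + 2) \<Omega> f"
proof -
  obtain Cs where Cs: "0 \<le> Cs" "\<And>T F y r u M w x. reference_map T F \<Longrightarrow> cball y r \<subseteq> T \<Longrightarrow> 0 < r \<Longrightarrow>
    (\<forall>z\<in>F ` node k ` {\<alpha>. mi_order \<alpha> \<le> k}. \<bar>u z\<bar> \<le> M) \<Longrightarrow> x \<in> T \<Longrightarrow> length w \<le> k \<Longrightarrow>
    \<bar>Dw w (interp k F u) x\<bar> \<le> Cs * M * (1 / r) ^ length w"
    by (rule interp_stable[OF assms(1), of k], rule that)
  define C where "C = Cs * (2 ^ (k + 2) * (1 / \<kappa>) ^ k) + 2 ^ (k + 2)"
  show ?thesis
  proof (rule that)
    show "0 \<le> C" using Cs(1) assms(2) by (simp add: C_def)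
    fix \<Omega> T :: "(real^2) set" and f :: "real^2 \<Rightarrow> real" and F :: "real^2 \<Rightarrow> real^2" and y c x :: "real^2"
      and h :: real and m :: nat and w :: "2 list"
    assume \<Omega>: "compact \<Omega>" "convex \<Omega>" and f: "f \<in> Cm_space (k + 2) \<Omega>" and c: "c \<in> interior \<Omega>"
      and F: "reference_map T F" and T: "T \<subseteq> \<Omega>" "T \<subseteq> cball c h" and y: "cball y (\<kappa> * h) \<subseteq> T" and h: "0 < h"
      and m: "m \<le> Suc k" and w: "length w \<le> k" "length w \<le> m" and x: "x \<in> interior T"
    define R where "R x = f x - taylor_poly m c f x" for x
    let ?N = "Cm_norm (k + 2) \<Omega> f"
    have "m < k + 2" using m by simp
    note R = taylor_remainder[OF \<Omega> f this c, folded R_def]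
    have N: "0 \<le> ?N"
      using Cm_norm_upper[OF \<Omega>(1) f, of 0 c] c by (simp add: mi_order_eq)
    have xT: "x \<in> T" "x \<in> interior \<Omega>" using x interior_subset interior_mono[OF T(1)] by blast+
    have d: "dist z c \<le> h" if "z \<in> T" for z using T(2) that by (auto simp: dist_commute)
    have node: "\<bar>R z\<bar> \<le> (2 * h) ^ Suc m * ?N" if "z \<in> F ` node k ` {\<alpha>. mi_order \<alpha> \<le> k}" for z
    proof -
      have z: "z \<in> T" using that reference_map_node[OF F _ assms(1)] by auto
      have "\<bar>R z\<bar> \<le> (2 * dist z c) ^ Suc m * ?N" using z T(1) by (intro R(3)) auto
      also have "\<dots> \<le> (2 * h) ^ Suc m * ?N" using d[OF z] N by (intro mult_right_mono power_mono) auto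
      finally show ?thesis .
    qed
    have "\<bar>Dw w (interp k F R) x\<bar> \<le> Cs * ((2 * h) ^ Suc m * ?N) * (1 / (\<kappa> * h)) ^ length w"
      using assms(2) h by (intro Cs(2)[OF F y _ ballI xT(1) w(1)] node) auto
    also have "\<dots> = Cs * (2 ^ Suc m * (1 / \<kappa>) ^ length w) * (h ^ Suc m / h ^ length w) * ?N"
      by (simp add: power_mult_distrib power_divide del: power_Suc)
    also have "h ^ Suc m / h ^ length w = h ^ (Suc m - length w)"
      using h w(2) by (simp add: power_diff del: power_Suc)
    also have "Cs * (2 ^ Suc m * (1 / \<kappa>) ^ length w) * h ^ (Suc m - length w) * ?N
        \<le> Cs * (2 ^ (k + 2) * (1 / \<kappa>) ^ k) * h ^ (Suc m - length w) * ?N"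
    proof (intro mult_right_mono mult_left_mono mult_mono)
      show "(2::real) ^ Suc m \<le> 2 ^ (k + 2)" using m by (intro power_increasing) auto
      show "(1 / \<kappa>) ^ length w \<le> (1 / \<kappa>) ^ k" using w(1) assms(2,3) by (intro power_increasing) auto
    qed (use Cs(1) N h assms(2) in auto)
    finally have 1: "\<bar>Dw w (interp k F R) x\<bar> \<le> Cs * (2 ^ (k + 2) * (1 / \<kappa>) ^ k) * h ^ (Suc m - length w) * ?N" .
    have "\<bar>Dw w R x\<bar> \<le> (2 * dist x c) ^ (Suc m - length w) * ?N"
      using w xT by (intro R(2)) auto
    also have "\<dots> \<le> (2 * h) ^ (Suc m - length w) * ?N"
      using d[OF xT(1)] N by (intro mult_right_mono power_mono) auto
    also have "\<dots> = 2 ^ (Suc m - length w) * h ^ (Suc m - length w) * ?N" by (simp add: power_mult_distrib)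
    also have "\<dots> \<le> 2 ^ (k + 2) * h ^ (Suc m - length w) * ?N"
      using N h m by (intro mult_right_mono power_increasing) auto
    finally have 2: "\<bar>Dw w R x\<bar> \<le> 2 ^ (k + 2) * h ^ (Suc m - length w) * ?N" .
    show "\<bar>Dw w (interp k F (\<lambda>x. f x - taylor_poly m c f x)) x - Dw w (\<lambda>x. f x - taylor_poly m c f x) x\<bar>
        \<le> C * h ^ (Suc m - length w) * ?N"
      using 1 2 unfolding R_def[abs_def] C_def distrib_right by linarith
  qed
qed

text \<open>Subtracting a Taylor polynomial changes the error only by the interpolation error of
  that polynomial. It is zero for degree k, which gives the first bound; for degree
  \<open>Suc k\<close> it is the error for the homogeneous top part, which gives the second.\<close>

lemma element_error:
  assumes "k \<ge> 1" "0 < \<kappa>" "\<kappa> \<le> 1"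
  obtains C where "0 \<le> C"
    "\<And>\<Omega> f T F y c h w x. compact \<Omega> \<Longrightarrow> convex \<Omega> \<Longrightarrow> f \<in> Cm_space (k + 2) \<Omega> \<Longrightarrow> c \<in> interior \<Omega> \<Longrightarrow>
      reference_map T F \<Longrightarrow> T \<subseteq> \<Omega> \<Longrightarrow> T \<subseteq> cball c h \<Longrightarrow> cball y (\<kappa> * h) \<subseteq> T \<Longrightarrow> 0 < h \<Longrightarrow>
      length w \<le> k \<Longrightarrow> x \<in> interior T \<Longrightarrow>
      \<bar>Dw w (interp k F f) x - Dw w f x\<bar> \<le> C * h ^ (Suc k - length w) * Cm_norm (k + 2) \<Omega> f \<and>
      \<bar>(Dw w (interp k F f) x - Dw w f x) - Dw w (\<lambda>x. interp k F (\<lambda>x. taylor_poly (Suc k) c f x - taylor_poly k c f x) x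
        - (taylor_poly (Suc k) c f x - taylor_poly k c f x)) x\<bar>
        \<le> C * h ^ (Suc (Suc k) - length w) * Cm_norm (k + 2) \<Omega> f"
proof -
  obtain C where C: "0 \<le> C"
    "\<And>\<Omega> f T F y c h m w x. compact \<Omega> \<Longrightarrow> convex \<Omega> \<Longrightarrow> f \<in> Cm_space (k + 2) \<Omega> \<Longrightarrow> c \<in> interior \<Omega> \<Longrightarrow>
      reference_map T F \<Longrightarrow> T \<subseteq> \<Omega> \<Longrightarrow> T \<subseteq> cball c h \<Longrightarrow> cball y (\<kappa> * h) \<subseteq> T \<Longrightarrow> 0 < h \<Longrightarrow>
      m \<le> Suc k \<Longrightarrow> length w \<le> k \<Longrightarrow> length w \<le> m \<Longrightarrow> x \<in> interior T \<Longrightarrow>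
      \<bar>Dw w (interp k F (\<lambda>x. f x - taylor_poly m c f x)) x - Dw w (\<lambda>x. f x - taylor_poly m c f x) x\<bar>
        \<le> C * h ^ (Suc m - length w) * Cm_norm (k + 2) \<Omega> f"
    by (rule element_error_remainder[OF assms], rule that)
  show ?thesis
  proof (rule that[OF C(1)])
    fix \<Omega> T :: "(real^2) set" and f :: "real^2 \<Rightarrow> real" and F :: "real^2 \<Rightarrow> real^2" and y c x :: "real^2"
      and h :: real and w :: "2 list"
    assume \<Omega>: "compact \<Omega>" "convex \<Omega>" and f: "f \<in> Cm_space (k + 2) \<Omega>" and c: "c \<in> interior \<Omega>"
      and F: "reference_map T F" and T: "T \<subseteq> \<Omega>" "T \<subseteq> cball c h" and y: "cball y (\<kappa> * h) \<subseteq> T" and h: "0 < h"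
      and w: "length w \<le> k" and x: "x \<in> interior T"
    let ?P = "\<lambda>m. taylor_poly m c f"
    define q where "q x = ?P (Suc k) x - ?P k x" for x
    have xO: "x \<in> interior \<Omega>" using x interior_mono[OF T(1)] by blast
    have Cf: "Cdiff_on (length w) (interior \<Omega>) f" using f w Cdiff_on_le[of "k + 2" "interior \<Omega>" f "length w"]
      by (simp add: Cm_space_def del: Cdiff_on.simps)
    have CP: "Cdiff_on l UNIV (?P m)" "Cdiff_on l (interior \<Omega>) (?P m)" for l m
      using Cdiff_on_poly[OF poly_taylor_poly, of l m c f] Cdiff_on_subset[of l UNIV "?P m" "interior \<Omega>"] by auto
    have CI: "Cdiff_on l UNIV (interp k F u)" for l u by (rule Cdiff_on_poly[OF interp_poly[OF assms(1) F]])
    have e: "Dw w (interp k F (\<lambda>x. f x - ?P m x)) x - Dw w (\<lambda>x. f x - ?P m x) x =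
        (Dw w (interp k F f) x - Dw w f x) - (Dw w (interp k F (?P m)) x - Dw w (?P m) x)" for m
    proof -
      have "Dw w (interp k F (\<lambda>x. f x - ?P m x)) x = Dw w (interp k F f) x - Dw w (interp k F (?P m)) x"
        unfolding interp_diff[OF assms(1), abs_def] by (rule Dw_diff[OF open_UNIV CI CI]) simp
      moreover have "Dw w (\<lambda>x. f x - ?P m x) x = Dw w f x - Dw w (?P m) x"
        by (rule Dw_diff[OF open_interior Cf CP(2) xO])
      ultimately show ?thesis by simp
    qed
    have rep: "interp k F (?P k) = ?P k" by (rule interp_poly_eq[OF assms(1) F poly_taylor_poly])
    have "Dw w (interp k F (?P (Suc k))) x - Dw w (?P (Suc k)) x = Dw w (\<lambda>x. interp k F (?P (Suc k)) x - ?P (Suc k) x) x"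
      by (rule Dw_diff[OF open_UNIV CI CP(1), symmetric]) simp
    also have "(\<lambda>x. interp k F (?P (Suc k)) x - ?P (Suc k) x) = (\<lambda>x. interp k F q x - q x)"
      unfolding q_def[abs_def] interp_diff[OF assms(1)] rep by simp
    finally have e2: "Dw w (interp k F (?P (Suc k))) x - Dw w (?P (Suc k)) x = Dw w (\<lambda>x. interp k F q x - q x) x" .
    note B = C(2)[OF \<Omega> f c F T y h _ w _ x, unfolded e]
    show "\<bar>Dw w (interp k F f) x - Dw w f x\<bar> \<le> C * h ^ (Suc k - length w) * Cm_norm (k + 2) \<Omega> f \<and>
      \<bar>(Dw w (interp k F f) x - Dw w f x) - Dw w (\<lambda>x. interp k F (\<lambda>x. ?P (Suc k) x - ?P k x) x
        - (?P (Suc k) x - ?P k x)) x\<bar> \<le> C * h ^ (Suc (Suc k) - length w) * Cm_norm (k + 2) \<Omega> f"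
      using B[of k] B[of "Suc k"] w unfolding rep e2 q_def by simp
  qed
qed

section \<open>Poincare estimate for symmetric pairs and finite overlap\<close>

lemma measure_ball_plane:
  "0 \<le> r \<Longrightarrow> measure lebesgue (ball (x::real^2) r) = pi * r\<^sup>2"
  "0 \<le> r \<Longrightarrow> measure lebesgue (cball (x::real^2) r) = pi * r\<^sup>2"
  using content_ball[of r x] content_cball[of r x] by (simp_all add: unit_ball_vol_2)

text \<open>The mean of \<open>\<psi>\<close> vanishes because \<open>\<psi>\<close> is odd about \<open>c\<close>, so the dual Poincare inequality
  applies on \<open>ball c h \<inter> interior \<Omega>\<close>. Working there rather than on the two triangles is essential:
  they only share a point, so their union admits no Poincare inequality.\<close>

lemma pair_bound:
  assumes \<Omega>: "compact \<Omega>" "convex \<Omega>" and g: "g \<in> W11_space \<Omega>" and \<psi>: "admissible M \<psi>"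
    and \<kappa>: "0 < \<kappa>" "0 < h" and y: "ball y (\<kappa> * h) \<subseteq> ball c h \<inter> interior \<Omega>"
    and supp: "\<And>x. \<psi> x \<noteq> 0 \<Longrightarrow> x \<in> ball c h \<inter> interior \<Omega>"
    and odd: "\<And>x. \<psi> (2 *\<^sub>R c - x) = - \<psi> x"
  shows "\<bar>LINT x:interior \<Omega>|lebesgue. g x * \<psi> x\<bar> \<le>
    8 / \<kappa>\<^sup>2 * h * M * (\<Sum>i\<in>UNIV. LINT x:ball c h \<inter> interior \<Omega>|lebesgue. \<bar>weak_partial (interior \<Omega>) i g x\<bar>)"
proof -
  define U where "U = ball c h \<inter> interior \<Omega>"
  have U: "open U" "convex U" "bounded U" "U \<subseteq> interior \<Omega>"
    using \<Omega> by (auto simp: U_def intro!: convex_Int convex_interior bounded_Int)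
  have [measurable]: "\<psi> \<in> borel_measurable borel" using \<psi> by (simp add: admissible_def)
  have M: "\<bar>\<psi> x\<bar> \<le> M" for x using \<psi> by (simp add: admissible_def)
  have "0 \<le> M" using M[of 0] by linarith
  have ind: "indicator U x * \<psi> x = \<psi> x" "indicator (interior \<Omega>) x * \<psi> x = \<psi> x" for x
    using supp[of x] by (auto simp: indicator_def U_def)
  have "(LINT x|lborel. \<psi> x) = (LINT x|lborel. \<psi> (2 *\<^sub>R c - x))"
    by (rule lborel_integral_reflect[symmetric]) measurable
  also have "\<dots> = - (LINT x|lborel. \<psi> x)" by (simp add: odd)
  finally have "(LINT x|lborel. \<psi> x) = 0" by simp
  moreover have "(LINT x:U|lebesgue. \<psi> x) = (LINT x|lebesgue. \<psi> x)"
    by (simp add: set_lebesgue_integral_def ind)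
  moreover have "(LINT x|lebesgue. \<psi> x) = (LINT x|lborel. \<psi> x)"
    by (rule integral_completion) measurable
  ultimately have mean: "(LINT x:U|lebesgue. \<psi> x) = 0" by simp
  have g': "set_integrable lebesgue (interior \<Omega>) g" using g by (simp add: W11_space_def)
  let ?W = "\<Sum>i\<in>UNIV. LINT x:U|lebesgue. \<bar>weak_partial (interior \<Omega>) i g x\<bar>"
  have P: "measure lebesgue U * \<bar>LINT x:U|lebesgue. g x * \<psi> x\<bar> \<le> measure lebesgue (cball (0::real^2) (2 * h)) * (M * (2 * h) * ?W)"
  proof (rule weak_poincare[OF U(1-3)])
    show "set_integrable lebesgue U g" using U by (intro set_integrable_subset[OF g']) auto
    show "has_weak_partial U i g (weak_partial (interior \<Omega>) i g)" for i
      using U by (intro has_weak_partial_subset[OF W11_space_weak_partial[OF g]])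
    show "dist x z \<le> 2 * h" if "x \<in> U" "z \<in> U" for x z
      using dist_triangle3[of x z c] that by (auto simp: U_def)
    show "AE x in lebesgue. isCont \<psi> x" using \<psi> by (simp add: admissible_def)
  qed (use \<kappa> M mean in auto)
  have U_ge: "pi * (\<kappa> * h)\<^sup>2 \<le> measure lebesgue U"
  proof -
    have "measure lebesgue (ball y (\<kappa> * h)) \<le> measure lebesgue U"
      using y U by (intro measure_mono_fmeasurable) (auto simp: U_def intro: bounded_set_imp_lmeasurable)
    then show ?thesis using measure_ball_plane(1)[of "\<kappa> * h" y] \<kappa> by simp
  qed
  have ball_eq: "measure lebesgue (cball (0::real^2) (2 * h)) = pi * (2 * h)\<^sup>2"
    using measure_ball_plane(2)[of "2 * h" 0] \<kappa> by simp
  \<comment> \<open>The constant \<open>8 / \<kappa>\<^sup>2\<close> is the ratio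
    \<open>4 / \<kappa>\<^sup>2\<close> of the two ball areas times the 2 in the diameter bound
    \<open>2 * h\<close>.\<close>
  have "pi * (\<kappa> * h)\<^sup>2 * \<bar>LINT x:U|lebesgue. g x * \<psi> x\<bar> \<le> pi * (2 * h)\<^sup>2 * (M * (2 * h) * ?W)"
    using mult_right_mono[OF U_ge abs_ge_zero[of "LINT x:U|lebesgue. g x * \<psi> x"]] P[unfolded ball_eq]
    by linarith
  then have "(pi * h\<^sup>2) * (\<kappa>\<^sup>2 * \<bar>LINT x:U|lebesgue. g x * \<psi> x\<bar>) \<le> (pi * h\<^sup>2) * (8 * h * M * ?W)"
    by (simp add: power_mult_distrib mult_ac)
  then have "\<kappa>\<^sup>2 * \<bar>LINT x:U|lebesgue. g x * \<psi> x\<bar> \<le> 8 * h * M * ?W"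
    using \<kappa> by (subst (asm) mult_le_cancel_left_pos) auto
  then have "\<bar>LINT x:U|lebesgue. g x * \<psi> x\<bar> \<le> 8 / \<kappa>\<^sup>2 * h * M * ?W"
    using \<kappa> by (simp add: field_simps)
  moreover have "(LINT x:U|lebesgue. g x * \<psi> x) = (LINT x:interior \<Omega>|lebesgue. g x * \<psi> x)"
    unfolding set_lebesgue_integral_def
    by (rule Bochner_Integration.integral_cong) (simp_all add: ind mult.left_commute[of "indicator _ _"])
  ultimately show ?thesis by (simp add: U_def)
qed

text \<open>Area packing: the small balls of those indices whose large ball contains x are disjoint
  and lie in the ball of radius \<open>2 * h\<close> about x, so there are at most
  \<open>4 / \<kappa>\<^sup>2\<close> of them. The local norms of all pairs thus sum to a multiple
  of one global norm.\<close>

lemma overlap_bound: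
  fixes c y :: "'i \<Rightarrow> real^2"
  assumes "finite I" "0 < \<kappa>" "0 < h"
    and disj: "\<And>i j. i \<in> I \<Longrightarrow> j \<in> I \<Longrightarrow> i \<noteq> j \<Longrightarrow> ball (y i) (\<kappa> * h) \<inter> ball (y j) (\<kappa> * h) = {}"
    and sub: "\<And>i. i \<in> I \<Longrightarrow> ball (y i) (\<kappa> * h) \<subseteq> ball (c i) h"
    and v: "set_integrable lebesgue U v" "open U"
  shows "(\<Sum>i\<in>I. LINT x:ball (c i) h \<inter> U|lebesgue. \<bar>v x\<bar>) \<le> 4 / \<kappa>\<^sup>2 * (LINT x:U|lebesgue. \<bar>v x\<bar>)"
proof -
  define V where "V x = \<bar>indicator U x * v x\<bar>" for x
  have V: "integrable lebesgue V" using v(1) unfolding V_def[abs_def] by (auto simp: set_integrable_def)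
  have eq: "(LINT x:ball (c i) h \<inter> U|lebesgue. \<bar>v x\<bar>) = (LINT x|lebesgue. V x * indicator (ball (c i) h) x)" for i
    unfolding set_lebesgue_integral_def by (rule Bochner_Integration.integral_cong) (auto simp: V_def indicator_def)
  have int: "integrable lebesgue (\<lambda>x. V x * indicator (ball (c i) h) x)" for i
    by (rule integrable_mult_bounded[OF V, where B=1]) (auto intro!: borel_measurable_indicator)
  have count: "(\<Sum>i\<in>I. indicator (ball (c i) h) x) \<le> 4 / \<kappa>\<^sup>2" for x :: "real^2"
  proof -
    define J where "J = {i\<in>I. x \<in> ball (c i) h}"
    have J: "finite J" "J \<subseteq> I" using assms(1) by (auto simp: J_def)
    have *: "ball (y i) (\<kappa> * h) \<subseteq> cball x (2 * h)" if "i \<in> J" for i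
    proof
      fix z assume "z \<in> ball (y i) (\<kappa> * h)"
      then have "z \<in> ball (c i) h" using sub[of i] that by (auto simp: J_def)
      then show "z \<in> cball x (2 * h)" using dist_triangle3[of x z "c i"] that by (auto simp: J_def)
    qed
    have "real (card J) * (pi * (\<kappa> * h)\<^sup>2) = (\<Sum>i\<in>J. measure lebesgue (ball (y i) (\<kappa> * h)))"
      using assms(2,3) measure_ball_plane(1)[of "\<kappa> * h"] by simp
    also have "\<dots> = measure lebesgue (\<Union>i\<in>J. ball (y i) (\<kappa> * h))"
    proof (rule measure_finite_Union[symmetric])
      show "disjoint_family_on (\<lambda>i. ball (y i) (\<kappa> * h)) J"
        unfolding disjoint_family_on_def using disj J(2) by blast
      show "emeasure lebesgue (ball (y i) (\<kappa> * h)) \<noteq> \<infinity>" for i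
        using emeasure_lborel_ball_finite[of "y i" "\<kappa> * h"] by auto
    qed (use J in auto)
    also have "\<dots> \<le> measure lebesgue (cball x (2 * h))"
      using * J(1) by (intro measure_mono_fmeasurable) auto
    also have "\<dots> = pi * (2 * h)\<^sup>2" using measure_ball_plane(2)[of "2 * h" x] assms(3) by simp
    finally have "(pi * h\<^sup>2) * (\<kappa>\<^sup>2 * real (card J)) \<le> (pi * h\<^sup>2) * 4" by (simp add: power_mult_distrib mult_ac)
    then have "\<kappa>\<^sup>2 * real (card J) \<le> 4" using assms(3) by (subst (asm) mult_le_cancel_left_pos) auto
    then have "real (card J) \<le> 4 / \<kappa>\<^sup>2" using assms(2) by (simp add: field_simps)
    also have "real (card J) = (\<Sum>i\<in>I. indicator (ball (c i) h) x)"
      using assms(1) by (simp add: J_def indicator_def sum.If_cases Int_def)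
    finally show ?thesis .
  qed
  have "(\<Sum>i\<in>I. LINT x:ball (c i) h \<inter> U|lebesgue. \<bar>v x\<bar>) = (LINT x|lebesgue. V x * (\<Sum>i\<in>I. indicator (ball (c i) h) x))"
    unfolding eq sum_distrib_left by (rule Bochner_Integration.integral_sum[symmetric]) (rule int)
  also have "\<dots> \<le> (LINT x|lebesgue. V x * (4 / \<kappa>\<^sup>2))"
  proof (rule integral_mono)
    show "integrable lebesgue (\<lambda>x. V x * (\<Sum>i\<in>I. indicator (ball (c i) h) x))"
      unfolding sum_distrib_left by (intro Bochner_Integration.integrable_sum int)
    show "integrable lebesgue (\<lambda>x. V x * (4 / \<kappa>\<^sup>2))" using V by simp
    show "V x * (\<Sum>i\<in>I. indicator (ball (c i) h) x) \<le> V x * (4 / \<kappa>\<^sup>2)" for x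
      by (rule mult_left_mono[OF count]) (simp add: V_def)
  qed
  also have "\<dots> = 4 / \<kappa>\<^sup>2 * (LINT x:U|lebesgue. \<bar>v x\<bar>)"
    by (simp add: set_lebesgue_integral_def V_def abs_mult mult.commute)
  finally show ?thesis .
qed

text \<open>Away from the frontiers of the pieces each summand is continuous, and frontiers of
  convex sets are negligible. Disjointness keeps the bound at M instead of a multiple of it.\<close>

lemma admissible_piecewise:
  assumes I: "finite I" "0 \<le> M" "\<And>i. i \<in> I \<Longrightarrow> open (V i)" "\<And>i. i \<in> I \<Longrightarrow> convex (V i)"
    and disj: "\<And>i j. i \<in> I \<Longrightarrow> j \<in> I \<Longrightarrow> i \<noteq> j \<Longrightarrow> V i \<inter> V j = {}"
    and \<phi>: "\<And>i. i \<in> I \<Longrightarrow> continuous_on (V i) (\<phi> i)" "\<And>i x. i \<in> I \<Longrightarrow> x \<in> V i \<Longrightarrow> \<bar>\<phi> i x\<bar> \<le> M"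
  shows "admissible M (\<lambda>x. \<Sum>i\<in>I. indicator (V i) x * \<phi> i x)"
  unfolding admissible_def
proof (intro conjI allI)
  have "(\<lambda>x. indicator (V i) x *\<^sub>R \<phi> i x) \<in> borel_measurable borel" if "i \<in> I" for i
    using I(3)[OF that] \<phi>(1)[OF that] by (intro borel_measurable_continuous_on_indicator) auto
  then show "(\<lambda>x. \<Sum>i\<in>I. indicator (V i) x * \<phi> i x) \<in> borel_measurable borel"
    by (intro borel_measurable_sum) simp
  have cont: "isCont (\<lambda>x. indicator (V i) x * \<phi> i x) x" if i: "i \<in> I" and x: "x \<notin> frontier (V i)" for i x
  proof (cases "x \<in> V i")
    case True
    have "isCont (\<phi> i) x" using \<phi>(1)[OF i] I(3)[OF i] True by (simp add: continuous_on_eq_continuous_at)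
    then show ?thesis using x by (intro continuous_intros) (auto simp: isCont_indicator)
  next
    case False
    then have "x \<in> - closure (V i)" using x I(3)[OF i] by (simp add: frontier_def interior_open)
    then have "\<forall>\<^sub>F y in nhds x. y \<in> - closure (V i)" by (intro eventually_nhds_in_open) auto
    then have "\<forall>\<^sub>F y in nhds x. indicator (V i) y * \<phi> i y = 0"
      by eventually_elim (use closure_subset[of "V i"] in \<open>auto simp: indicator_def\<close>)
    then have "isCont (\<lambda>x. indicator (V i) x * \<phi> i x) x \<longleftrightarrow> isCont (\<lambda>x. 0::real) x"
      by (rule isCont_cong)
    then show ?thesis by simp
  qed
  have "AE x in lebesgue. \<forall>i\<in>I. x \<notin> frontier (V i)"
    using I(1,4) by (intro eventually_ball_finite ballI AE_not_in_negligible negligible_convex_frontier) auto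
  then show "AE x in lebesgue. isCont (\<lambda>x. \<Sum>i\<in>I. indicator (V i) x * \<phi> i x) x"
    by eventually_elim (use cont in \<open>auto intro!: continuous_sum\<close>)
  fix x
  show "\<bar>\<Sum>i\<in>I. indicator (V i) x * \<phi> i x\<bar> \<le> M"
  proof (cases "\<exists>i\<in>I. x \<in> V i")
    case True
    then obtain i where i: "i \<in> I" "x \<in> V i" by blast
    have "(\<Sum>i\<in>I. indicator (V i) x * \<phi> i x) = (\<Sum>j\<in>{i}. indicator (V j) x * \<phi> j x)"
      using I(1) i disj[OF i(1)] by (intro sum.mono_neutral_right) (auto simp: indicator_def)
    then show ?thesis using \<phi>(2)[OF i] i(2) by simp
  next
    case False
    then have "(\<Sum>i\<in>I. indicator (V i) x * \<phi> i x) = 0" by (intro sum.neutral) (auto simp: indicator_def)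
    then show ?thesis using I(2) by simp
  qed
qed

lemma piecewise_eq:
  fixes \<phi> :: "'i \<Rightarrow> 'a \<Rightarrow> real"
  assumes "finite I" "i \<in> I" "x \<in> V i" "\<And>j. j \<in> I \<Longrightarrow> j \<noteq> i \<Longrightarrow> x \<notin> V j"
  shows "(\<Sum>j\<in>I. indicator (V j) x * \<phi> j x) = \<phi> i x"
proof -
  have "(\<Sum>j\<in>I. indicator (V j) x * \<phi> j x) = (\<Sum>j\<in>{i}. indicator (V j) x * \<phi> j x)"
    using assms by (intro sum.mono_neutral_right) (auto simp: indicator_def)
  then show ?thesis using assms(3) by simp
qed

section \<open>Geometry of elements and of quasi-uniform meshes\<close>

lemma simplex_interior_nonempty:
  assumes "2 simplex (T :: (real^2) set)"
  shows "interior T \<noteq> {}"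
proof -
  have "affine hull T = UNIV"
    using aff_dim_simplex[OF assms] by (simp flip: aff_dim_eq_full)
  moreover have "T \<noteq> {}" using assms by auto
  ultimately show ?thesis
    using rel_interior_eq_empty[OF convex_simplex[OF assms]] by (simp add: rel_interior_interior)
qed

text \<open>The strict inequality yields a realised radius above t, whether or not the supremum is
  attained.\<close>

lemma inradius_ball:
  assumes "bounded T" "T \<noteq> {}" "t < inradius T"
  shows "\<exists>c. cball c t \<subseteq> T"
proof -
  let ?A = "{r. 0 \<le> r \<and> (\<exists>c. cball c r \<subseteq> T)}"
  obtain x where "x \<in> T" using assms(2) by blast
  then have "0 \<in> ?A" by (auto intro!: exI[of _ x])
  then have ne: "?A \<noteq> {}" by blast
  have "r \<le> diameter T" if r: "r \<in> ?A" for r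
  proof -
    obtain c where c: "cball c r \<subseteq> T" "0 \<le> r" using r by auto
    then have "diameter (cball c r) \<le> diameter T" using assms(1) by (intro diameter_subset)
    then show ?thesis using c(2) by (simp add: diameter_cball)
  qed
  then have "bdd_above ?A" by (auto simp: bdd_above_def)
  then obtain r where "r \<in> ?A" "t < r"
    using assms(3) less_cSup_iff[OF ne] unfolding inradius_def by blast
  then obtain c where "cball c r \<subseteq> T" by auto
  moreover have "cball c t \<subseteq> cball c r" using \<open>t < r\<close> by (intro subset_cball) simp
  ultimately show ?thesis by blast
qed

text \<open>Quasi-uniformity and shape regularity bound the mesh size by \<open>q * \<sigma>\<close>
  times the inradius; the 2 in the condition on \<kappa> leaves a margin for the strict inequality
  of \<open>inradius_ball\<close>. Positivity of q and \<sigma> follows from the existence of an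
  element, since its diameter is positive.\<close>

lemma mesh_geometry:
  assumes \<T>: "conforming_triangulation_of \<Omega> \<T>" "shape_regular \<sigma> \<T>" "quasi_uniform q \<T>" "T \<in> \<T>"
    and \<kappa>: "\<kappa> \<le> 1" "q * \<sigma> > 0 \<longrightarrow> \<kappa> \<le> 1 / (2 * q * \<sigma>)"
  shows "0 < mesh_size \<T>" "\<And>x. x \<in> T \<Longrightarrow> T \<subseteq> cball x (mesh_size \<T>)" "\<exists>y. cball y (\<kappa> * mesh_size \<T>) \<subseteq> T"
proof -
  let ?h = "mesh_size \<T>"
  have T: "2 simplex T" "finite \<T>" using \<T> by (auto simp: conforming_triangulation_of_def triangulation_def)
  then have bT: "bounded T" using compact_simplex compact_imp_bounded by blast
  have "T \<noteq> {}" using T(1) by auto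
  have dh: "diameter T \<le> ?h" unfolding mesh_size_def using T(2) \<T>(4) by (intro Max_ge) auto
  obtain x r where r: "r > 0" "cball x r \<subseteq> T"
    using simplex_interior_nonempty[OF T(1)] by (auto simp: mem_interior_cball)
  have "diameter (cball x r) \<le> diameter T" using r bT by (intro diameter_subset)
  then have dT: "0 < diameter T" using r by (simp add: diameter_cball)
  then show h: "0 < ?h" using dh by linarith
  show "T \<subseteq> cball x ?h" if "x \<in> T" for x
    using diameter_bounded_bound[OF bT that] dh by (force intro: order_trans)
  have qu: "?h \<le> q * diameter T" and sh: "diameter T \<le> \<sigma> * inradius T"
    using \<T> by (auto simp: quasi_uniform_def shape_regular_def)
  have "0 < q * diameter T" using h qu by linarith
  then have q: "0 < q" using dT by (simp add: zero_less_mult_iff)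
  have "0 \<le> inradius T"
  proof (rule ccontr)
    assume "\<not> 0 \<le> inradius T"
    have bdd: "bdd_above {r. 0 \<le> r \<and> (\<exists>c. cball c r \<subseteq> T)}"
    proof (rule bdd_aboveI)
      fix r assume "r \<in> {r. 0 \<le> r \<and> (\<exists>c. cball c r \<subseteq> T)}"
      then obtain c where c: "cball c r \<subseteq> T" "0 \<le> r" by auto
      then have "diameter (cball c r) \<le> diameter T" using bT by (intro diameter_subset)
      then show "r \<le> diameter T" using c(2) by (simp add: diameter_cball)
    qed
    have "r \<le> inradius T" unfolding inradius_def by (rule cSup_upper[OF _ bdd]) (use r in auto)
    then show False using r \<open>\<not> 0 \<le> inradius T\<close> by linarith
  qed
  moreover have "0 < \<sigma> * inradius T" using dT sh by linarith
  ultimately have \<sigma>: "0 < \<sigma>" "0 < inradius T" by (auto simp: zero_less_mult_iff)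
  have "?h \<le> q * (\<sigma> * inradius T)" using qu mult_left_mono[OF sh, of q] q by linarith
  moreover have "\<kappa> * ?h \<le> 1 / (2 * q * \<sigma>) * ?h" using \<kappa>(2) q \<sigma> h by (intro mult_right_mono) auto
  ultimately have "\<kappa> * ?h \<le> 1 / (2 * q * \<sigma>) * (q * (\<sigma> * inradius T))"
    using q \<sigma> by (meson mult_left_mono order_trans divide_nonneg_pos zero_le_one mult_pos_pos zero_less_numeral)
  also have "\<dots> = inradius T / 2" using q \<sigma> by simp
  finally have "\<kappa> * ?h < inradius T" using \<sigma> by linarith
  then show "\<exists>y. cball y (\<kappa> * ?h) \<subseteq> T" by (rule inradius_ball[OF bT \<open>T \<noteq> {}\<close>])
qed

text \<open>A ball in S and its reflection about c average to a ball about c, which convexity keeps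
  in \<Omega>. For a symmetric pair this makes the common vertex a legitimate Taylor centre, even if
  the elements touch the boundary.\<close>

lemma midpoint_interior:
  assumes "convex \<Omega>" "S \<subseteq> \<Omega>" "\<And>x. x \<in> S \<Longrightarrow> 2 *\<^sub>R c - x \<in> \<Omega>" "interior S \<noteq> {}"
  shows "c \<in> interior (\<Omega> :: 'a::euclidean_space set)"
proof -
  obtain y r where r: "r > 0" "ball y r \<subseteq> S" using assms(4) by (auto simp: mem_interior)
  have "ball c r \<subseteq> \<Omega>"
  proof
    fix z assume z: "z \<in> ball c r"
    have "y + (z - c) \<in> S" "y - (z - c) \<in> S"
      using z by (auto intro!: subsetD[OF r(2)] simp: dist_norm norm_minus_commute)
    then have "y + (z - c) \<in> \<Omega>" "2 *\<^sub>R c - (y - (z - c)) \<in> \<Omega>" using assms(2,3) by blast+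
    then have "(1/2) *\<^sub>R (y + (z - c)) + (1/2) *\<^sub>R (2 *\<^sub>R c - (y - (z - c))) \<in> \<Omega>"
      using assms(1) by (intro convexD) auto
    moreover have "(1/2) *\<^sub>R (y + (z - c)) + (1/2) *\<^sub>R (2 *\<^sub>R c - (y - (z - c))) = z"
      by (simp add: algebra_simps flip: scaleR_add_left scaleR_left_diff_distrib)
    ultimately show "z \<in> \<Omega>" by simp
  qed
  then show ?thesis using r(1) by (auto simp: mem_interior)
qed

lemma interior_reflect:
  assumes "\<And>x. x \<in> T \<longleftrightarrow> z - x \<in> (S :: 'a::real_normed_vector set)"
  shows "x \<in> interior T \<longleftrightarrow> z - x \<in> interior S"
proof -
  have "x \<in> interior T \<Longrightarrow> z - x \<in> interior S" if *: "\<And>x. x \<in> T \<longleftrightarrow> z - x \<in> S" for S T :: "'a set" and x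
  proof -
    assume "x \<in> interior T"
    then obtain e where e: "e > 0" "ball x e \<subseteq> T" by (auto simp: mem_interior)
    have "ball (z - x) e \<subseteq> S"
    proof
      fix u assume "u \<in> ball (z - x) e"
      moreover have "x - (z - u) = - ((z - x) - u)" by simp
      then have "dist x (z - u) = dist (z - x) u" by (simp only: dist_norm norm_minus_cancel)
      ultimately have "z - u \<in> ball x e" by simp
      then have "z - u \<in> T" using e by blast
      then show "u \<in> S" using *[of "z - u"] by simp
    qed
    then show "z - x \<in> interior S" using e by (auto simp: mem_interior)
  qed
  from this[of T S x] this[of S T "z - x"] show ?thesis using assms by auto
qed

text \<open>The witness \<psi> is, on both interiors, the derivative of the error for the
  homogeneous part of degree \<open>k + 1\<close>. It is within B of the true error, whose bound is
  A, hence its bound \<open>A + B\<close>. The ball inside S is recorded because the balls of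
  different pairs are then disjoint, as \<open>overlap_bound\<close> requires.\<close>

lemma symmetric_pair_error:
  assumes k: "k \<ge> 1" and \<Omega>: "compact \<Omega>" "convex \<Omega>"
    and \<T>: "conforming_triangulation_of \<Omega> \<T>" "S \<in> \<T>" "T \<in> \<T>" and pair: "symmetric_pair S T"
    and h: "0 < h" "\<And>T x. T \<in> \<T> \<Longrightarrow> x \<in> T \<Longrightarrow> T \<subseteq> cball x h" "\<And>T. T \<in> \<T> \<Longrightarrow> \<exists>y. cball y (\<kappa> * h) \<subseteq> T"
    and F: "\<And>T. T \<in> \<T> \<Longrightarrow> reference_map T (F T)" and w: "even (k + 2 - length w)" "length w \<le> k"
    and err: "\<And>c T G y x. c \<in> interior \<Omega> \<Longrightarrow> reference_map T G \<Longrightarrow> T \<subseteq> \<Omega> \<Longrightarrow> T \<subseteq> cball c h \<Longrightarrow> cball y (\<kappa> * h) \<subseteq> T \<Longrightarrow>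
      x \<in> interior T \<Longrightarrow> \<bar>Dw w (interp k G f) x - Dw w f x\<bar> \<le> A \<and>
      \<bar>(Dw w (interp k G f) x - Dw w f x) - Dw w (\<lambda>x. interp k G (\<lambda>x. taylor_poly (Suc k) c f x - taylor_poly k c f x) x
        - (taylor_poly (Suc k) c f x - taylor_poly k c f x)) x\<bar> \<le> B"
  shows "\<exists>\<psi> c y. admissible (A + B) \<psi> \<and> (\<forall>x. \<psi> (2 *\<^sub>R c - x) = - \<psi> x) \<and>
    (\<forall>x. \<psi> x \<noteq> 0 \<longrightarrow> x \<in> ball c h \<inter> interior \<Omega> \<and> x \<in> interior S \<union> interior T) \<and>
    (\<forall>T'\<in>{S, T}. \<forall>x\<in>interior T'. \<bar>(Dw w (interp k (F T') f) x - Dw w f x) - \<psi> x\<bar> \<le> B) \<and>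
    ball y (\<kappa> * h) \<subseteq> ball c h \<inter> interior \<Omega> \<and> ball y (\<kappa> * h) \<subseteq> interior S"
proof -
  obtain c F1 F2 where c: "S \<inter> T = {c}" "reference_map S F1" "reference_map T F2"
    "\<And>\<xi>. \<xi> \<in> T_ref \<Longrightarrow> F1 \<xi> - c = c - F2 \<xi>"
    using pair unfolding symmetric_pair_def by metis
  have F2: "F2 \<xi> = 2 *\<^sub>R c - F1 \<xi>" if "\<xi> \<in> T_ref" for \<xi>
    using c(4)[OF that] by (simp add: scaleR_2 algebra_simps)
  have ST: "x \<in> T \<longleftrightarrow> 2 *\<^sub>R c - x \<in> S" for x
  proof -
    have "T = (\<lambda>x. 2 *\<^sub>R c - x) ` S"
    proof -
      have "T = F2 ` T_ref" "S = F1 ` T_ref" using c(2,3) by (auto simp: reference_map_def bij_betw_def)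
      then show ?thesis using F2 by (auto simp: image_iff)
    qed
    then show ?thesis by (auto simp: image_iff) (metis add_diff_cancel_left' diff_add_cancel)
  qed
  have simplex: "2 simplex S" "2 simplex T" and sub: "S \<subseteq> \<Omega>" "T \<subseteq> \<Omega>"
    using \<T> by (auto simp: conforming_triangulation_of_def)
  have int: "x \<in> interior T \<longleftrightarrow> 2 *\<^sub>R c - x \<in> interior S" for x
    by (rule interior_reflect) (rule ST)
  have cO: "c \<in> interior \<Omega>"
  proof (rule midpoint_interior[OF \<Omega>(2) sub(1) _ simplex_interior_nonempty[OF simplex(1)]])
    show "2 *\<^sub>R c - x \<in> \<Omega>" if "x \<in> S" for x using ST[of "2 *\<^sub>R c - x"] that sub(2) by auto
  qed
  have cb: "S \<subseteq> cball c h" "T \<subseteq> cball c h" using h(2) \<T>(2,3) c(1) by blast+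
  have ib: "interior S \<subseteq> ball c h \<inter> interior \<Omega>" "interior T \<subseteq> ball c h \<inter> interior \<Omega>"
    using interior_mono[OF cb(1)] interior_mono[OF cb(2)] interior_mono[OF sub(1)] interior_mono[OF sub(2)]
    by auto
  have "S \<noteq> T"
  proof
    assume "S = T"
    then have "interior S \<subseteq> {c}" using c(1) interior_subset by blast
    then have "interior S = {}" using interior_mono[of "interior S" "{c}"] by simp
    then show False using simplex_interior_nonempty[OF simplex(1)] by blast
  qed
  then have disj: "interior S \<inter> interior T = {}"
    using triangulation_interior_disjoint[OF \<T>] interior_subset by blast
  obtain yS yT where y: "cball yS (\<kappa> * h) \<subseteq> S" "cball yT (\<kappa> * h) \<subseteq> T" using h(3) \<T>(2,3) by metis
  define q where "q x = taylor_poly (Suc k) c f x - taylor_poly k c f x" for x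
  define E where "E G x = interp k G q x - q x" for G x
  have q: "poly_deg_le (Suc k) q"
    unfolding q_def[abs_def] by (intro poly_deg_le_diff poly_taylor_poly poly_deg_le_mono[OF poly_taylor_poly]) simp
  have E: "poly_deg_le (Suc k) (E G)" if "reference_map T' G" for T' G
    unfolding E_def[abs_def] using q by (intro poly_deg_le_diff poly_deg_le_mono[OF interp_poly[OF k that]]) auto
  have q_odd: "q (2 *\<^sub>R c - x) = (- 1) ^ Suc k * q x" for x
    unfolding q_def by (rule taylor_poly_odd)
  have "interp k F2 q (2 *\<^sub>R c - x) = (- 1) ^ Suc k * interp k F1 q x" for x
    using interp_reflect[OF k c(2,3) F2, of q x] by (simp only: q_odd interp_cmult[OF k])
  then have "E F2 (2 *\<^sub>R c - x) = (- 1) ^ Suc k * E F1 x" for x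
    unfolding E_def q_odd right_diff_distrib by (simp only:)
  \<comment> \<open>The sum over a one-element set brings the sign factor into the form of
    \<open>Dw_lincomb\<close>.\<close>
  then have "(\<lambda>x. E F2 (2 *\<^sub>R c - x)) = (\<lambda>x. \<Sum>j\<in>{()}. (- 1) ^ Suc k * E F1 x)" by simp
  then have "Dw w (\<lambda>x. E F2 (2 *\<^sub>R c - x)) x = (\<Sum>j\<in>{()}. (- 1) ^ Suc k * Dw w (E F1) x)" for x
    using Dw_lincomb[OF open_UNIV, of "{()}" w "\<lambda>_. E F1" x "\<lambda>_. (- 1) ^ Suc k"] Cdiff_on_poly[OF E[OF c(2)]]
    by (simp only:) simp
  then have "(- 1) ^ length w * Dw w (E F2) (2 *\<^sub>R c - x) = (- 1) ^ Suc k * Dw w (E F1) x" for x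
    unfolding Dw_reflect[OF E[OF c(3)]] by simp
  \<comment> \<open>Parity enters here: \<open>length w\<close> and k are both even or both odd, so
    the sign from the homogeneous degree \<open>k + 1\<close> is opposite to the sign from the chain
    rule.\<close>
  moreover have "(- 1) ^ Suc k = - ((- 1) ^ length w :: real)"
  proof -
    have "even k \<longleftrightarrow> even (length w)" using w by presburger
    then show ?thesis by (cases "even k") auto
  qed
  ultimately have E_odd: "Dw w (E F2) (2 *\<^sub>R c - x) = - Dw w (E F1) x" for x
    by (metis mult_minus_left mult_minus_right mult_left_cancel power_not_zero zero_neq_neg_one)
  have E_odd': "Dw w (E F1) (2 *\<^sub>R c - x) = - Dw w (E F2) x" for x
    using E_odd[of "2 *\<^sub>R c - x"] by simp
  have errS: "\<bar>Dw w (interp k F1 f) x - Dw w f x\<bar> \<le> A" "\<bar>(Dw w (interp k F1 f) x - Dw w f x) - Dw w (E F1) x\<bar> \<le> B"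
    if "x \<in> interior S" for x
    using err[OF cO c(2) sub(1) cb(1) y(1) that] by (simp_all add: E_def[abs_def] q_def[abs_def])
  have errT: "\<bar>Dw w (interp k F2 f) x - Dw w f x\<bar> \<le> A" "\<bar>(Dw w (interp k F2 f) x - Dw w f x) - Dw w (E F2) x\<bar> \<le> B"
    if "x \<in> interior T" for x
    using err[OF cO c(3) sub(2) cb(2) y(2) that] by (simp_all add: E_def[abs_def] q_def[abs_def])
  \<comment> \<open>Indexing the two pieces by the booleans gives the form expected by
    \<open>admissible_piecewise\<close>; taking interiors makes the pieces disjoint.\<close>
  define \<psi> where "\<psi> x = (\<Sum>b\<in>UNIV. indicator (if b then interior S else interior T) x * Dw w (E (if b then F1 else F2)) x)" for x
  have \<psi>_eq: "\<psi> x = indicator (interior S) x * Dw w (E F1) x + indicator (interior T) x * Dw w (E F2) x" for x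
  proof -
    have "(\<Sum>b\<in>UNIV. u b) = u True + u False" for u :: "bool \<Rightarrow> real" by (simp add: UNIV_bool)
    from this[of "\<lambda>b. indicator (if b then interior S else interior T) x * Dw w (E (if b then F1 else F2)) x"]
    show ?thesis unfolding \<psi>_def by (simp only: if_True if_False)
  qed
  have r1: "admissible (A + B) \<psi>"
    unfolding \<psi>_def[abs_def]
  proof (rule admissible_piecewise)
    obtain x where "x \<in> interior S" using simplex_interior_nonempty[OF simplex(1)] by blast
    then show "0 \<le> A + B" using errS[of x] by linarith
    show "convex (if b then interior S else interior T)" for b
      using simplex by (auto intro: convex_interior convex_simplex)
    show "(if i then interior S else interior T) \<inter> (if j then interior S else interior T) = {}" if "i \<noteq> j" for i j
      using that disj by auto
    have "continuous_on V (Dw w (E G))" if "reference_map T' G" for V T' G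
      using Cdiff_on_Dw[of w 0 UNIV "E G"] Cdiff_on_poly[OF E[OF that]] by (auto intro: continuous_on_subset)
    then show "continuous_on (if b then interior S else interior T) (Dw w (E (if b then F1 else F2)))" for b
      using c(2,3) by (cases b) auto
    show "\<bar>Dw w (E (if b then F1 else F2)) x\<bar> \<le> A + B" if "x \<in> (if b then interior S else interior T)" for b x
      using that errS[of x] errT[of x] by (cases b) auto
  qed auto
  have r2: "\<psi> (2 *\<^sub>R c - x) = - \<psi> x" for x
    using int[of x] int[of "2 *\<^sub>R c - x"] by (simp add: \<psi>_eq E_odd E_odd' indicator_def)
  have r3: "x \<in> ball c h \<inter> interior \<Omega> \<and> x \<in> interior S \<union> interior T" if "\<psi> x \<noteq> 0" for x
  proof -
    have "x \<in> interior S \<union> interior T"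
    proof (rule ccontr)
      assume "x \<notin> interior S \<union> interior T"
      then have "\<psi> x = 0" by (simp add: \<psi>_eq)
      then show False using that by simp
    qed
    then show ?thesis using ib by blast
  qed
  have r4: "\<bar>(Dw w (interp k (F T') f) x - Dw w f x) - \<psi> x\<bar> \<le> B" if "T' \<in> {S, T}" "x \<in> interior T'" for T' x
  proof -
    have i: "interp k (F S) f = interp k F1 f" "interp k (F T) f = interp k F2 f"
      using interp_indep[OF k simplex(1) F[OF \<T>(2)] c(2)] interp_indep[OF k simplex(2) F[OF \<T>(3)] c(3)] by blast+
    show ?thesis
      using that disj errS(2)[of x] errT(2)[of x] by (auto simp: i \<psi>_eq indicator_def)
  qed
  have r5: "ball yS (\<kappa> * h) \<subseteq> interior S"
    using y(1) ball_subset_cball by (intro interior_maximal) auto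
  show ?thesis
  proof (rule exI[of _ \<psi>], rule exI[of _ c], rule exI[of _ yS], intro conjI allI impI ballI)
    show "admissible (A + B) \<psi>" by (rule r1)
    show "\<psi> (2 *\<^sub>R c - x) = - \<psi> x" for x by (rule r2)
    show "x \<in> ball c h \<inter> interior \<Omega>" if "\<psi> x \<noteq> 0" for x by (rule conjunct1[OF r3[OF that]])
    show "x \<in> interior S \<union> interior T" if "\<psi> x \<noteq> 0" for x by (rule conjunct2[OF r3[OF that]])
    show "\<bar>(Dw w (interp k (F T') f) x - Dw w f x) - \<psi> x\<bar> \<le> B" if "T' \<in> {S, T}" "x \<in> interior T'" for T' x
      by (rule r4[OF that])
    show "ball yS (\<kappa> * h) \<subseteq> ball c h \<inter> interior \<Omega>" using r5 ib(1) by (rule order_trans)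
    show "ball yS (\<kappa> * h) \<subseteq> interior S" by (rule r5)
  qed
qed

lemma partition_on_obtain_part:
  assumes "partition_on A P" "T \<in> A"
  obtains p where "p \<in> P" "T \<in> p"
  using assms by (auto simp: partition_on_def)

theorem corollary3p3:
  fixes \<Omega> :: "(real^2) set" and k :: nat and h0 \<sigma> q :: real
  assumes "k \<ge> 1" and "2 simplex \<Omega>"
  shows "\<exists>C. \<forall>h \<T> F f g \<beta>.
    h < h0 \<longrightarrow>
    conforming_triangulation_of \<Omega> \<T> \<longrightarrow>
    h = mesh_size \<T> \<longrightarrow>
    shape_regular \<sigma> \<T> \<longrightarrow>
    quasi_uniform q \<T> \<longrightarrow>
    symmetric_triangulation \<Omega> \<T> \<longrightarrow>
    (\<forall>T\<in>\<T>. reference_map T (F T)) \<longrightarrow>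
    f \<in> Cm_space (k + 2) \<Omega> \<longrightarrow>
    g \<in> W11_space \<Omega> \<longrightarrow>
    mi_order \<beta> \<le> k + 2 \<longrightarrow>
    even (k + 2 - mi_order \<beta>) \<longrightarrow>
    \<bar>\<Sum>T\<in>\<T>. LINT x:T|lebesgue.
        g x * (mi_deriv \<beta> (lagrange_interpolant k \<T> F f) x - mi_deriv \<beta> f x)\<bar>
      \<le> C * h ^ (k + 2 - mi_order \<beta>) * W11_norm \<Omega> g * Cm_norm (k + 2) \<Omega> f"
proof -
  \<comment> \<open>The ball ratio provided by \<open>mesh_geometry\<close>; the minimum with 1 lets
    powers of 1 / \<kappa> increase with the exponent. If the product is not positive, no mesh
    satisfies the regularity conditions, and 1 is a mere default.\<close>
  define \<kappa> where "\<kappa> = (if q * \<sigma> > 0 then min 1 (1 / (2 * q * \<sigma>)) else 1)"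
  have \<kappa>: "0 < \<kappa>" "\<kappa> \<le> 1" "q * \<sigma> > 0 \<longrightarrow> \<kappa> \<le> 1 / (2 * q * \<sigma>)"
    by (auto simp: \<kappa>_def mult.assoc)
  have \<Omega>: "compact \<Omega>" "convex \<Omega>" using assms(2) compact_simplex convex_simplex by blast+
  have "\<Omega> \<noteq> {}" using assms(2) by auto
  \<comment> \<open>An upper bound for the mesh size, which absorbs the extra power of h in
    \<open>h * (M + B)\<close>.\<close>
  define H where "H = diameter \<Omega>"
  have H: "0 \<le> H" unfolding H_def using \<Omega>(1) by (intro diameter_ge_0 compact_imp_bounded)
  obtain C where C: "0 \<le> C"
    "\<And>\<Omega> f T F y c h w x. compact \<Omega> \<Longrightarrow> convex \<Omega> \<Longrightarrow> f \<in> Cm_space (k + 2) \<Omega> \<Longrightarrow> c \<in> interior \<Omega> \<Longrightarrow>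
      reference_map T F \<Longrightarrow> T \<subseteq> \<Omega> \<Longrightarrow> T \<subseteq> cball c h \<Longrightarrow> cball y (\<kappa> * h) \<subseteq> T \<Longrightarrow> 0 < h \<Longrightarrow>
      length w \<le> k \<Longrightarrow> x \<in> interior T \<Longrightarrow>
      \<bar>Dw w (interp k F f) x - Dw w f x\<bar> \<le> C * h ^ (Suc k - length w) * Cm_norm (k + 2) \<Omega> f \<and>
      \<bar>(Dw w (interp k F f) x - Dw w f x) - Dw w (\<lambda>x. interp k F (\<lambda>x. taylor_poly (Suc k) c f x - taylor_poly k c f x) x
        - (taylor_poly (Suc k) c f x - taylor_poly k c f x)) x\<bar>
        \<le> C * h ^ (Suc (Suc k) - length w) * Cm_norm (k + 2) \<Omega> f"
    by (rule element_error[OF assms(1) \<kappa>(1,2)], rule that)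
  obtain Cb where Cb: "0 \<le> Cb"
    "\<And>h g \<psi> M. 0 < h \<Longrightarrow> g \<in> W11_space \<Omega> \<Longrightarrow> admissible M \<psi> \<Longrightarrow>
      (\<forall>x. \<psi> x \<noteq> 0 \<longrightarrow> x \<in> interior \<Omega> \<and> infdist x (frontier \<Omega>) \<le> h) \<Longrightarrow>
      \<bar>LINT y:interior \<Omega>|lebesgue. g y * \<psi> y\<bar> \<le> Cb * h * M * W11_norm \<Omega> g"
    by (rule boundary_strip[OF assms(2)], rule that)
  \<comment> \<open>Contributions of the boundary strip, of the pairs (32 is 8 from the Poincare
    inequality times 4 from the overlap count) and of the remainder; the final 1 covers derivatives
    of order \<open>k + 2\<close>.\<close>
  define Ct where "Ct = Cb * C + 32 / \<kappa> ^ 4 * (C * (1 + H)) + C + 1"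
  show ?thesis
  proof (intro exI[of _ Ct] allI impI)
    fix h \<T> F f g \<beta>
    assume \<T>: "conforming_triangulation_of \<Omega> \<T>" and h_def: "h = mesh_size \<T>"
      and reg: "shape_regular \<sigma> \<T>" "quasi_uniform q \<T>" and symT: "symmetric_triangulation \<Omega> \<T>"
      and F: "\<forall>T\<in>\<T>. reference_map T (F T)" and f: "f \<in> Cm_space (k + 2) \<Omega>" and g: "g \<in> W11_space \<Omega>"
      and \<beta>: "mi_order \<beta> \<le> k + 2" "even (k + 2 - mi_order \<beta>)"
    define w where "w = replicate (\<beta> $ 1) (1::2) @ replicate (\<beta> $ 2) 2"
    have w: "length w = mi_order \<beta>" "\<And>f. mi_deriv \<beta> f = Dw w f"
      by (simp_all add: w_def mi_order_eq mi_deriv_eq_Dw)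
    define l where "l = mi_order \<beta>"
    let ?N = "Cm_norm (k + 2) \<Omega> f" and ?W = "W11_norm \<Omega> g"
    have Tprop: "finite \<T>" "\<And>T. T \<in> \<T> \<Longrightarrow> 2 simplex T" "\<And>T. T \<in> \<T> \<Longrightarrow> T \<subseteq> \<Omega>"
      using \<T> by (auto simp: conforming_triangulation_of_def triangulation_def)
    have "\<T> \<noteq> {}" using \<T> \<open>\<Omega> \<noteq> {}\<close> by (auto simp: conforming_triangulation_of_def)
    then obtain T0 where T0: "T0 \<in> \<T>" by blast
    note geo = mesh_geometry[OF \<T> reg _ \<kappa>(2,3), folded h_def]
    have h: "0 < h" using geo(1)[OF T0] .
    have hH: "h \<le> H"
    proof -
      have "h \<in> diameter ` \<T>" unfolding h_def mesh_size_def using Tprop(1) \<open>\<T> \<noteq> {}\<close> by (intro Max_in) auto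
      then show ?thesis unfolding H_def using Tprop(3) \<Omega>(1) by (auto intro!: diameter_subset compact_imp_bounded)
    qed
    have intT: "interior T \<subseteq> interior \<Omega>" if "T \<in> \<T>" for T using Tprop(3)[OF that] by (rule interior_mono)
    have disj: "interior S \<inter> interior T = {}" if "S \<in> \<T>" "T \<in> \<T>" "S \<noteq> T" for S T
      using triangulation_interior_disjoint[OF \<T> that(1,2)] that(3) interior_subset by blast
    have N: "\<bar>mi_deriv \<gamma> f x\<bar> \<le> ?N" if "mi_order \<gamma> \<le> k + 2" "x \<in> interior \<Omega>" for \<gamma> x
      by (rule Cm_norm_upper[OF \<Omega>(1) f that])
    have N0: "0 \<le> ?N"
    proof -
      obtain x where "x \<in> interior \<Omega>" using simplex_interior_nonempty[OF assms(2)] by blast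
      from N[OF \<beta>(1) this] show ?thesis by linarith
    qed
    have W0: "0 \<le> ?W" by (rule W11_norm_nonneg)
    define D where "D T x = Dw w (interp k (F T) f) x - Dw w f x" for T x
    define err where "err x = (\<Sum>T\<in>\<T>. indicator (interior T) x * D T x)" for x
    have g': "set_integrable lebesgue (interior \<Omega>) g" using g by (simp add: W11_space_def)
    have D_cont: "continuous_on (interior T) (D T)" if "T \<in> \<T>" for T
    proof -
      have "Cdiff_on (length w + 0) (interior \<Omega>) f"
        using f Cdiff_on_le[of "k + 2" "interior \<Omega>" f "length w"] \<beta>(1) w(1) by (simp add: Cm_space_def del: Cdiff_on.simps)
      from Cdiff_on_Dw[OF this] have "continuous_on (interior T) (Dw w f)"
        using intT[OF that] by (auto intro: continuous_on_subset)
      moreover have "continuous_on (interior T) (Dw w (interp k (F T) f))"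
        using Cdiff_on_Dw[of w 0 UNIV "interp k (F T) f"] Cdiff_on_poly[OF interp_poly[OF assms(1) bspec[OF F that]]]
        by (auto intro: continuous_on_subset)
      ultimately show ?thesis unfolding D_def[abs_def] by (intro continuous_intros)
    qed

    \<comment> \<open>Reduction of the sum to one integral over the interior of \<Omega>\<close>
    have sum_eq: "(\<Sum>T\<in>\<T>. LINT x:T|lebesgue. g x * (mi_deriv \<beta> (lagrange_interpolant k \<T> F f) x - mi_deriv \<beta> f x))
        = (LINT x:interior \<Omega>|lebesgue. g x * err x)"
      if bd: "\<And>T x. T \<in> \<T> \<Longrightarrow> x \<in> interior T \<Longrightarrow> \<bar>D T x\<bar> \<le> M" "0 \<le> M" for M
    proof -
      have adm: "admissible M (\<lambda>x. indicator (interior T) x * D T x)" if "T \<in> \<T>" for T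
      proof -
        have "admissible M (\<lambda>x. \<Sum>S\<in>{T}. indicator (interior S) x * D S x)"
          by (rule admissible_piecewise)
            (use that bd D_cont convex_interior[OF convex_simplex[OF Tprop(2)[OF that]]] in auto)
        moreover have "(\<Sum>S\<in>{T}. u S) = u T" for u :: "_ \<Rightarrow> real" by simp
        ultimately show ?thesis by (simp only:)
      qed
      have int: "set_integrable lebesgue (interior \<Omega>) (\<lambda>x. g x * (indicator (interior T) x * D T x))" if "T \<in> \<T>" for T
        by (rule admissible_integrable[OF adm[OF that] g'])
      have "(LINT x:T|lebesgue. g x * (mi_deriv \<beta> (lagrange_interpolant k \<T> F f) x - mi_deriv \<beta> f x))
          = (LINT x:interior \<Omega>|lebesgue. g x * (indicator (interior T) x * D T x))" if T: "T \<in> \<T>" for T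
        unfolding set_lebesgue_integral_def
      proof (rule integral_cong_AE)
        let ?a = "\<lambda>x. indicat_real T x *\<^sub>R (g x * (mi_deriv \<beta> (lagrange_interpolant k \<T> F f) x - mi_deriv \<beta> f x))"
          and ?b = "\<lambda>x. indicat_real (interior \<Omega>) x *\<^sub>R (g x * (indicator (interior T) x * D T x))"
        show b: "?b \<in> borel_measurable lebesgue" using int[OF T] by (auto simp: set_integrable_def)
        have "negligible (frontier T)" by (rule negligible_convex_frontier[OF convex_simplex[OF Tprop(2)[OF T]]])
        from AE_not_in_negligible[OF this] show AE: "AE x in lebesgue. ?a x = ?b x"
        proof eventually_elim
          case (elim x)
          show ?case
          proof (cases "x \<in> T")
            case True
            then have x: "x \<in> interior T" "x \<in> interior \<Omega>"
              using elim intT[OF T] closure_subset[of T] by (auto simp: frontier_def)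
            have "Dw w (lagrange_interpolant k \<T> F f) x = Dw w (interp k (F T) f) x"
              using lagrange_interpolant_eq_interp[where F=F, OF assms(1) \<T> T _ bspec[OF F T]] x(1)
              by (intro Dw_cong[OF open_interior]) auto
            then show ?thesis using True x by (simp add: D_def w(2))
          next
            case False
            then have "x \<notin> interior T" using interior_subset by blast
            then show ?thesis using False by simp
          qed
        qed
        \<comment> \<open>Measurability of the original integrand is inherited from the other side:
          on element boundaries \<open>mi_deriv\<close> has uncontrolled values, but only on a null
          set.\<close>
        have "AE x in lebesgue. ?b x = ?a x" by (rule eventually_mono[OF AE], rule sym)
        then show "?a \<in> borel_measurable lebesgue" by (rule borel_measurable_AE[OF b])
      qed
      then have "(\<Sum>T\<in>\<T>. LINT x:T|lebesgue. g x * (mi_deriv \<beta> (lagrange_interpolant k \<T> F f) x - mi_deriv \<beta> f x))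
          = (\<Sum>T\<in>\<T>. LINT x:interior \<Omega>|lebesgue. g x * (indicator (interior T) x * D T x))"
        by (rule sum.cong[OF refl])
      also have "\<dots> = (LINT x:interior \<Omega>|lebesgue. g x * err x)"
        using int unfolding set_lebesgue_integral_def set_integrable_def err_def
        by (subst Bochner_Integration.integral_sum[symmetric]) (auto simp: sum_distrib_left scaleR_sum_right)
      finally show ?thesis .
    qed
    have err_at: "err x = D T x" if "T \<in> \<T>" "x \<in> interior T" for T x
      unfolding err_def using Tprop(1) that disj[OF that(1)] by (intro piecewise_eq[where V=interior]) auto
    have err_adm: "admissible M (\<lambda>x. \<Sum>T\<in>\<S>. indicator (interior T) x * D T x)"
      if "\<S> \<subseteq> \<T>" "\<And>T x. T \<in> \<S> \<Longrightarrow> x \<in> interior T \<Longrightarrow> \<bar>D T x\<bar> \<le> M" "0 \<le> M" for \<S> M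
    proof (rule admissible_piecewise)
      show "finite \<S>" using Tprop(1) that(1) finite_subset by blast
      show "convex (interior T)" if "T \<in> \<S>" for T
        using Tprop(2) \<open>\<S> \<subseteq> \<T>\<close> that by (blast intro: convex_interior convex_simplex)
      show "interior S \<inter> interior T = {}" if "S \<in> \<S>" "T \<in> \<S>" "S \<noteq> T" for S T
        using disj[of S T] that \<open>\<S> \<subseteq> \<T>\<close> by blast
      show "continuous_on (interior T) (D T)" if "T \<in> \<S>" for T
        using D_cont[of T] that \<open>\<S> \<subseteq> \<T>\<close> by blast
    qed (use that in auto)
    show "\<bar>\<Sum>T\<in>\<T>. LINT x:T|lebesgue. g x * (mi_deriv \<beta> (lagrange_interpolant k \<T> F f) x - mi_deriv \<beta> f x)\<bar>
      \<le> Ct * h ^ (k + 2 - mi_order \<beta>) * ?W * ?N"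
    proof (cases "l \<le> k")

      \<comment> \<open>Derivatives of order \<open>k + 2\<close>\<close>
      case False
      \<comment> \<open>Order \<open>k + 1\<close> is excluded by parity. At order
        \<open>k + 2\<close> the interpolant drops out, and the error is
        \<open>mi_deriv \<beta> f\<close> up to sign.\<close>
      then have l: "l = k + 2" using \<beta> unfolding l_def by presburger
      have bd: "\<bar>D T x\<bar> \<le> ?N" if "T \<in> \<T>" "x \<in> interior T" for T x
      proof -
        have "Dw w (interp k (F T) f) x = 0"
          using Dw_poly_eq_0[OF interp_poly[OF assms(1) bspec[OF F that(1)]], of w f] l w(1) by (simp add: l_def)
        then show ?thesis using N[OF \<beta>(1), of x] intT[OF that(1)] that(2) by (auto simp: D_def w(2))
      qed
      have "\<bar>LINT x:interior \<Omega>|lebesgue. g x * err x\<bar> \<le> ?N * (LINT x:interior \<Omega>|lebesgue. \<bar>g x\<bar>)"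
        unfolding err_def by (rule admissible_abs_integral_le[OF err_adm[OF subset_refl bd N0] g'])
      also have "\<dots> \<le> ?N * ?W" using N0 W11_norm_ge(1) by (intro mult_left_mono)
      also have "\<dots> \<le> Ct * (?N * ?W)"
      proof -
        have "1 \<le> Ct" using C(1) Cb(1) H \<kappa>(1) by (simp add: Ct_def)
        then show ?thesis using N0 W0 by (metis mult_1 mult_nonneg_nonneg mult_right_mono)
      qed
      finally show ?thesis using l by (subst sum_eq[OF bd N0]) (simp_all add: l_def mult_ac)
    next
      case True

      \<comment> \<open>Derivatives of order at most k: splitting into strip, odd parts and
        remainder\<close>
      define M where "M = C * h ^ (Suc k - l) * ?N"
      \<comment> \<open>M has the usual local order, B the target order, one power of h
        better.\<close>
      define B where "B = C * h ^ (Suc (Suc k) - l) * ?N"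
      have MB: "0 \<le> M" "0 \<le> B" using C(1) h N0 by (auto simp: M_def B_def)
      have hp: "h ^ (Suc (Suc k) - l) = h * h ^ (Suc k - l)" using True by (simp add: Suc_diff_le)
      have lw: "length w \<le> k" "length w = l" using True w(1) by (simp_all add: l_def)
      note err_T = C(2)[OF \<Omega> f _ _ _ _ _ h lw(1), unfolded lw(2), folded M_def B_def]
      have bd: "\<bar>D T x\<bar> \<le> M" if T: "T \<in> \<T>" "x \<in> interior T" for T x
      proof -
        obtain y where y: "cball y (\<kappa> * h) \<subseteq> T" using geo(3)[OF T(1)] by blast
        have "x \<in> T" using T(2) interior_subset by blast
        \<comment> \<open>The point x serves as its own Taylor centre; it lies in the interior of
          \<Omega> even if the vertices of T are on the boundary. Only the first bound of
          \<open>err_T\<close> is used.\<close>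
        then show ?thesis unfolding D_def
          using err_T[OF _ bspec[OF F T(1)] Tprop(3)[OF T(1)] geo(2)[OF T(1)] y T(2), of x] intT[OF T(1)] T(2) by blast
      qed
      obtain \<A> \<B> P where AB0: "\<T> = \<A> \<union> \<B>" "\<A> \<inter> \<B> = {}" "partition_on \<A> P"
        "\<forall>p\<in>P. \<exists>S T. p = {S, T} \<and> symmetric_pair S T" "\<Union>\<B> \<subseteq> {x \<in> \<Omega>. infdist x (frontier \<Omega>) \<le> h}"
        using symT unfolding symmetric_triangulation_def h_def[symmetric]
        by (elim exE conjE) (rule that; assumption)
      note AB = AB0(1-3) bspec[OF AB0(4)] AB0(5)
      have "finite \<A>" using Tprop(1) unfolding AB(1) by simp
      then have finP: "finite P" using AB(3) finite_elements by blast
      have pA: "T \<in> \<A>" if "p \<in> P" "T \<in> p" for p T using AB(3) that by (auto simp: partition_on_def)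
      have p_unique: "p = p'" if "p \<in> P" "p' \<in> P" "T \<in> p" "T \<in> p'" for p p' T
        using AB(3) that by (auto simp: partition_on_def disjoint_def)
      \<comment> \<open>Gathers the properties of the data attached to a pair, so that one
        simultaneous choice over all pairs can be made.\<close>
      define Q where "Q p \<psi> c y \<longleftrightarrow> admissible (M + B) \<psi> \<and> (\<forall>x. \<psi> (2 *\<^sub>R c - x) = - \<psi> x) \<and>
        (\<forall>x. \<psi> x \<noteq> 0 \<longrightarrow> x \<in> ball c h \<inter> interior \<Omega> \<and> (\<exists>T\<in>p. x \<in> interior T)) \<and>
        (\<forall>T\<in>p. \<forall>x\<in>interior T. \<bar>D T x - \<psi> x\<bar> \<le> B) \<and>
        ball y (\<kappa> * h) \<subseteq> ball c h \<inter> interior \<Omega> \<and> (\<exists>T\<in>p. ball y (\<kappa> * h) \<subseteq> interior T)" for p \<psi> c y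
      have "\<forall>p\<in>P. \<exists>\<psi> c y. Q p \<psi> c y"
      proof
        fix p assume p: "p \<in> P"
        obtain S T where ST: "p = {S, T}" "symmetric_pair S T" using AB(4)[OF p] by blast
        have "S \<in> \<T>" "T \<in> \<T>" using pA[OF p] ST(1) AB(1) by auto
        have "\<exists>\<psi> c y. admissible (M + B) \<psi> \<and> (\<forall>x. \<psi> (2 *\<^sub>R c - x) = - \<psi> x) \<and>
          (\<forall>x. \<psi> x \<noteq> 0 \<longrightarrow> x \<in> ball c h \<inter> interior \<Omega> \<and> x \<in> interior S \<union> interior T) \<and>
          (\<forall>T'\<in>{S, T}. \<forall>x\<in>interior T'. \<bar>(Dw w (interp k (F T') f) x - Dw w f x) - \<psi> x\<bar> \<le> B) \<and>
          ball y (\<kappa> * h) \<subseteq> ball c h \<inter> interior \<Omega> \<and> ball y (\<kappa> * h) \<subseteq> interior S"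
        proof (rule symmetric_pair_error[OF assms(1) \<Omega> \<T> \<open>S \<in> \<T>\<close> \<open>T \<in> \<T>\<close> ST(2) h])
          show "even (k + 2 - length w)" using \<beta>(2) w(1) by simp
          show "T \<subseteq> cball x h" if "T \<in> \<T>" "x \<in> T" for T x by (rule geo(2)[OF that])
          show "\<exists>y. cball y (\<kappa> * h) \<subseteq> T" if "T \<in> \<T>" for T by (rule geo(3)[OF that])
          show "reference_map T (F T)" if "T \<in> \<T>" for T using F that by (rule bspec)
          show "length w \<le> k" by (rule lw(1))
        qed (rule err_T)
        then obtain \<psi> c y where e: "admissible (M + B) \<psi>" "\<forall>x. \<psi> (2 *\<^sub>R c - x) = - \<psi> x"
          "\<forall>x. \<psi> x \<noteq> 0 \<longrightarrow> x \<in> ball c h \<inter> interior \<Omega> \<and> x \<in> interior S \<union> interior T"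
          "\<forall>T'\<in>{S, T}. \<forall>x\<in>interior T'. \<bar>D T' x - \<psi> x\<bar> \<le> B"
          "ball y (\<kappa> * h) \<subseteq> ball c h \<inter> interior \<Omega>" "ball y (\<kappa> * h) \<subseteq> interior S"
          unfolding D_def[symmetric] by (elim exE conjE) (rule that; assumption)
        have e3: "\<forall>x. \<psi> x \<noteq> 0 \<longrightarrow> x \<in> ball c h \<inter> interior \<Omega> \<and> (\<exists>T\<in>p. x \<in> interior T)"
        proof (intro allI impI)
          fix x assume "\<psi> x \<noteq> 0"
          then have "x \<in> ball c h \<inter> interior \<Omega> \<and> x \<in> interior S \<union> interior T" by (rule mp[OF spec[OF e(3)]])
          then show "x \<in> ball c h \<inter> interior \<Omega> \<and> (\<exists>T\<in>p. x \<in> interior T)" unfolding ST(1) by blast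
        qed
        have e6: "\<exists>T\<in>p. ball y (\<kappa> * h) \<subseteq> interior T" using e(6) unfolding ST(1) by blast
        show "\<exists>\<psi> c y. Q p \<psi> c y" unfolding Q_def
          by (rule exI[of _ \<psi>], rule exI[of _ c], rule exI[of _ y], intro conjI e(1,2,5) e3 e6 e(4)[folded ST(1)])
      qed
      then obtain \<psi> c y where "\<forall>p\<in>P. Q p (\<psi> p) (c p) (y p)" by metis
      then have Q: "Q p (\<psi> p) (c p) (y p)" if "p \<in> P" for p using that by (rule bspec)
      have \<psi>: "admissible (M + B) (\<psi> p)" "\<psi> p (2 *\<^sub>R c p - x) = - \<psi> p x"
        "\<psi> p x \<noteq> 0 \<Longrightarrow> x \<in> ball (c p) h \<inter> interior \<Omega>" "\<psi> p x \<noteq> 0 \<Longrightarrow> \<exists>T\<in>p. x \<in> interior T"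
        "T \<in> p \<Longrightarrow> x \<in> interior T \<Longrightarrow> \<bar>D T x - \<psi> p x\<bar> \<le> B"
        "ball (y p) (\<kappa> * h) \<subseteq> ball (c p) h \<inter> interior \<Omega>"
        "\<exists>T\<in>p. ball (y p) (\<kappa> * h) \<subseteq> interior T" if "p \<in> P" for p x T
        using Q[OF that] unfolding Q_def by (elim conjE; blast)+
      have int_unique: "S = T" if "S \<in> \<T>" "T \<in> \<T>" "x \<in> interior S" "x \<in> interior T" for S T x
        using disj[OF that(1,2)] that(3,4) by blast
      define errB where "errB x = (\<Sum>T\<in>\<B>. indicator (interior T) x * D T x)" for x
      \<comment> \<open>On an unpaired element this is zero, on a paired one it is the deviation of
        the error from the odd part, and outside all interiors every term vanishes; so it is of size
        B everywhere.\<close>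
      define rest where "rest x = err x - errB x - (\<Sum>p\<in>P. \<psi> p x)" for x
      have rest: "\<bar>rest x\<bar> \<le> B" for x
      proof (cases "\<exists>T\<in>\<T>. x \<in> interior T")
        case False
        then have "err x = 0" "errB x = 0" using AB(1) by (auto simp: err_def errB_def intro!: sum.neutral)
        moreover have "\<psi> p x = 0" if "p \<in> P" for p
          using \<psi>(4)[OF that, of x] False pA[OF that] AB(1) by blast
        ultimately show ?thesis using MB by (simp add: rest_def)
      next
        case True
        then obtain T where T: "T \<in> \<T>" "x \<in> interior T" by blast
        show ?thesis
        proof (cases "T \<in> \<B>")
          case True
          have "errB x = D T x"
            unfolding errB_def using Tprop(1) AB(1) True T disj[OF T(1)] by (intro piecewise_eq[where V=interior]) auto
          moreover have "\<psi> p x = 0" if pP: "p \<in> P" for p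
          proof (rule ccontr)
            assume "\<psi> p x \<noteq> 0"
            then obtain S where S: "S \<in> p" "x \<in> interior S" using \<psi>(4)[OF pP] by blast
            then have "S \<in> \<A>" using pA[OF pP] by blast
            then have "S = T" using int_unique[OF _ T(1) S(2) T(2)] AB(1) by blast
            then show False using \<open>S \<in> \<A>\<close> True AB(2) by blast
          qed
          ultimately show ?thesis using err_at[OF T] MB by (simp add: rest_def)
        next
          case False
          then have "T \<in> \<A>" using T AB(1) by blast
          then obtain p where p: "p \<in> P" "T \<in> p" by (rule partition_on_obtain_part[OF AB(3)])
          have "x \<notin> interior S" if "S \<in> \<B>" for S
            using int_unique[OF _ T(1) _ T(2), of S] that False AB(1) by blast
          then have "errB x = 0" by (auto simp: errB_def intro!: sum.neutral)
          moreover have "\<psi> p' x = 0" if pP: "p' \<in> P" "p' \<noteq> p" for p'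
          proof (rule ccontr)
            assume "\<psi> p' x \<noteq> 0"
            then obtain S where S: "S \<in> p'" "x \<in> interior S" using \<psi>(4)[OF pP(1)] by blast
            then have "S = T" using int_unique[OF _ T(1) S(2) T(2)] pA[OF pP(1)] AB(1) by blast
            then show False using p_unique[OF pP(1) p(1) S(1)] p(2) pP(2) by blast
          qed
          then have "(\<Sum>p'\<in>P. \<psi> p' x) = (\<Sum>p'\<in>{p}. \<psi> p' x)"
            using finP p(1) by (intro sum.mono_neutral_right) auto
          ultimately show ?thesis using err_at[OF T] \<psi>(5)[OF p T(2)] by (simp add: rest_def)
        qed
      qed
      have admB: "admissible M errB"
        unfolding errB_def[abs_def] by (rule err_adm) (use AB(1) bd MB in auto)
      have adm: "admissible M err" unfolding err_def[abs_def] by (rule err_adm[OF subset_refl bd MB(1)])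
      have [measurable]: "err \<in> borel_measurable borel" "errB \<in> borel_measurable borel"
        using adm admB by (simp_all add: admissible_def)
      have "(\<lambda>x. \<Sum>p\<in>P. \<psi> p x) \<in> borel_measurable borel"
        using \<psi>(1) by (intro borel_measurable_sum) (simp add: admissible_def)
      then have "rest \<in> borel_measurable borel" unfolding rest_def[abs_def] by measurable
      then have rest_meas: "rest \<in> borel_measurable lebesgue" by (intro measurable_completion) simp
      define G where "G x = indicator (interior \<Omega>) x * g x" for x
      have G: "integrable lebesgue G" using g' by (simp add: set_integrable_def G_def[abs_def])
      have J: "(LINT x:interior \<Omega>|lebesgue. g x * \<phi> x) = (LINT x|lebesgue. G x * \<phi> x)" for \<phi>
        by (simp add: set_lebesgue_integral_def G_def mult.assoc)
      have Gi: "integrable lebesgue (\<lambda>x. G x * \<phi> x)" if "admissible K \<phi>" for K \<phi>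
        using admissible_integrable[OF that g'] by (simp add: set_integrable_def G_def mult.assoc)
      have rest_int: "integrable lebesgue (\<lambda>x. G x * rest x)"
        by (rule integrable_mult_bounded[OF G rest_meas rest])
      have "(LINT x|lebesgue. G x * err x) = (LINT x|lebesgue. G x * errB x + (\<Sum>p\<in>P. G x * \<psi> p x) + G x * rest x)"
        by (rule Bochner_Integration.integral_cong) (simp_all add: rest_def right_diff_distrib sum_distrib_left)
      also have "\<dots> = (LINT x|lebesgue. G x * errB x) + (\<Sum>p\<in>P. LINT x|lebesgue. G x * \<psi> p x) + (LINT x|lebesgue. G x * rest x)"
        using Gi[OF admB] Gi[OF \<psi>(1)] rest_int
        by (simp add: Bochner_Integration.integral_add Bochner_Integration.integral_sum Bochner_Integration.integrable_sum)
      finally have split: "(LINT x:interior \<Omega>|lebesgue. g x * err x) = (LINT x:interior \<Omega>|lebesgue. g x * errB x)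
          + (\<Sum>p\<in>P. LINT x:interior \<Omega>|lebesgue. g x * \<psi> p x) + (LINT x:interior \<Omega>|lebesgue. g x * rest x)"
        unfolding J .

      \<comment> \<open>Estimates of strip, pairs and remainder\<close>
      have 1: "\<bar>LINT x:interior \<Omega>|lebesgue. g x * errB x\<bar> \<le> Cb * h * M * ?W"
      proof (rule Cb(2)[OF h g admB], intro allI impI)
        fix x assume "errB x \<noteq> 0"
        then obtain T where "T \<in> \<B>" "x \<in> interior T"
          unfolding errB_def by (metis (no_types, lifting) indicator_simps(2) mult_zero_left sum.neutral)
        then show "x \<in> interior \<Omega> \<and> infdist x (frontier \<Omega>) \<le> h"
          using AB(1,5) intT interior_subset by blast
      qed
      have 2: "\<bar>\<Sum>p\<in>P. LINT x:interior \<Omega>|lebesgue. g x * \<psi> p x\<bar> \<le> 32 / \<kappa> ^ 4 * h * (M + B) * ?W"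
      proof -
        let ?v = "weak_partial (interior \<Omega>)"
        have v: "set_integrable lebesgue (interior \<Omega>) (?v i g)" for i
          using W11_space_weak_partial[OF g, of i] by (simp add: has_weak_partial_def)
        have "\<bar>\<Sum>p\<in>P. LINT x:interior \<Omega>|lebesgue. g x * \<psi> p x\<bar>
          \<le> (\<Sum>p\<in>P. 8 / \<kappa>\<^sup>2 * h * (M + B) * (\<Sum>i\<in>UNIV. LINT x:ball (c p) h \<inter> interior \<Omega>|lebesgue. \<bar>?v i g x\<bar>))"
          by (intro order_trans[OF sum_abs] sum_mono pair_bound[OF \<Omega> g \<psi>(1) \<kappa>(1) h \<psi>(6) \<psi>(3) \<psi>(2)])
        also have "\<dots> = 8 / \<kappa>\<^sup>2 * h * (M + B) * (\<Sum>i\<in>UNIV. \<Sum>p\<in>P. LINT x:ball (c p) h \<inter> interior \<Omega>|lebesgue. \<bar>?v i g x\<bar>)"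
          unfolding sum_distrib_left[symmetric] by (subst sum.swap) (rule refl)
        also have "\<dots> \<le> 8 / \<kappa>\<^sup>2 * h * (M + B) * (\<Sum>i\<in>UNIV. 4 / \<kappa>\<^sup>2 * (LINT x:interior \<Omega>|lebesgue. \<bar>?v i g x\<bar>))"
        proof (intro mult_left_mono sum_mono overlap_bound[OF finP \<kappa>(1) h _ _ v open_interior])
          \<comment> \<open>The balls of two pairs lie in the interiors of different elements, hence
            are disjoint.\<close>
          fix p p' assume pp: "p \<in> P" "p' \<in> P" "p \<noteq> p'"
          obtain S T where ST: "S \<in> p" "ball (y p) (\<kappa> * h) \<subseteq> interior S" "T \<in> p'" "ball (y p') (\<kappa> * h) \<subseteq> interior T"
            using \<psi>(7)[OF pp(1)] \<psi>(7)[OF pp(2)] by blast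
          have "S \<noteq> T" using p_unique[OF pp(1,2)] ST(1,3) pp(3) by blast
          then have "interior S \<inter> interior T = {}" using disj pA pp ST AB(1) by blast
          then show "ball (y p) (\<kappa> * h) \<inter> ball (y p') (\<kappa> * h) = {}" using ST by blast
        qed (use \<psi>(6) MB h in auto)
        also have "\<dots> = 32 / \<kappa> ^ 4 * h * (M + B) * (\<Sum>i\<in>UNIV. LINT x:interior \<Omega>|lebesgue. \<bar>?v i g x\<bar>)"
          unfolding sum_distrib_left[symmetric] by (simp add: power4_eq_xxxx power2_eq_square)
        also have "\<dots> \<le> 32 / \<kappa> ^ 4 * h * (M + B) * ?W"
          using MB h W11_norm_ge(2) by (intro mult_left_mono) auto
        finally show ?thesis .
      qed
      have 3: "\<bar>LINT x:interior \<Omega>|lebesgue. g x * rest x\<bar> \<le> B * ?W"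
      proof -
        have "\<bar>LINT x|lebesgue. G x * rest x\<bar> \<le> B * (LINT x|lebesgue. \<bar>G x\<bar>)"
          by (rule abs_integral_mult_le[OF G rest_meas rest])
        also have "(LINT x|lebesgue. \<bar>G x\<bar>) = (LINT x:interior \<Omega>|lebesgue. \<bar>g x\<bar>)"
          by (simp add: set_lebesgue_integral_def G_def abs_mult)
        also have "B * \<dots> \<le> B * ?W" using MB W11_norm_ge(1) by (intro mult_left_mono)
        finally show ?thesis unfolding J .
      qed
      \<comment> \<open>The power of h gained from g turns the local order into the target
        order.\<close>
      have hM: "h * M = B" by (simp add: M_def B_def hp)
      have "h * (M + B) \<le> (1 + H) * B"
        using mult_right_mono[OF hH MB(2)] hM by (simp add: distrib_left distrib_right)
      then have 4: "32 / \<kappa> ^ 4 * ?W * (h * (M + B)) \<le> 32 / \<kappa> ^ 4 * ?W * ((1 + H) * B)"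
        using W0 \<kappa>(1) by (intro mult_left_mono) auto
      have r1: "Cb * h * M * ?W = Cb * ?W * B" by (simp add: hM[symmetric])
      have r2: "32 / \<kappa> ^ 4 * h * (M + B) * ?W = 32 / \<kappa> ^ 4 * ?W * (h * (M + B))"
        by (simp only: mult_ac)
      have "\<bar>LINT x:interior \<Omega>|lebesgue. g x * err x\<bar> \<le> Cb * ?W * B + 32 / \<kappa> ^ 4 * ?W * ((1 + H) * B) + B * ?W"
        unfolding split using 1[unfolded r1] 2[unfolded r2] 3 4 by linarith
      also have "\<dots> = (Ct - 1) * (h ^ (Suc (Suc k) - l) * ?N * ?W)"
        by (simp add: Ct_def B_def algebra_simps add_divide_distrib)
      also have "\<dots> \<le> Ct * (h ^ (Suc (Suc k) - l) * ?N * ?W)"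
        using h N0 W0 by (intro mult_right_mono) auto
      finally show ?thesis by (subst sum_eq[OF bd MB(1)]) (simp_all add: l_def mult_ac)
    qed
  qed
qed

end
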